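(* For every $x\in E$, $$\lim_{h\to0}\inf_{V\in\mathbb V_h}J^d(x,V)=\inf_{V\in\mathbb V}J^d(x,V).$$
   Context: Process. $X=(X_t)_{t\ge0}$ is a continuous-time standard Feller–Markov process on a filtered space $(\Omega,\mathcal F,(\mathcal F_t))$ (standard in the usual sense of Markov process theory) with values in a compact metric space $(E,\rho)$ with Borel $\sigma$-field $\mathcal E$; $\mathbb P_x,\mathbb E_x$ are the law and expectation for the process started at $x\in E$, and $P_t(x,A):=\mathbb P_x[X_t\in A]$. The set of admissible after-impulse states is $U=E$. $\mathcal C_b(E)$ is the space of bounded continuous real functions on $E$. Standing assumptions. (1) $\beta:[0,\infty)\to(0,1]$ is weakly decreasing and continuous, $\beta(0)=1$, $\beta(t+s)\ge\beta(t)\beta(s)$ for all $t,s\ge0$, and $\int_0^\infty\beta(s)ds=\infty$. (2) $g:E\to\mathbb R$ is continuous and bounded; $c:E\times U\to\mathbb R_+$ is continuous and bounded, and for some $c_0>0$ we have $0<c_0\le c(x,\xi)\le c(x,\eta)+c(\eta,\xi)$ for $x,\xi,\eta\in E$. (3) For every $f\in\mathcal C_b(E)$ and $t>0$, the map $x\mapsto\mathbb E_x[f(X_t)]$ is in $\mathcal C_b(E)$. (4) For every $t>0$ there is $\Lambda_t\in(0,1)$ with $\sup_{x,y\in E}\sup_{A\in\mathcal E}|P_t(x,A)-P_t(y,A)|\le\Lambda_t$. Impulse control. A strategy is a sequence $V=(\tau_i,\xi_i)_{i=1}^\infty$ with $(\tau_i)$ an increasing (weakly, values in $[0,\infty]$)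 sequence of stopping times and $\xi_i$ $\mathcal F_{\tau_i}$-measurable $U$-valued random variables; $\mathbb V$ is the family of all strategies, and for $h>0$, $\mathbb V_h\subset\mathbb V$ consists of those with impulse times restricted to $\{0,h,2h,\dots\}$ (or $\infty$, i.e. no impulse). On a countable product of copies of $(\Omega,\mathcal F,(\mathcal F_t))$ with coordinate process $(X^1_t,X^2_t,\dots)$, to each $x\in E$ and $V\in\mathbb V$ one associates a probability $\mathbb P^V_x$ (expectation $\mathbb E^V_x$) under which $X^1$ follows the uncontrolled dynamics from $x$ and, for each $i\ge1$, on $\{\tau_i<\infty\}$, $X^{i+1}_{\tau_i}=\xi_i$ and from time $\tau_i$ on $X^{i+1}$ follows the uncontrolled dynamics started afresh from $\xi_i$ (conditionally on the past). The controlled process is $Y_t:=X^i_t$ for $t\in[\tau_{i-1},\tau_i)$, $\tau_0\equiv0$. Functional. For $x\in E$ and $V\in\mathbb V$, $$J^d(x,V):=\limsup_{T\to\infty}\frac{\mathbb E^V_x\bigl[\int_0^T\beta(s)g(Y_s)ds+\sum_{i=1}^\infty1_{\{\tau_i\le T\}}\beta(\tau_i)c(X^i_{\tau_i},X^{i+1}_{\tau_i})\bigr]}{\int_0^T\beta(s)ds}.$$ *)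

theory Defs
  imports "HOL-Probability.Probability"
begin

text \<open>
  Time is \<open>[0,\<infinity>)\<close>, rendered by nonnegative reals for paths and by \<^typ>\<open>ennreal\<close> for filtrations
  and stopping times.  A filtered space \<open>(\<Omega>, \<F>, (\<F>\<^sub>t))\<close> is one family \<open>F\<close> indexed by \<^typ>\<open>ennreal\<close>
  with \<open>F \<infinity> = \<F>\<close>, so that \<^const>\<open>stopping_time\<close> and \<^const>\<open>filtration.pre_sigma\<close> yield
  \<open>[0,\<infinity>]\<close>-valued stopping times and the usual \<open>\<F>\<^sub>\<tau> = {A \<in> \<F>. \<forall>t. A \<inter> {\<tau> \<le> t} \<in> \<F>\<^sub>t}\<close>.
\<close>

section \<open>Standard Markov processes\<close>

definition trans_prob ::
    "(real \<Rightarrow> 'w \<Rightarrow> 'e::polish_space) \<Rightarrow> ('e \<Rightarrow> 'w measure) \<Rightarrow> real \<Rightarrow> 'e \<Rightarrow> 'e set \<Rightarrow> real" where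
  "trans_prob X P t x B = measure (P x) {\<omega> \<in> space (P x). X t \<omega> \<in> B}"

locale markov_process = filtration \<Omega> F
  for \<Omega> :: "'w set" and F :: "ennreal \<Rightarrow> 'w measure" +
  fixes X :: "real \<Rightarrow> 'w \<Rightarrow> 'e::polish_space" and P :: "'e \<Rightarrow> 'w measure"
  assumes prob_space_P: "\<And>x. prob_space (P x)"
    and sets_P: "\<And>x. sets (P x) = sets (F \<infinity>)"
    and adapted: "\<And>t. 0 \<le> t \<Longrightarrow> X t \<in> F (ennreal t) \<rightarrow>\<^sub>M borel"
    and measurable_trans_prob:
      "\<And>t B. 0 \<le> t \<Longrightarrow> B \<in> sets borel \<Longrightarrow> (\<lambda>x. trans_prob X P t x B) \<in> borel_measurable borel"
    and normal: "\<And>x. AE \<omega> in P x. X 0 \<omega> = x"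
    and markov: "\<And>x s t A B. 0 \<le> s \<Longrightarrow> 0 \<le> t \<Longrightarrow> A \<in> sets (F (ennreal t)) \<Longrightarrow> B \<in> sets borel \<Longrightarrow>
      measure (P x) {\<omega> \<in> A. X (t + s) \<omega> \<in> B} = (LINT \<omega>:A|P x. trans_prob X P s (X t \<omega>) B)"

text \<open>
  A standard process in the sense of Blumenthal and Getoor with infinite lifetime.  Completeness of
  the filtration is deliberately not demanded: complete and non-complete right-continuous
  filtrations are both covered.  (The laws of the controlled process introduced below are in general
  not absolutely continuous with respect to the laws \<open>P x\<close>, so they need not be defined on sets that
  are only measurable for the \<open>P\<close>-completion.)
\<close>

locale standard_process = markov_process +
  assumes right_continuous_filtration:
      "\<And>t. t < \<infinity> \<Longrightarrow> sets (F t) = (\<Inter>s\<in>{t<..}. sets (F s))"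
    and right_continuous_paths:
      "\<And>\<omega> t. \<omega> \<in> \<Omega> \<Longrightarrow> 0 \<le> t \<Longrightarrow> continuous (at_right t) (\<lambda>s. X s \<omega>)"
    and left_limits: "\<And>\<omega> t. \<omega> \<in> \<Omega> \<Longrightarrow> 0 < t \<Longrightarrow> \<exists>l. ((\<lambda>s. X s \<omega>) \<longlongrightarrow> l) (at_left t)"
    and strong_markov:
      "\<And>x T s A B. stopping_time F T \<Longrightarrow> A \<in> sets (pre_sigma T) \<Longrightarrow> 0 \<le> s \<Longrightarrow> B \<in> sets borel \<Longrightarrow>
        measure (P x) {\<omega> \<in> A. T \<omega> < \<infinity> \<and> X (enn2real (T \<omega>) + s) \<omega> \<in> B} =
        (LINT \<omega>:{\<omega> \<in> A. T \<omega> < \<infinity>}|P x. trans_prob X P s (X (enn2real (T \<omega>)) \<omega>) B)"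
    and quasi_left_continuous:
      "\<And>x T. (\<And>n. stopping_time F (T n)) \<Longrightarrow> (\<And>n \<omega>. \<omega> \<in> \<Omega> \<Longrightarrow> T n \<omega> \<le> T (Suc n) \<omega>) \<Longrightarrow>
        AE \<omega> in P x. (SUP n. T n \<omega>) < \<infinity> \<longrightarrow>
          (\<lambda>n. X (enn2real (T n \<omega>)) \<omega>) \<longlonglongrightarrow> X (enn2real (SUP n. T n \<omega>)) \<omega>"

section \<open>Strategies\<close>

text \<open>
  The countable product of copies of \<open>\<Omega>\<close> is indexed by \<open>i = 1, 2, \<dots>\<close>; its points are extensional
  functions \<open>\<omega>\<close> on \<open>{1..}\<close>, and the coordinate process is \<open>X\<^sup>i\<^sub>t(\<omega>) = X t (\<omega> i)\<close>.
\<close>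

definition prod_filtration ::
    "'w set \<Rightarrow> (ennreal \<Rightarrow> 'w measure) \<Rightarrow> nat \<Rightarrow> ennreal \<Rightarrow> (nat \<Rightarrow> 'w) measure" where
  \<comment> \<open>\<open>\<F>\<^sub>t \<otimes> \<dots> \<otimes> \<F>\<^sub>t\<close> (\<open>i\<close> factors) \<open>\<otimes> {\<emptyset>,\<Omega>} \<otimes> {\<emptyset>,\<Omega>} \<otimes> \<dots>\<close>: the information up to time \<open>t\<close>
    carried by the first \<open>i\<close> copies\<close>
  "prod_filtration \<Omega> F i t = (\<Pi>\<^sub>M j\<in>{1..}. if j \<le> i then F t else sigma \<Omega> {})"

type_synonym ('w, 'e) strategy =
  "(nat \<Rightarrow> (nat \<Rightarrow> 'w) \<Rightarrow> ennreal) \<times> (nat \<Rightarrow> (nat \<Rightarrow> 'w) \<Rightarrow> 'e)"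

text \<open>
  The impulses of \<open>(\<tau>, \<xi>)\<close> are \<open>(\<tau> i, \<xi> i)\<close> for \<open>i \<ge> 1\<close>; \<open>\<tau> 0\<close> is the convention \<open>\<tau>\<^sub>0 \<equiv> 0\<close> and \<open>\<xi> 0\<close>
  is never used.  As the copy \<open>i + 1\<close> is only launched by the \<open>i\<close>-th impulse, the decision
  \<open>(\<tau> i, \<xi> i)\<close> may depend on the first \<open>i\<close> copies only.
\<close>

definition strategies ::
    "'w set \<Rightarrow> (ennreal \<Rightarrow> 'w measure) \<Rightarrow> ('w, 'e::polish_space) strategy set" where
  "strategies \<Omega> F = {(\<tau>, \<xi>).
     \<tau> 0 = (\<lambda>_. 0) \<and>
     (\<forall>i. \<forall>\<omega>\<in>(\<Pi>\<^sub>E j\<in>{1..}. \<Omega>). \<tau> i \<omega> \<le> \<tau> (Suc i) \<omega>) \<and>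
     (\<forall>i\<ge>1. stopping_time (prod_filtration \<Omega> F i) (\<tau> i) \<and>
       \<xi> i \<in> filtration.pre_sigma (\<Pi>\<^sub>E j\<in>{1..}. \<Omega>) (prod_filtration \<Omega> F i) (\<tau> i) \<rightarrow>\<^sub>M borel)}"

definition grid_strategies ::
    "'w set \<Rightarrow> (ennreal \<Rightarrow> 'w measure) \<Rightarrow> real \<Rightarrow> ('w, 'e::polish_space) strategy set" where
  "grid_strategies \<Omega> F h = {(\<tau>, \<xi>). (\<tau>, \<xi>) \<in> strategies \<Omega> F \<and>
     (\<forall>i\<ge>1. \<forall>\<omega>\<in>(\<Pi>\<^sub>E j\<in>{1..}. \<Omega>). \<tau> i \<omega> = \<infinity> \<or> (\<exists>n::nat. \<tau> i \<omega> = ennreal (real n * h)))}"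

section \<open>The controlled process\<close>

text \<open>
  \<open>controlled_law \<Omega> F X P x V M\<close>: \<open>M\<close> is a law on the product of the copies as required of \<open>\<P>\<^sub>x\<^sup>V\<close>.  The
  first copy has law \<open>P x\<close>.  On \<open>{\<tau> i < \<infinity>}\<close> the copy \<open>i + 1\<close> is at \<open>\<xi> i\<close> at time \<open>\<tau> i\<close> and from then
  on evolves with the transition probabilities of \<open>X\<close>, conditionally on everything the first
  \<open>i + 1\<close> copies reveal up to the present time.  Its behaviour before \<open>\<tau> i\<close> is left unspecified.
\<close>

definition controlled_law ::
    "'w set \<Rightarrow> (ennreal \<Rightarrow> 'w measure) \<Rightarrow> (real \<Rightarrow> 'w \<Rightarrow> 'e::polish_space) \<Rightarrow> ('e \<Rightarrow> 'w measure) \<Rightarrow>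
      'e \<Rightarrow> ('w, 'e) strategy \<Rightarrow> (nat \<Rightarrow> 'w) measure \<Rightarrow> bool" where
  "controlled_law \<Omega> F X P x V M \<longleftrightarrow> (case V of (\<tau>, \<xi>) \<Rightarrow>
     prob_space M \<and>
     sets M = sets (\<Pi>\<^sub>M j\<in>{1..}. F \<infinity>) \<and>
     distr M (F \<infinity>) (\<lambda>\<omega>. \<omega> 1) = P x \<and>
     (\<forall>i\<ge>1. AE \<omega> in M. \<tau> i \<omega> < \<infinity> \<longrightarrow> X (enn2real (\<tau> i \<omega>)) (\<omega> (Suc i)) = \<xi> i \<omega>) \<and>
     (\<forall>i\<ge>1. \<forall>t\<ge>0. \<forall>s\<ge>0. \<forall>A\<in>sets (prod_filtration \<Omega> F (Suc i) (ennreal t)). \<forall>B\<in>sets borel.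
        A \<subseteq> {\<omega>. \<tau> i \<omega> \<le> ennreal t} \<longrightarrow>
        measure M {\<omega> \<in> A. X (t + s) (\<omega> (Suc i)) \<in> B} =
        (LINT \<omega>:A|M. trans_prob X P s (X t (\<omega> (Suc i))) B)))"

text \<open>
  The value at times \<open>t \<ge> sup\<^sub>i \<tau> i\<close> is immaterial: if such times occur before some finite \<open>T\<close> with
  positive probability, then the expected impulse cost up to \<open>T\<close> is infinite.
\<close>

definition controlled_process ::
    "(real \<Rightarrow> 'w \<Rightarrow> 'e) \<Rightarrow> ('w, 'e) strategy \<Rightarrow> real \<Rightarrow> (nat \<Rightarrow> 'w) \<Rightarrow> 'e" where
  "controlled_process X V t \<omega> = (case V of (\<tau>, \<xi>) \<Rightarrow>
     if \<exists>i\<ge>1. \<tau> (i - 1) \<omega> \<le> ennreal t \<and> ennreal t < \<tau> i \<omega>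
     then X t (\<omega> (THE i. i \<ge> 1 \<and> \<tau> (i - 1) \<omega> \<le> ennreal t \<and> ennreal t < \<tau> i \<omega>))
     else undefined)"

text \<open>
  The running costs are bounded and the impulse costs nonnegative, possibly of infinite
  expectation; hence the split of the expectation and the value in \<^typ>\<open>ereal\<close>.
\<close>

definition expected_cost ::
    "(real \<Rightarrow> 'w \<Rightarrow> 'e) \<Rightarrow> (real \<Rightarrow> real) \<Rightarrow> ('e \<Rightarrow> real) \<Rightarrow> ('e \<Rightarrow> 'e \<Rightarrow> real) \<Rightarrow>
      (nat \<Rightarrow> 'w) measure \<Rightarrow> ('w, 'e) strategy \<Rightarrow> real \<Rightarrow> ereal" where
  "expected_cost X \<beta> g c M V T = (case V of (\<tau>, \<xi>) \<Rightarrow>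
     ereal (LINT \<omega>|M. (LINT s:{0..T}|lborel. \<beta> s * g (controlled_process X V s \<omega>))) +
     enn2ereal (\<integral>\<^sup>+ \<omega>. (\<Sum>k. let i = Suc k; t = enn2real (\<tau> i \<omega>) in
       if \<tau> i \<omega> \<le> ennreal T then ennreal (\<beta> t * c (X t (\<omega> i)) (X t (\<omega> (Suc i)))) else 0) \<partial>M))"

definition discounted_average_cost ::
    "(real \<Rightarrow> 'w \<Rightarrow> 'e) \<Rightarrow> (real \<Rightarrow> real) \<Rightarrow> ('e \<Rightarrow> real) \<Rightarrow> ('e \<Rightarrow> 'e \<Rightarrow> real) \<Rightarrow>
      (nat \<Rightarrow> 'w) measure \<Rightarrow> ('w, 'e) strategy \<Rightarrow> ereal" where
  "discounted_average_cost X \<beta> g c M V =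
     Limsup at_top (\<lambda>T. expected_cost X \<beta> g c M V T / ereal (LINT s:{0..T}|lborel. \<beta> s))"

end

theory Submission
  imports Defs
begin

text \<open>
  A grid strategy is a strategy, so passing to the grid can only increase the infimum.  It remains to
  show that, for small \<open>h\<close>, some grid strategy costs at most \<open>\<epsilon>\<close> more than any strategy.  Both costs are
  compared with a number \<open>\<mu>\<close> that comes from a dynamic programming equation on the grid \<open>{0, h, 2h, \<dots>}\<close>.

  \<^emph>\<open>The equation.\<close>  Write \<open>g\<^sub>h(x)\<close> for the expected running cost over one cell of the grid and
  \<open>M u(x) = inf\<^sub>\<xi> (c(x,\<xi>) + u(\<xi>))\<close>.  For \<open>\<rho> < 1\<close> the equation \<open>v = min (L v) (M (L v))\<close> with
  \<open>L v = g\<^sub>h + \<rho> P\<^sub>h v\<close> has a continuous solution by Banach's theorem (\<open>discounted_bellman\<close>).  The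
  triangle inequality for \<open>c\<close> gives \<open>v(x) \<le> c(x,\<xi>) + v(\<xi>)\<close>, so the oscillation of \<open>v\<close> is at most
  \<open>sup c\<close>, however close \<open>\<rho>\<close> is to 1.  Subtracting the value at one point and letting \<open>\<rho>\<close> approach 1
  therefore yields functions with \<open>v = min u (M u)\<close> and \<open>u \<approx> g\<^sub>h + P\<^sub>h v - \<mu> h\<close>, with an error as small
  as desired (\<open>approximate_bellman\<close>).

  \<^emph>\<open>Grid strategies reach \<open>\<mu>\<close>.\<close>  Shift the process at a grid time exactly if \<open>M u < u\<close> at its
  current state, and then to a measurably chosen near-minimizer.  Along this strategy the equation
  telescopes and gives average cost at most \<open>\<mu>\<close> up to a small error (\<open>grid_upper_bound\<close>).

  \<^emph>\<open>No strategy does much better.\<close>  An arbitrary strategy is observed at grid times only.  Let the copy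
  that is alive at the beginning of a cell run on to the end of the cell, and there pass through the
  copies started in between, one after the other, using \<open>v(x) \<le> c(x,\<xi>) + v(\<xi>)\<close>.  So an impulse inside
  the cell is paid at the end of the cell.  In the meantime the two copies involved have moved only
  little, uniformly in the state (\<open>uniform_stochastic_continuity\<close>), so the cost changes by a small
  amount in expectation, and the running cost is altered by at most \<open>2 h sup \<bar>g\<bar>\<close>.  As every impulse
  costs at least \<open>c\<^sub>0\<close>, both errors are a small fraction of the impulse costs themselves, whatever the
  number of impulses (\<open>expected_intervention_step\<close>, \<open>lower_bound_grid\<close>).

  \<^emph>\<open>The weight \<open>\<beta>\<close>.\<close>  Replacing \<open>\<beta>\<close> by its values at grid times and summing by parts costs a bounded
  amount, independent of the horizon (\<open>discounted_telescope\<close>), which is negligible against the divergent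
  \<open>\<integral>\<beta>\<close>; for the impulse costs \<open>\<beta>(t + s) \<ge> \<beta>(t) \<beta>(s)\<close> limits the loss to a factor \<open>\<beta>(h)\<close>, close to 1.

  \<^emph>\<open>Uniform smallness of displacements.\<close>  If \<open>u \<ge> 0\<close> is continuous and \<open>e\<^sup>-\<^sup>p\<^sup>r P\<^sub>r u \<le> u\<close>, then
  \<open>e\<^sup>-\<^sup>p\<^sup>r E\<^sub>x[min (u(X\<^sub>r)) (u(x))]\<close> increases to \<open>u(x)\<close> as \<open>r\<close> decreases to 0, hence uniformly by Dini's
  theorem, and so \<open>E\<^sub>x\<bar>u(X\<^sub>r) - u(x)\<bar>\<close> tends to 0 uniformly (\<open>supermedian_increment\<close>).  Resolvents are
  such functions, and they separate points; by compactness finitely many of them control the metric.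
\<close>

section \<open>Transition operators of a Markov process\<close>

text \<open>
  Evaluating at the first point of the grid of mesh \<open>1/(n+1)\<close> strictly to the right of the current time
  gives a measurable function, and right-continuity makes these converge.  The cut-off \<open>max 0\<close> lets the
  time variable range over the whole line, where Lebesgue measure lives.
\<close>

lemma jointly_measurable_right_continuous:
  fixes Z :: "real \<Rightarrow> 'a \<Rightarrow> 'b::metric_space"
  assumes meas: "\<And>t. 0 \<le> t \<Longrightarrow> Z t \<in> borel_measurable M"
    and rc: "\<And>\<omega> t. \<omega> \<in> space M \<Longrightarrow> 0 \<le> t \<Longrightarrow> continuous (at_right t) (\<lambda>s. Z s \<omega>)"
  shows "(\<lambda>p. Z (max 0 (fst p)) (snd p)) \<in> borel_measurable (borel \<Otimes>\<^sub>M M)"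
proof -
  define q where "q n s = (real_of_int \<lfloor>real (Suc n) * max 0 s\<rfloor> + 1) / real (Suc n)" for n s
  have q_gt: "max 0 s < q n s" for n s
  proof -
    have "real (Suc n) * max 0 s < real_of_int \<lfloor>real (Suc n) * max 0 s\<rfloor> + 1" by linarith
    then show ?thesis unfolding q_def by (subst pos_less_divide_eq) (simp_all add: mult.commute del: of_nat_Suc)
  qed
  have q_le: "q n s \<le> max 0 s + 1 / real (Suc n)" for n s
  proof -
    have "real_of_int \<lfloor>real (Suc n) * max 0 s\<rfloor> \<le> real (Suc n) * max 0 s" by linarith
    then show ?thesis unfolding q_def by (subst pos_divide_le_eq) (simp_all add: algebra_simps del: of_nat_Suc)
  qed
  have lim: "filterlim (\<lambda>n. q n s) (at_right (max 0 s)) sequentially" for s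
  proof (rule tendsto_imp_filterlim_at_right)
    have "(\<lambda>n. max 0 s + 1 / real (Suc n)) \<longlonglongrightarrow> max 0 s + 0"
      by (intro tendsto_intros LIMSEQ_Suc[OF lim_1_over_n])
    then have "(\<lambda>n. max 0 s + 1 / real (Suc n)) \<longlonglongrightarrow> max 0 s" by simp
    note up = this
    have lo: "\<forall>\<^sub>F n in sequentially. max 0 s \<le> q n s" "\<forall>\<^sub>F n in sequentially. q n s \<le> max 0 s + 1 / real (Suc n)"
      using q_le less_imp_le[OF q_gt] by (auto simp del: of_nat_Suc max.bounded_iff)
    show "(\<lambda>n. q n s) \<longlonglongrightarrow> max 0 s"
      by (rule tendsto_sandwich[OF lo tendsto_const up])
  qed (intro always_eventually allI q_gt)
  show ?thesis
  proof (rule borel_measurable_LIMSEQ_metric)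
    fix n
    have "(\<lambda>p. (\<lambda>k p. Z (max 0 ((real_of_int k + 1) / real (Suc n))) (snd p))
             (\<lfloor>real (Suc n) * max 0 (fst p)\<rfloor>) p) \<in> borel_measurable (borel \<Otimes>\<^sub>M M)"
    proof (rule measurable_compose_countable[where f="\<lambda>k p. Z (max 0 ((real_of_int k + 1) / real (Suc n))) (snd p)"
          and g="\<lambda>p. \<lfloor>real (Suc n) * max 0 (fst p)\<rfloor>"])
      show "(\<lambda>p. Z (max 0 ((real_of_int k + 1) / real (Suc n))) (snd p)) \<in> borel_measurable (borel \<Otimes>\<^sub>M M)" for k
        by (rule measurable_compose[OF measurable_snd meas]) simp
      show "(\<lambda>p::real \<times> 'a. \<lfloor>real (Suc n) * max 0 (fst p)\<rfloor>) \<in> borel \<Otimes>\<^sub>M M \<rightarrow>\<^sub>M count_space UNIV"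
        by measurable
    qed
    moreover have "max 0 (q n s) = q n s" for s
      using q_gt[of s n] by (intro max_absorb2) linarith
    ultimately show "(\<lambda>p. Z (q n (fst p)) (snd p)) \<in> borel_measurable (borel \<Otimes>\<^sub>M M)"
      by (simp add: q_def)
  next
    fix p :: "real \<times> 'a" assume "p \<in> space (borel \<Otimes>\<^sub>M M)"
    then have "snd p \<in> space M" by (auto simp: space_pair_measure)
    then have "((\<lambda>s. Z s (snd p)) \<longlongrightarrow> Z (max 0 (fst p)) (snd p)) (at_right (max 0 (fst p)))"
      using rc[of "snd p" "max 0 (fst p)"] by (simp add: continuous_within)
    then show "(\<lambda>n. Z (q n (fst p)) (snd p)) \<longlonglongrightarrow> Z (max 0 (fst p)) (snd p)"
      by (rule filterlim_compose[OF _ lim])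
  qed
qed

context markov_process
begin

definition transition :: "real \<Rightarrow> ('e \<Rightarrow> real) \<Rightarrow> 'e \<Rightarrow> real" where
  "transition s f x = (LINT \<omega>|P x. f (X s \<omega>))"

lemma space_P: "space (P x) = \<Omega>"
  using sets_eq_imp_space_eq[OF sets_P[of x]] by (simp add: space_F)

lemma X_measurable_F: "0 \<le> t \<Longrightarrow> X t \<in> borel_measurable (F \<infinity>)"
  using measurable_mono[OF order_refl refl sets_F_mono[of "ennreal t" \<infinity>]] adapted[of t]
  by (auto simp: space_F)

lemma X_measurable_P: "0 \<le> t \<Longrightarrow> X t \<in> borel_measurable (P x)"
  using X_measurable_F measurable_cong_sets[OF sets_P[of x] refl] by blast

lemma P_integrable_bounded:
  assumes "0 \<le> s" "f \<in> borel_measurable borel" "\<And>y. \<bar>f y\<bar> \<le> (K::real)"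
  shows "integrable (P x) (\<lambda>\<omega>. f (X s \<omega>))"
proof -
  interpret prob_space "P x" by (rule prob_space_P)
  show ?thesis
    using assms X_measurable_P[of s x]
    by (intro integrable_const_bound[where B=K]) auto
qed

lemma transition_bounded:
  assumes "0 \<le> s" "f \<in> borel_measurable borel" "\<And>y. \<bar>f y\<bar> \<le> K"
  shows "\<bar>transition s f x\<bar> \<le> K"
proof -
  interpret prob_space "P x" by (rule prob_space_P)
  have "\<bar>transition s f x\<bar> \<le> (LINT \<omega>|P x. \<bar>f (X s \<omega>)\<bar>)"
    unfolding transition_def by (rule integral_abs_bound)
  also have "\<dots> \<le> (LINT \<omega>|P x. K)"
    using P_integrable_bounded[OF assms] assms(3) by (intro integral_mono) auto
  finally show ?thesis by (simp add: prob_space)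
qed

lemma transition_mono:
  assumes "0 \<le> s" "f \<in> borel_measurable borel" "\<And>y. \<bar>f y\<bar> \<le> K"
    and "f' \<in> borel_measurable borel" "\<And>y. \<bar>f' y\<bar> \<le> K'" "\<And>y. f y \<le> f' y"
  shows "transition s f x \<le> transition s f' x"
  unfolding transition_def
  using P_integrable_bounded[OF assms(1-3)] P_integrable_bounded[OF assms(1,4,5)] assms(6)
  by (intro integral_mono) auto

lemma transition_diff:
  assumes "0 \<le> s" "f \<in> borel_measurable borel" "\<And>y. \<bar>f y\<bar> \<le> K"
    and "f' \<in> borel_measurable borel" "\<And>y. \<bar>f' y\<bar> \<le> K'"
  shows "transition s (\<lambda>y. f y - f' y) x = transition s f x - transition s f' x"
  unfolding transition_def
  using P_integrable_bounded[OF assms(1-3)] P_integrable_bounded[OF assms(1,4,5)]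
  by (intro Bochner_Integration.integral_diff) auto

lemma transition_const: "transition s (\<lambda>y. k) x = k"
proof -
  interpret prob_space "P x" by (rule prob_space_P)
  show ?thesis by (simp add: transition_def prob_space)
qed

lemma transition_0: "f \<in> borel_measurable borel \<Longrightarrow> transition 0 f x = f x"
proof -
  interpret prob_space "P x" by (rule prob_space_P)
  assume [measurable]: "f \<in> borel_measurable borel"
  note X_measurable_P[of 0 x, simplified, measurable]
  have "transition 0 f x = (LINT \<omega>|P x. f x)"
    unfolding transition_def using normal[of x] by (intro integral_cong_AE) auto
  then show ?thesis by (simp add: prob_space)
qed

definition kernel :: "real \<Rightarrow> 'e \<Rightarrow> 'e measure" where
  "kernel s x = distr (P x) borel (X s)"

lemma emeasure_kernel:
  assumes "0 \<le> s" "B \<in> sets borel"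
  shows "emeasure (kernel s x) B = ennreal (trans_prob X P s x B)"
proof -
  interpret prob_space "P x" by (rule prob_space_P)
  have "{\<omega> \<in> space (P x). X s \<omega> \<in> B} = X s -` B \<inter> space (P x)" by auto
  then show ?thesis
    unfolding kernel_def trans_prob_def
    using emeasure_distr[OF X_measurable_P[OF assms(1), of x] assms(2)] by (simp add: emeasure_eq_measure)
qed

lemma kernel_measurable:
  assumes s: "0 \<le> s" shows "kernel s \<in> borel \<rightarrow>\<^sub>M subprob_algebra borel"
proof (rule measurable_subprob_algebra)
  show "subprob_space (kernel s x)" for x
    unfolding kernel_def
    by (intro prob_space_imp_subprob_space prob_space.prob_space_distr prob_space_P X_measurable_P s)
  show "(\<lambda>x. emeasure (kernel s x) B) \<in> borel_measurable borel" if "B \<in> sets borel" for B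
    using measurable_trans_prob[OF s that] by (simp add: emeasure_kernel[OF s that])
qed (simp add: kernel_def)

lemma transition_kernel:
  "0 \<le> s \<Longrightarrow> f \<in> borel_measurable borel \<Longrightarrow> transition s f x = (LINT y|kernel s x. f y)"
  unfolding transition_def kernel_def by (rule integral_distr[OF X_measurable_P, symmetric])

lemma transition_measurable:
  assumes "0 \<le> s" "f \<in> borel_measurable borel"
  shows "transition s f \<in> borel_measurable borel"
proof -
  have "transition s f = (\<lambda>x. LINT y|kernel s x. f y)" using transition_kernel[OF assms] by auto
  then show ?thesis
    using measurable_compose[OF kernel_measurable integral_measurable_subprob_algebra] assms by simp
qed

text \<open>
  The laws of \<open>W\<close> on \<open>A\<close> and of a step of length \<open>s\<close> started from \<open>U\<close> on \<open>A\<close> are the same measure.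
  \<open>U\<close> and \<open>W\<close> are left arbitrary, because the identity is needed for the process itself under \<open>P x\<close> and
  also for the copies of it under the controlled laws.
\<close>

lemma markov_nn_integral:
  assumes fin: "finite_measure M" and A: "A \<in> sets M" and s: "0 \<le> s"
    and U: "U \<in> borel_measurable M" and W: "W \<in> borel_measurable M"
    and eq: "\<And>B. B \<in> sets borel \<Longrightarrow>
      measure M {\<omega> \<in> A. W \<omega> \<in> B} = (LINT \<omega>:A|M. trans_prob X P s (U \<omega>) B)"
    and f: "f \<in> borel_measurable borel"
  shows "(\<integral>\<^sup>+ \<omega>. indicator A \<omega> * f (W \<omega>) \<partial>M)
       = (\<integral>\<^sup>+ \<omega>. indicator A \<omega> * (\<integral>\<^sup>+ y. f y \<partial>kernel s (U \<omega>)) \<partial>M)"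
proof -
  interpret finite_measure M by (rule fin)
  note [measurable] = A U W f kernel_measurable[OF s]
  define N where "N = density M (indicator A)"
  have [measurable]: "U \<in> borel_measurable N" "W \<in> borel_measurable N" by (simp_all add: N_def)
  have ne: "space (distr N borel U) \<noteq> {}" by simp
  have km: "kernel s \<in> distr N borel U \<rightarrow>\<^sub>M subprob_algebra borel" by simp
  have "distr N borel W = distr N borel U \<bind> kernel s"
  proof (rule measure_eqI)
    show "sets (distr N borel W) = sets (distr N borel U \<bind> kernel s)"
      using ne by (subst sets_bind[where N=borel]) (auto simp: kernel_def)
    fix B assume "B \<in> sets (distr N borel W)"
    then have B [measurable]: "B \<in> sets borel" by simp
    have tp1: "0 \<le> trans_prob X P s x B \<and> trans_prob X P s x B \<le> 1" for x
      unfolding trans_prob_def using prob_space.prob_le_1[OF prob_space_P] by simp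
    note [measurable] = measurable_trans_prob[OF s B]
    have [measurable]: "(\<lambda>x. emeasure (kernel s x) B) \<in> borel_measurable borel"
      unfolding emeasure_kernel[OF s B] by measurable
    have AB: "{\<omega> \<in> A. W \<omega> \<in> B} = A \<inter> (W -` B \<inter> space M)" using sets.sets_into_space[OF A] by auto
    have WB [measurable]: "W -` B \<inter> space M \<in> sets M" by measurable
    have "emeasure (distr N borel W) B = emeasure N (W -` B \<inter> space M)"
      by (simp add: emeasure_distr N_def)
    also have "\<dots> = (\<integral>\<^sup>+ \<omega>. indicator A \<omega> * indicator (W -` B \<inter> space M) \<omega> \<partial>M)"
      unfolding N_def by (rule emeasure_density) measurable
    also have "\<dots> = (\<integral>\<^sup>+ \<omega>. indicator {\<omega> \<in> A. W \<omega> \<in> B} \<omega> \<partial>M)"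
      unfolding AB by (simp add: indicator_inter_arith)
    also have "\<dots> = emeasure M {\<omega> \<in> A. W \<omega> \<in> B}"
      unfolding AB by (rule nn_integral_indicator) measurable
    also have "\<dots> = ennreal (LINT \<omega>|M. indicator A \<omega> * trans_prob X P s (U \<omega>) B)"
      by (simp add: emeasure_eq_measure eq[OF B] set_lebesgue_integral_def)
    also have "\<dots> = (\<integral>\<^sup>+ \<omega>. ennreal (indicator A \<omega> * trans_prob X P s (U \<omega>) B) \<partial>M)"
      using tp1
      by (intro nn_integral_eq_integral[symmetric] integrable_const_bound[where B=1]) (auto simp: indicator_def)
    also have "\<dots> = (\<integral>\<^sup>+ \<omega>. indicator A \<omega> * emeasure (kernel s (U \<omega>)) B \<partial>M)"
      by (intro nn_integral_cong) (auto simp: indicator_def emeasure_kernel[OF s B])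
    also have "\<dots> = emeasure (distr N borel U \<bind> kernel s) B"
      unfolding emeasure_bind[OF ne km B] by (simp add: nn_integral_distr N_def nn_integral_density)
    finally show "emeasure (distr N borel W) B = emeasure (distr N borel U \<bind> kernel s) B" .
  qed
  then have "(\<integral>\<^sup>+ y. f y \<partial>distr N borel W) = (\<integral>\<^sup>+ y. f y \<partial>(distr N borel U \<bind> kernel s))" by simp
  moreover have [measurable]: "(\<lambda>x. \<integral>\<^sup>+ y. f y \<partial>kernel s x) \<in> borel_measurable borel"
    by (rule measurable_compose[OF kernel_measurable[OF s] nn_integral_measurable_subprob_algebra[OF f]])
  ultimately show ?thesis
    unfolding nn_integral_bind[OF f km] by (simp add: nn_integral_distr N_def nn_integral_density)
qed

lemma ennreal_transition:
  assumes "0 \<le> s" "f \<in> borel_measurable borel" "\<And>y. \<bar>f y\<bar> \<le> K" "\<And>y. 0 \<le> f y"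
  shows "ennreal (transition s f x) = (\<integral>\<^sup>+ y. ennreal (f y) \<partial>kernel s x)"
  unfolding transition_def kernel_def
  using P_integrable_bounded[OF assms(1-3)] X_measurable_P[OF assms(1)] assms(2,4)
  by (simp add: nn_integral_distr nn_integral_eq_integral)

lemma markov_integral:
  assumes fin: "finite_measure M" and A: "A \<in> sets M" and s: "0 \<le> s"
    and U: "U \<in> borel_measurable M" and W: "W \<in> borel_measurable M"
    and eq: "\<And>B. B \<in> sets borel \<Longrightarrow>
      measure M {\<omega> \<in> A. W \<omega> \<in> B} = (LINT \<omega>:A|M. trans_prob X P s (U \<omega>) B)"
    and f: "f \<in> borel_measurable borel" "\<And>y. \<bar>f y\<bar> \<le> K"
  shows "(LINT \<omega>|M. indicator A \<omega> * f (W \<omega>)) = (LINT \<omega>|M. indicator A \<omega> * transition s f (U \<omega>))"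
proof -
  interpret finite_measure M by (rule fin)
  note [measurable] = A U W f(1) transition_measurable[OF s f(1)]
  have K: "0 \<le> K" using f(2)[of undefined] by auto
  have *: "\<bar>f y + K\<bar> \<le> 2 * K" "0 \<le> f y + K" for y using f(2)[of y] by auto
  have m: "(\<lambda>y. f y + K) \<in> borel_measurable borel" using f by measurable
  have t: "transition s (\<lambda>y. f y + K) x = transition s f x + K" for x
    using transition_diff[OF s f, of "\<lambda>_. -K" K x] K by (simp add: transition_const)
  have t0: "0 \<le> transition s f x + K" for x
    using transition_bounded[OF s f, of x] by auto
  have i1: "integrable M (\<lambda>\<omega>. indicator A \<omega> * f (W \<omega>))"
    using f(2) K by (intro integrable_const_bound[where B=K]) (auto simp: indicator_def)
  have i2: "integrable M (\<lambda>\<omega>. indicator A \<omega> * transition s f (U \<omega>))"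
    using transition_bounded[OF s f] K by (intro integrable_const_bound[where B=K]) (auto simp: indicator_def)
  have i3: "integrable M (\<lambda>\<omega>. indicator A \<omega> * K)"
    using K by (intro integrable_const_bound[where B=K]) (auto simp: indicator_def)
  have "ennreal (LINT \<omega>|M. indicator A \<omega> * f (W \<omega>) + indicator A \<omega> * K)
      = (\<integral>\<^sup>+ \<omega>. ennreal (indicator A \<omega> * f (W \<omega>) + indicator A \<omega> * K) \<partial>M)"
    using i1 i3 * by (subst nn_integral_eq_integral) (auto simp: indicator_def)
  also have "\<dots> = (\<integral>\<^sup>+ \<omega>. indicator A \<omega> * ennreal (f (W \<omega>) + K) \<partial>M)"
    by (intro nn_integral_cong) (auto simp: indicator_def)
  also have "\<dots> = (\<integral>\<^sup>+ \<omega>. indicator A \<omega> * (\<integral>\<^sup>+ y. ennreal (f y + K) \<partial>kernel s (U \<omega>)) \<partial>M)"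
    using f by (intro markov_nn_integral[OF fin A s U W eq, of "\<lambda>y. ennreal (f y + K)"]) auto
  also have "\<dots> = (\<integral>\<^sup>+ \<omega>. ennreal (indicator A \<omega> * transition s f (U \<omega>) + indicator A \<omega> * K) \<partial>M)"
    unfolding ennreal_transition[OF s m *, symmetric] t
    by (intro nn_integral_cong) (auto simp: indicator_def)
  also have "\<dots> = ennreal (LINT \<omega>|M. indicator A \<omega> * transition s f (U \<omega>) + indicator A \<omega> * K)"
    using i2 i3 t0 by (subst nn_integral_eq_integral) (auto simp: indicator_def)
  finally have "(LINT \<omega>|M. indicator A \<omega> * f (W \<omega>) + indicator A \<omega> * K)
      = (LINT \<omega>|M. indicator A \<omega> * transition s f (U \<omega>) + indicator A \<omega> * K)"
    using * t0 by (subst (asm) ennreal_inj) (auto intro!: integral_nonneg_AE simp: indicator_def)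
  then show ?thesis using i1 i2 i3 by simp
qed

lemma transition_semigroup:
  assumes r: "0 \<le> r" and s: "0 \<le> s" and f: "f \<in> borel_measurable borel" "\<And>y. \<bar>f y\<bar> \<le> K"
  shows "transition r (transition s f) x = transition (r + s) f x"
proof -
  interpret prob_space "P x" by (rule prob_space_P)
  have "(LINT \<omega>|P x. indicator \<Omega> \<omega> * f (X (r + s) \<omega>))
      = (LINT \<omega>|P x. indicator \<Omega> \<omega> * transition s f (X r \<omega>))"
  proof (rule markov_integral[OF _ _ s _ _ _ f])
    show "\<Omega> \<in> sets (P x)" using sets.top[of "P x"] by (simp add: space_P)
    fix B :: "'e set" assume "B \<in> sets borel"
    then show "measure (P x) {\<omega> \<in> \<Omega>. X (r + s) \<omega> \<in> B} = (LINT \<omega>:\<Omega>|P x. trans_prob X P s (X r \<omega>) B)"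
      using sets.top[of "F (ennreal r)"] by (intro markov[OF s r]) (auto simp: space_F)
  qed (use r s X_measurable_P in \<open>auto intro: finite_measure_axioms\<close>)
  moreover have "(LINT \<omega>|P x. indicator \<Omega> \<omega> * h \<omega>) = (LINT \<omega>|P x. h \<omega>)" for h :: "'w \<Rightarrow> real"
    by (intro Bochner_Integration.integral_cong) (auto simp: space_P)
  ultimately show ?thesis unfolding transition_def by simp
qed

end

section \<open>Feller processes: displacements are uniformly small\<close>

locale feller_process = standard_process \<Omega> F X P
  for \<Omega> :: "'w set" and F :: "ennreal \<Rightarrow> 'w measure"
    and X :: "real \<Rightarrow> 'w \<Rightarrow> 'e::polish_space" and P :: "'e \<Rightarrow> 'w measure" +
  assumes compact_E: "compact (UNIV :: 'e set)"
    and feller: "\<And>f t. (f :: 'e \<Rightarrow> real) \<in> bcontfun \<Longrightarrow> 0 < t \<Longrightarrow>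
      (\<lambda>x. LINT \<omega>|P x. f (X t \<omega>)) \<in> bcontfun"

lemma continuous_on_compact_UNIV_bounded:
  fixes f :: "'a::topological_space \<Rightarrow> real"
  assumes "compact (UNIV :: 'a set)" "continuous_on UNIV f"
  obtains K where "0 \<le> K" "\<And>x. \<bar>f x\<bar> \<le> K"
proof -
  have "bounded (range f)" using compact_continuous_image[OF assms(2,1)] compact_imp_bounded by blast
  then obtain K where "\<forall>x\<in>range f. norm x \<le> K" by (auto simp: bounded_iff)
  then have "\<bar>f x\<bar> \<le> max 0 K" for x by (simp add: le_max_iff_disj)
  then show ?thesis by (intro that[of "max 0 K"]) auto
qed

lemma Dini_increasing:
  fixes \<phi> :: "nat \<Rightarrow> 'a::topological_space \<Rightarrow> real"
  assumes cpt: "compact (UNIV :: 'a set)"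
    and cont: "\<And>n. continuous_on UNIV (\<phi> n)" "continuous_on UNIV f"
    and inc: "\<And>n x. \<phi> n x \<le> \<phi> (Suc n) x"
    and lim: "\<And>x. (\<lambda>n. \<phi> n x) \<longlonglongrightarrow> f x"
    and e: "0 < e"
  shows "\<exists>n. \<forall>x. f x - e < \<phi> n x"
proof -
  define U where "U n = {x. f x - e < \<phi> n x}" for n
  have op: "open (U n)" for n
    unfolding U_def using cont by (intro open_Collect_less continuous_intros) auto
  have mono: "\<phi> m x \<le> \<phi> n x" if "m \<le> n" for m n x
    using lift_Suc_mono_le[of "\<lambda>n. \<phi> n x"] inc that by blast
  have "\<exists>n. x \<in> U n" for x
    using order_tendstoD(1)[OF lim[of x], of "f x - e"] e
    by (auto simp: U_def eventually_sequentially)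
  then have "UNIV \<subseteq> (\<Union>n\<in>UNIV. U n)" by auto
  then obtain C where C: "finite C" "UNIV \<subseteq> (\<Union>n\<in>C. U n)"
    using compactE_image[OF cpt, of UNIV U] op by metis
  have "f x - e < \<phi> (Max (insert 0 C)) x" for x
  proof -
    obtain n where "n \<in> C" "x \<in> U n" using C by auto
    moreover have "n \<le> Max (insert 0 C)" using C \<open>n \<in> C\<close> by simp
    ultimately show ?thesis using mono[of n "Max (insert 0 C)" x] by (auto simp: U_def)
  qed
  then show ?thesis by blast
qed

text \<open>
  The resolvent at rate \<open>1/e\<close> averages the semigroup over an exponentially distributed time.  Scaling a
  standard exponential time by \<open>e\<close> keeps one measure for all rates.
\<close>

abbreviation std_exp :: "real measure" where
  "std_exp \<equiv> density lborel (exponential_density 1)"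

interpretation std_exp: prob_space std_exp
  by (rule prob_space_exponential_density) simp

context feller_process
begin

lemma continuous_bounded:
  assumes "continuous_on UNIV (f :: 'e \<Rightarrow> real)"
  obtains K where "0 \<le> K" "\<And>x. \<bar>f x\<bar> \<le> K"
  using continuous_on_compact_UNIV_bounded[OF compact_E assms] by blast

lemma continuous_borel: "continuous_on UNIV (f :: 'e \<Rightarrow> real) \<Longrightarrow> f \<in> borel_measurable borel"
  by (rule borel_measurable_continuous_onI)

lemma P_integrable:
  assumes "0 \<le> s" "continuous_on UNIV (f :: 'e \<Rightarrow> real)"
  shows "integrable (P x) (\<lambda>\<omega>. f (X s \<omega>))"
  using continuous_bounded[OF assms(2)] P_integrable_bounded[OF assms(1) continuous_borel[OF assms(2)]]
  by metis

lemma transition_continuous: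
  assumes "0 \<le> s" "continuous_on UNIV f"
  shows "continuous_on UNIV (transition s f)"
proof (cases "s = 0")
  case True
  then have "transition s f = f" using transition_0[OF continuous_borel[OF assms(2)]] by auto
  then show ?thesis using assms by simp
next
  case False
  obtain K where "\<And>x. \<bar>f x\<bar> \<le> K" using continuous_bounded[OF assms(2)] by metis
  then have "f \<in> bcontfun" using assms(2) by (intro bcontfun_normI) auto
  from feller[OF this, of s] have "transition s f \<in> bcontfun"
    unfolding transition_def[abs_def] using assms(1) False by simp
  then show ?thesis by (auto simp: bcontfun_def)
qed

lemma transition_right_continuous:
  assumes f: "continuous_on UNIV (f :: 'e \<Rightarrow> real)" and t: "0 \<le> t"
  shows "continuous (at_right t) (\<lambda>s. transition s f x)"
  unfolding continuous_within
proof (rule tendsto_at_right_sequentially[of t "t + 1"])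
  fix S assume S: "\<And>n. t < S n" "S \<longlonglongrightarrow> t"
  obtain K where K: "\<And>x. \<bar>f x\<bar> \<le> K" using continuous_bounded[OF f] by metis
  interpret prob_space "P x" by (rule prob_space_P)
  have lim: "filterlim S (at_right t) sequentially"
    using S by (intro tendsto_imp_filterlim_at_right always_eventually) auto
  show "(\<lambda>n. transition (S n) f x) \<longlonglongrightarrow> transition t f x"
    unfolding transition_def
  proof (rule integral_dominated_convergence[where w="\<lambda>_. K"])
    show "(\<lambda>\<omega>. f (X t \<omega>)) \<in> borel_measurable (P x)"
      using measurable_compose[OF X_measurable_P[OF t] continuous_borel[OF f]] .
    show "(\<lambda>\<omega>. f (X (S n) \<omega>)) \<in> borel_measurable (P x)" for n
      using measurable_compose[OF X_measurable_P continuous_borel[OF f], of "S n"] S(1)[of n] t by simp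
    show "AE \<omega> in P x. (\<lambda>n. f (X (S n) \<omega>)) \<longlonglongrightarrow> f (X t \<omega>)"
    proof (rule AE_I2)
      fix \<omega> assume "\<omega> \<in> space (P x)"
      then have "((\<lambda>s. X s \<omega>) \<longlongrightarrow> X t \<omega>) (at_right t)"
        using right_continuous_paths[of \<omega> t] t by (simp add: space_P continuous_within)
      from filterlim_compose[OF this lim] show "(\<lambda>n. f (X (S n) \<omega>)) \<longlonglongrightarrow> f (X t \<omega>)"
        using f by (intro continuous_on_tendsto_compose[OF f]) auto
    qed
  qed (use K in auto)
qed simp

lemma transition_jointly_measurable:
  assumes f: "continuous_on UNIV (f :: 'e \<Rightarrow> real)"
  shows "(\<lambda>p. transition (max 0 (fst p)) f (snd p)) \<in> borel_measurable (borel \<Otimes>\<^sub>M borel)"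
  using transition_right_continuous[OF f] continuous_borel[OF transition_continuous[OF _ f]]
  by (intro jointly_measurable_right_continuous) auto

definition resolvent :: "real \<Rightarrow> ('e \<Rightarrow> real) \<Rightarrow> 'e \<Rightarrow> real" where
  "resolvent e f x = (LINT s|std_exp. transition (e * max 0 s) f x)"

lemma max_mult_nonneg: "0 \<le> e \<Longrightarrow> max 0 (e * max 0 s) = e * max 0 (s::real)"
  by (simp add: max_def)

lemma transition_scaled_measurable:
  assumes f: "continuous_on UNIV (f :: 'e \<Rightarrow> real)" and e: "0 \<le> e"
  shows "(\<lambda>p. transition (e * max 0 (fst p)) f (snd p)) \<in> borel_measurable (std_exp \<Otimes>\<^sub>M borel)"
proof -
  have "(\<lambda>p. (e * max 0 (fst p), snd p)) \<in> (std_exp \<Otimes>\<^sub>M borel) \<rightarrow>\<^sub>M (borel \<Otimes>\<^sub>M (borel :: 'e measure))"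
    by measurable
  from measurable_compose[OF this transition_jointly_measurable[OF f]] show ?thesis
    by (simp add: max_mult_nonneg[OF e])
qed

lemma transition_scaled_measurable_time:
  assumes f: "continuous_on UNIV (f :: 'e \<Rightarrow> real)" and e: "0 \<le> e"
  shows "(\<lambda>s. transition (e * max 0 s) f x) \<in> borel_measurable std_exp"
  using measurable_compose[OF measurable_Pair2' transition_scaled_measurable[OF f e], of x] by simp

lemma resolvent_continuous:
  assumes f: "continuous_on UNIV (f :: 'e \<Rightarrow> real)" and e: "0 \<le> e"
  shows "continuous_on UNIV (resolvent e f)"
proof (rule continuous_on_sequentiallyI)
  fix u a assume u: "u \<longlonglongrightarrow> (a::'e)"
  obtain K where K: "\<And>x. \<bar>f x\<bar> \<le> K" using continuous_bounded[OF f] by metis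
  show "(\<lambda>n. resolvent e f (u n)) \<longlonglongrightarrow> resolvent e f a"
    unfolding resolvent_def
  proof (rule integral_dominated_convergence[where w="\<lambda>_. K"])
    show "AE s in std_exp. (\<lambda>n. transition (e * max 0 s) f (u n)) \<longlonglongrightarrow> transition (e * max 0 s) f a"
      using e u by (intro AE_I2 continuous_on_tendsto_compose[OF transition_continuous[OF _ f]]) auto
    show "AE s in std_exp. norm (transition (e * max 0 s) f (u n)) \<le> K" for n
      using e transition_bounded[OF _ continuous_borel[OF f] K] by (intro AE_I2) auto
  qed (use transition_scaled_measurable_time[OF f e] in auto)
qed

lemma resolvent_tendsto:
  assumes f: "continuous_on UNIV (f :: 'e \<Rightarrow> real)"
  shows "(\<lambda>n. resolvent (1 / real (Suc n)) f x) \<longlonglongrightarrow> f x"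
proof -
  obtain K where K: "\<And>x. \<bar>f x\<bar> \<le> K" using continuous_bounded[OF f] by metis
  have "(\<lambda>n. resolvent (1 / real (Suc n)) f x) \<longlonglongrightarrow> (LINT s|std_exp. f x)"
    unfolding resolvent_def
  proof (rule integral_dominated_convergence[where w="\<lambda>_. K"])
    show "AE s in std_exp. (\<lambda>n. transition (1 / real (Suc n) * max 0 s) f x) \<longlonglongrightarrow> f x"
    proof (rule AE_I2)
      fix s :: real
      show "(\<lambda>n. transition (1 / real (Suc n) * max 0 s) f x) \<longlonglongrightarrow> f x"
      proof (cases "s \<le> 0")
        case True
        then show ?thesis using transition_0[OF continuous_borel[OF f]] by simp
      next
        case False
        have "(\<lambda>n. 1 / real (Suc n) * max 0 s) \<longlonglongrightarrow> 0 * max 0 s"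
          by (intro tendsto_intros LIMSEQ_Suc[OF lim_1_over_n])
        then have "filterlim (\<lambda>n. 1 / real (Suc n) * max 0 s) (at_right 0) sequentially"
          using False by (intro tendsto_imp_filterlim_at_right always_eventually) auto
        moreover have "((\<lambda>s. transition s f x) \<longlongrightarrow> f x) (at_right 0)"
          using transition_right_continuous[OF f, of 0 x] transition_0[OF continuous_borel[OF f]]
          by (simp add: continuous_within)
        ultimately show ?thesis by (rule filterlim_compose[rotated])
      qed
    qed
    show "AE s in std_exp. norm (transition (1 / real (Suc n) * max 0 s) f x) \<le> K" for n
      using transition_bounded[OF _ continuous_borel[OF f] K] by (intro AE_I2) auto
    show "(\<lambda>s. transition (1 / real (Suc n) * max 0 s) f x) \<in> borel_measurable std_exp" for n
      by (rule transition_scaled_measurable_time[OF f]) simp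
  qed auto
  then show ?thesis using std_exp.prob_space by simp
qed

lemma resolvent_nonneg: "(\<And>y. 0 \<le> f y) \<Longrightarrow> 0 \<le> resolvent e f x"
  unfolding resolvent_def transition_def by simp

lemma transition_resolvent:
  assumes f: "continuous_on UNIV (f :: 'e \<Rightarrow> real)" and e: "0 \<le> e" and r: "0 \<le> r"
  shows "transition r (resolvent e f) x = (LINT s|std_exp. transition (r + e * max 0 s) f x)"
proof -
  obtain K where K: "\<And>x. \<bar>f x\<bar> \<le> K" using continuous_bounded[OF f] by metis
  note fb = continuous_borel[OF f]
  interpret Px: prob_space "P x" by (rule prob_space_P)
  interpret pair_prob_space "P x" std_exp ..
  have m: "(\<lambda>p. transition (e * max 0 (snd p)) f (X r (fst p))) \<in> borel_measurable (P x \<Otimes>\<^sub>M std_exp)"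
  proof -
    have "(\<lambda>p. (snd p, X r (fst p))) \<in> (P x \<Otimes>\<^sub>M std_exp) \<rightarrow>\<^sub>M (std_exp \<Otimes>\<^sub>M (borel :: 'e measure))"
      using X_measurable_P[OF r, of x] by measurable
    from measurable_compose[OF this transition_scaled_measurable[OF f e]] show ?thesis by simp
  qed
  have "transition r (resolvent e f) x
      = (LINT \<omega>|P x. LINT s|std_exp. transition (e * max 0 s) f (X r \<omega>))"
    by (simp add: transition_def[of r] resolvent_def)
  also have "\<dots> = (LINT s|std_exp. LINT \<omega>|P x. transition (e * max 0 s) f (X r \<omega>))"
  proof (rule Fubini_integral[symmetric])
    show "integrable (P x \<Otimes>\<^sub>M std_exp) (\<lambda>(\<omega>, s). transition (e * max 0 s) f (X r \<omega>))"
      using m e transition_bounded[OF _ fb K]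
      by (intro P.integrable_const_bound[where B=K]) (auto simp: case_prod_beta)
  qed
  also have "\<dots> = (LINT s|std_exp. transition (r + e * max 0 s) f x)"
    using e transition_semigroup[OF r _ fb K] by (simp add: transition_def[of r, symmetric])
  finally show ?thesis .
qed

text \<open>
  By the semigroup law, \<open>P\<^sub>r\<close> shifts the integration variable by \<open>r/e\<close>; multiplied by \<open>e\<^sup>-\<^sup>r\<^sup>/\<^sup>e\<close> the left
  side is the part of the resolvent integral over \<open>{r/e..}\<close>.
\<close>

lemma resolvent_supermedian:
  assumes f: "continuous_on UNIV (f :: 'e \<Rightarrow> real)" "\<And>y. 0 \<le> f y" and e: "0 < e" and r: "0 \<le> r"
  shows "exp (- (1 / e) * r) * transition r (resolvent e f) x \<le> resolvent e f x"
proof -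
  define \<phi> where "\<phi> s = transition (e * max 0 s) f x" for s
  obtain K where K: "\<And>x. \<bar>f x\<bar> \<le> K" using continuous_bounded[OF f(1)] by metis
  have \<phi>m [measurable]: "\<phi> \<in> borel_measurable borel"
    unfolding \<phi>_def using transition_scaled_measurable_time[OF f(1), of e x] e by simp
  have \<phi>0: "0 \<le> \<phi> s" for s unfolding \<phi>_def transition_def using f(2) by simp
  have \<phi>K: "\<bar>\<phi> s\<bar> \<le> K" for s
    unfolding \<phi>_def using e transition_bounded[OF _ continuous_borel[OF f(1)] K] by simp
  have int: "integrable lborel (\<lambda>s. exponential_density 1 s * \<phi> s)"
  proof -
    have "integrable std_exp \<phi>" using \<phi>K by (intro std_exp.integrable_const_bound[where B=K]) auto
    then show ?thesis by (subst (asm) integrable_density) (auto simp: exponential_density_nonneg)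
  qed
  have "transition r (resolvent e f) x = (LINT s|std_exp. transition (r + e * max 0 s) f x)"
    using transition_resolvent[OF f(1) _ r] e by simp
  also have "\<dots> = (LINT s|lborel. exponential_density 1 s * transition (r + e * max 0 s) f x)"
  proof -
    have "(\<lambda>s. (r + e * max 0 s, x)) \<in> lborel \<rightarrow>\<^sub>M borel \<Otimes>\<^sub>M borel" by measurable
    from measurable_compose[OF this transition_jointly_measurable[OF f(1)]]
    have "(\<lambda>s. transition (r + e * max 0 s) f x) \<in> borel_measurable lborel"
      using r e by simp
    then show ?thesis by (subst integral_density) (auto simp: exponential_density_nonneg)
  qed
  finally have "exp (- (1 / e) * r) * transition r (resolvent e f) x
    = (LINT s|lborel. exp (- (1 / e) * r) * (exponential_density 1 s * transition (r + e * max 0 s) f x))"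
    by simp
  also have "\<dots> = (LINT s|lborel. (\<lambda>s. indicator {r / e..} s * (exponential_density 1 s * \<phi> s)) (r / e + 1 * s))"
  proof (rule Bochner_Integration.integral_cong[OF refl])
    fix s :: real
    have re: "0 \<le> r / e" using r e by simp
    show "exp (- (1 / e) * r) * (exponential_density 1 s * transition (r + e * max 0 s) f x)
      = (\<lambda>s. indicator {r / e..} s * (exponential_density 1 s * \<phi> s)) (r / e + 1 * s)"
    proof (cases "0 \<le> s")
      case True
      have 1: "exp (- (1 / e) * r) * exp (- s) = exp (- (r / e + s))"
        by (simp add: exp_add[symmetric])
      have "e * (r / e + s) = r + e * s" using e by (simp add: distrib_left)
      then have 2: "\<phi> (r / e + s) = transition (r + e * s) f x"
        unfolding \<phi>_def using True re by (subst max_absorb2) auto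
      have "exp (- (1 / e) * r) * (exponential_density 1 s * transition (r + e * max 0 s) f x)
          = (exp (- (1 / e) * r) * exp (- s)) * transition (r + e * s) f x"
        using True by (simp add: exponential_density_def)
      then show ?thesis unfolding 1 using True re by (simp add: exponential_density_def 2)
    next
      case False
      then show ?thesis by (simp add: exponential_density_def indicator_def)
    qed
  qed
  also have "\<dots> = (LINT s|lborel. indicator {r / e..} s * (exponential_density 1 s * \<phi> s))"
    using lborel_integral_real_affine[of 1 "\<lambda>s. indicator {r / e..} s * (exponential_density 1 s * \<phi> s)" "r / e"]
    by simp
  also have "\<dots> \<le> (LINT s|lborel. exponential_density 1 s * \<phi> s)"
    using int integrable_real_mult_indicator[OF _ int, of "{r/e..}"] \<phi>0
    by (intro integral_mono) (auto simp: indicator_def exponential_density_def mult.commute)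
  also have "\<dots> = resolvent e f x"
    unfolding resolvent_def \<phi>_def[symmetric]
    by (subst integral_density) (auto simp: exponential_density_nonneg)
  finally show ?thesis .
qed

text \<open>
  Since \<open>\<bar>a - b\<bar> = a + b - 2 min a b\<close>, it suffices to bound \<open>E\<^sub>x[min (u(X\<^sub>r)) (u(x))]\<close> from below.  With
  the level \<open>a\<close> held fixed, \<open>min u a\<close> is again supermedian, so its discounted expectation increases as
  \<open>r\<close> decreases to 0; the level \<open>a = u(x)\<close> may then depend on the starting point, and Dini's theorem
  applies.
\<close>

lemma supermedian_increment:
  assumes u: "continuous_on UNIV (u :: 'e \<Rightarrow> real)" "\<And>x. 0 \<le> u x" and p: "0 \<le> p"
    and sm: "\<And>r x. 0 \<le> r \<Longrightarrow> exp (- p * r) * transition r u x \<le> u x"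
    and eps: "0 < \<epsilon>"
  shows "\<exists>h>0. \<forall>r x. 0 \<le> r \<longrightarrow> r \<le> h \<longrightarrow> transition r (\<lambda>y. \<bar>u y - u x\<bar>) x \<le> \<epsilon>"
proof -
  obtain K where K: "0 \<le> K" "\<And>x. \<bar>u x\<bar> \<le> K" using continuous_bounded[OF u(1)] by metis
  have mc: "continuous_on UNIV (\<lambda>y. min (u y) a)" for a using u(1) by (intro continuous_intros)
  note ub = continuous_borel[OF u(1)] and mb = continuous_borel[OF mc]
  have mK: "\<bar>min (u y) a\<bar> \<le> K" if "0 \<le> a" for y a using K(2)[of y] u(2)[of y] that by auto
  define \<psi> where "\<psi> r a x = exp (- p * r) * transition r (\<lambda>y. min (u y) a) x" for r a x
  have msm: "\<psi> r a x \<le> min (u x) a" if "0 \<le> r" "0 \<le> a" for r a x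
  proof -
    have "transition r (\<lambda>y. min (u y) a) x \<le> transition r u x"
      by (rule transition_mono[OF that(1) mb mK ub K(2)]) (use that in auto)
    then have "\<psi> r a x \<le> u x"
      unfolding \<psi>_def using sm[OF that(1), of x] mult_left_mono[of _ _ "exp (-p * r)"]
      by (meson exp_ge_zero order_trans)
    moreover have "transition r (\<lambda>y. min (u y) a) x \<le> transition r (\<lambda>y. a) x"
      by (rule transition_mono[OF that(1) mb mK, of _ _ a]) (use that in auto)
    then have "\<psi> r a x \<le> 1 * a"
      unfolding \<psi>_def using p that u(2) by (intro mult_mono) (auto simp: transition_const transition_def)
    ultimately show ?thesis by simp
  qed
  have mono: "\<psi> t a x \<le> \<psi> r a x" if rt: "0 \<le> r" "r \<le> t" and a: "0 \<le> a" for r t a x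
  proof -
    have s: "0 \<le> t - r" using rt by simp
    have "transition (t - r) (\<lambda>y. min (u y) a) z \<le> exp (p * (t - r)) * min (u z) a" for z
    proof -
      have "exp (p * (t - r)) * \<psi> (t - r) a z \<le> exp (p * (t - r)) * min (u z) a"
        using msm[OF s a] by (intro mult_left_mono) auto
      then show ?thesis by (simp add: \<psi>_def mult.assoc[symmetric] exp_add[symmetric])
    qed
    then have "transition r (transition (t - r) (\<lambda>y. min (u y) a)) x
        \<le> transition r (\<lambda>z. exp (p * (t - r)) * min (u z) a) x"
      unfolding transition_def[of r]
      using rt s a mc u(1) by (intro integral_mono P_integrable transition_continuous continuous_intros) auto
    also have "\<dots> = exp (p * (t - r)) * transition r (\<lambda>z. min (u z) a) x"
      by (simp add: transition_def)
    finally have "transition t (\<lambda>y. min (u y) a) x \<le> exp (p * (t - r)) * transition r (\<lambda>z. min (u z) a) x"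
      using transition_semigroup[OF rt(1) s mb mK[OF a]] by simp
    then have "\<psi> t a x \<le> exp (- p * t) * (exp (p * (t - r)) * transition r (\<lambda>z. min (u z) a) x)"
      unfolding \<psi>_def by (intro mult_left_mono) auto
    also have "\<dots> = \<psi> r a x"
      by (simp add: \<psi>_def mult.assoc[symmetric] exp_add[symmetric] right_diff_distrib)
    finally show ?thesis .
  qed
  have lip: "\<bar>\<psi> r a x - \<psi> r b x\<bar> \<le> \<bar>a - b\<bar>" if "0 \<le> r" "0 \<le> a" "0 \<le> b" for r a b x
  proof -
    have "transition r (\<lambda>y. min (u y) a) x - transition r (\<lambda>y. min (u y) b) x
       = transition r (\<lambda>y. min (u y) a - min (u y) b) x"
      using transition_diff[OF that(1) mb mK[OF that(2)] mb mK[OF that(3)]] by simp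
    also have "\<bar>\<dots>\<bar> \<le> \<bar>a - b\<bar>"
      using mb by (intro transition_bounded[OF that(1)] borel_measurable_diff) auto
    finally have le: "\<bar>transition r (\<lambda>y. min (u y) a) x - transition r (\<lambda>y. min (u y) b) x\<bar> \<le> \<bar>a - b\<bar>" .
    have "\<bar>\<psi> r a x - \<psi> r b x\<bar>
        = exp (- p * r) * \<bar>transition r (\<lambda>y. min (u y) a) x - transition r (\<lambda>y. min (u y) b) x\<bar>"
      unfolding \<psi>_def right_diff_distrib[symmetric] by (simp add: abs_mult)
    also have "\<dots> \<le> 1 * \<bar>a - b\<bar>" using le p that by (intro mult_mono) auto
    finally show ?thesis by simp
  qed
  define \<phi> where "\<phi> n x = \<psi> (1 / real (Suc n)) (u x) x" for n x
  have "\<exists>n. \<forall>x. u x - \<epsilon> / 4 < \<phi> n x"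
  proof (rule Dini_increasing[OF compact_E _ u(1)])
    show "continuous_on UNIV (\<phi> n)" for n
    proof (rule continuous_on_sequentiallyI)
      fix v and z :: 'e assume v: "v \<longlonglongrightarrow> z"
      let ?r = "1 / real (Suc n)"
      have "continuous_on UNIV (\<lambda>x. \<psi> ?r (u z) x)"
        unfolding \<psi>_def using transition_continuous[OF _ mc, of ?r] by (intro continuous_intros) auto
      then have 1: "(\<lambda>k. \<psi> ?r (u z) (v k)) \<longlonglongrightarrow> \<psi> ?r (u z) z"
        by (rule continuous_on_tendsto_compose) (use v in auto)
      have "(\<lambda>k. \<bar>u (v k) - u z\<bar>) \<longlonglongrightarrow> \<bar>u z - u z\<bar>"
        by (intro tendsto_intros continuous_on_tendsto_compose[OF u(1) v]) auto
      then have 0: "(\<lambda>k. \<bar>u (v k) - u z\<bar>) \<longlonglongrightarrow> 0" by simp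
      have "(\<lambda>k. \<psi> ?r (u (v k)) (v k) - \<psi> ?r (u z) (v k)) \<longlonglongrightarrow> 0"
        by (rule Lim_null_comparison[OF always_eventually 0]) (use lip u(2) in simp)
      from tendsto_add[OF this 1] show "(\<lambda>k. \<phi> n (v k)) \<longlonglongrightarrow> \<phi> n z" by (simp add: \<phi>_def)
    qed
    show "\<phi> n x \<le> \<phi> (Suc n) x" for n x
      unfolding \<phi>_def using u(2) by (intro mono) (auto simp: field_simps)
    show "(\<lambda>n. \<phi> n x) \<longlonglongrightarrow> u x" for x
    proof -
      have l0: "(\<lambda>n. 1 / real (Suc n)) \<longlonglongrightarrow> 0" by (intro LIMSEQ_Suc[OF lim_1_over_n])
      then have "filterlim (\<lambda>n. 1 / real (Suc n)) (at_right 0) sequentially"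
        by (intro tendsto_imp_filterlim_at_right always_eventually) auto
      moreover have "((\<lambda>s. transition s (\<lambda>y. min (u y) (u x)) x) \<longlongrightarrow> u x) (at_right 0)"
        using transition_right_continuous[OF mc[of "u x"], of 0 x] transition_0[OF mb[of "u x"]]
        by (simp add: continuous_within)
      ultimately have "(\<lambda>n. transition (1 / real (Suc n)) (\<lambda>y. min (u y) (u x)) x) \<longlonglongrightarrow> u x"
        by (rule filterlim_compose[rotated])
      moreover have "(\<lambda>n. exp (- p * (1 / real (Suc n)))) \<longlonglongrightarrow> exp (- p * 0)"
        by (intro tendsto_exp tendsto_mult tendsto_const l0)
      ultimately show ?thesis unfolding \<phi>_def \<psi>_def by (auto dest: tendsto_mult)
    qed
  qed (use eps in auto)
  then obtain n where n: "\<And>x. u x - \<epsilon> / 4 < \<phi> n x" by auto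
  have "((\<lambda>r. (exp (p * r) - 1) * K) \<longlongrightarrow> (exp (p * 0) - 1) * K) (at_right 0)"
    by (intro tendsto_intros)
  then have "\<forall>\<^sub>F r in at_right 0. (exp (p * r) - 1) * K < \<epsilon> / 2"
    using eps by (intro order_tendstoD(2)) auto
  then obtain b where b: "b > 0" "\<And>r. 0 < r \<Longrightarrow> r < b \<Longrightarrow> (exp (p * r) - 1) * K < \<epsilon> / 2"
    by (auto simp: eventually_at_right_field)
  show ?thesis
  proof (intro exI[of _ "min (b / 2) (1 / real (Suc n))"] conjI allI impI)
    show "0 < min (b / 2) (1 / real (Suc n))" using b by simp
    fix r x assume r: "0 \<le> r" "r \<le> min (b / 2) (1 / real (Suc n))"
    let ?m = "\<lambda>y. min (u y) (u x)"
    have "u x - \<epsilon> / 4 \<le> \<psi> r (u x) x"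
      using n[of x] mono[of r "1 / real (Suc n)" "u x" x] r u(2) by (auto simp: \<phi>_def)
    also have "\<dots> \<le> transition r ?m x"
    proof -
      have "0 \<le> transition r ?m x" unfolding transition_def using u(2) by simp
      then show ?thesis unfolding \<psi>_def using p r by (intro mult_left_le_one_le) auto
    qed
    finally have 1: "u x - \<epsilon> / 4 \<le> transition r ?m x" .
    have "transition r u x \<le> exp (p * r) * u x"
    proof -
      have "exp (p * r) * (exp (- p * r) * transition r u x) \<le> exp (p * r) * u x"
        using sm[OF r(1)] by (intro mult_left_mono) auto
      then show ?thesis by (simp add: mult.assoc[symmetric] exp_add[symmetric])
    qed
    moreover have "(exp (p * r) - 1) * u x \<le> (exp (p * r) - 1) * K"
      using K(2)[of x] p r by (intro mult_left_mono) auto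
    moreover have "(exp (p * r) - 1) * K \<le> \<epsilon> / 2"
      using b(2)[of r] r b(1) eps by (cases "r = 0") auto
    ultimately have 2: "transition r u x \<le> u x + \<epsilon> / 2" by (simp add: left_diff_distrib)
    have "transition r (\<lambda>y. \<bar>u y - u x\<bar>) x = (LINT \<omega>|P x. u (X r \<omega>) + u x - 2 * min (u (X r \<omega>)) (u x))"
      unfolding transition_def by (intro Bochner_Integration.integral_cong) (auto simp: min_def)
    also have "\<dots> = transition r u x + u x - 2 * transition r ?m x"
    proof -
      interpret prob_space "P x" by (rule prob_space_P)
      show ?thesis
        unfolding transition_def using P_integrable[OF r(1) u(1), of x] P_integrable[OF r(1) mc, of x "u x"]
        by (simp add: prob_space)
    qed
    also have "\<dots> \<le> \<epsilon>" using 1 2 by simp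
    finally show "transition r (\<lambda>y. \<bar>u y - u x\<bar>) x \<le> \<epsilon>" .
  qed
qed

lemma diameter_bounded:
  obtains K where "0 \<le> K" "\<And>y x :: 'e. dist y x \<le> K"
proof -
  have "bounded (UNIV :: 'e set)" using compact_E by (rule compact_imp_bounded)
  then obtain K where K: "\<And>y x :: 'e. dist y x \<le> K" unfolding bounded_two_points by blast
  show ?thesis using K order_trans[OF zero_le_dist K] by (rule that[rotated])
qed

text \<open>
  Finitely many resolvents separate all pairs of points at distance at least \<open>\<epsilon>/2\<close> by a positive amount
  \<open>\<delta>\<close>, so the distance is at most \<open>\<epsilon>/2\<close> plus a multiple of the sum of their increments, each of which
  is small in expectation by \<open>supermedian_increment\<close>.
\<close>

lemma uniform_stochastic_continuity:
  assumes eps: "0 < \<epsilon>"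
  shows "\<exists>h>0. \<forall>r x. 0 \<le> r \<longrightarrow> r \<le> h \<longrightarrow> transition r (\<lambda>y. dist y x) x \<le> \<epsilon>"
proof -
  \<comment> \<open>the functions whose increments are small in expectation, uniformly in the starting point\<close>
  define G where "G = {u :: 'e \<Rightarrow> real. continuous_on UNIV u \<and>
    (\<forall>\<epsilon>>0. \<exists>h>0. \<forall>r x. 0 \<le> r \<longrightarrow> r \<le> h \<longrightarrow> transition r (\<lambda>y. \<bar>u y - u x\<bar>) x \<le> \<epsilon>)}"
  have sep: "\<exists>u\<in>G. u x \<noteq> u y" if "x \<noteq> y" for x y :: 'e
  proof -
    define f where "f z = dist z x" for z
    have f: "continuous_on UNIV f" "\<And>z. 0 \<le> f z" unfolding f_def by (auto intro!: continuous_intros)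
    have "\<forall>\<^sub>F n in sequentially. resolvent (1 / real (Suc n)) f x < dist y x / 2"
      using that by (intro order_tendstoD(2)[OF resolvent_tendsto[OF f(1)]]) (auto simp: f_def)
    moreover have "\<forall>\<^sub>F n in sequentially. dist y x / 2 < resolvent (1 / real (Suc n)) f y"
      using that by (intro order_tendstoD(1)[OF resolvent_tendsto[OF f(1)]]) (auto simp: f_def)
    ultimately have "\<forall>\<^sub>F n in sequentially. resolvent (1 / real (Suc n)) f x < resolvent (1 / real (Suc n)) f y"
      by eventually_elim simp
    then obtain n where n: "resolvent (1 / real (Suc n)) f x < resolvent (1 / real (Suc n)) f y"
      using eventually_happens'[OF sequentially_bot] by blast
    let ?u = "resolvent (1 / real (Suc n)) f"
    have uc: "continuous_on UNIV ?u" by (rule resolvent_continuous[OF f(1)]) simp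
    have sm: "exp (- real (Suc n) * r) * transition r ?u z \<le> ?u z" if "0 \<le> r" for r z
      using resolvent_supermedian[OF f, of "1 / real (Suc n)" r z] that by (simp del: of_nat_Suc)
    have "\<exists>h>0. \<forall>r x. 0 \<le> r \<longrightarrow> r \<le> h \<longrightarrow> transition r (\<lambda>y. \<bar>?u y - ?u x\<bar>) x \<le> \<epsilon>" if "0 < \<epsilon>" for \<epsilon>
      using supermedian_increment[OF uc resolvent_nonneg[OF f(2)] of_nat_0_le_iff sm that] .
    then have "?u \<in> G" unfolding G_def using uc by blast
    then show ?thesis by (rule bexI[rotated]) (use n in simp)
  qed
  have cE2: "compact (UNIV :: ('e \<times> 'e) set)" using compact_Times[OF compact_E compact_E] by simp
  define D where "D = {q :: 'e \<times> 'e. \<epsilon> / 2 \<le> dist (fst q) (snd q)}"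
  have D: "compact D"
  proof -
    have "closed D" unfolding D_def by (intro closed_Collect_le continuous_intros)
    then show ?thesis using compact_Int_closed[OF cE2, of D] by simp
  qed
  define U where "U q = (SOME u. u \<in> G \<and> u (fst q) \<noteq> u (snd q))" for q :: "'e \<times> 'e"
  have U: "U q \<in> G \<and> U q (fst q) \<noteq> U q (snd q)" if "q \<in> D" for q
  proof -
    have "fst q \<noteq> snd q" using that eps by (auto simp: D_def)
    then have "\<exists>u. u \<in> G \<and> u (fst q) \<noteq> u (snd q)" using sep by blast
    then show ?thesis unfolding U_def by (rule someI_ex)
  qed
  have Uc: "continuous_on UNIV (U q)" if "q \<in> D" for q using U[OF that] by (auto simp: G_def)
  have Uc2: "continuous_on UNIV (\<lambda>z. U q (fst z))" "continuous_on UNIV (\<lambda>z. U q (snd z))" if "q \<in> D" for q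
    using that by (auto intro!: continuous_on_compose2[OF Uc] continuous_intros)
  obtain C where C: "C \<subseteq> D" "finite C" "D \<subseteq> (\<Union>q\<in>C. {z. U q (fst z) \<noteq> U q (snd z)})"
  proof (rule compactE_image[OF D, of D "\<lambda>q. {z. U q (fst z) \<noteq> U q (snd z)}"])
    show "open {z. U q (fst z) \<noteq> U q (snd z)}" if "q \<in> D" for q
      using Uc2[OF that] by (intro open_Collect_neq)
    show "D \<subseteq> (\<Union>q\<in>D. {z. U q (fst z) \<noteq> U q (snd z)})" using U by auto
  qed auto
  define \<Phi> where "\<Phi> z = (\<Sum>q\<in>C. \<bar>U q (fst z) - U q (snd z)\<bar>)" for z
  have \<Phi>0: "0 \<le> \<Phi> z" for z unfolding \<Phi>_def by (intro sum_nonneg) auto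
  \<comment> \<open>\<open>\<Phi>\<close> is continuous and positive on the compact set \<open>D\<close>\<close>
  have "\<exists>\<delta>>0. \<forall>z\<in>D. \<delta> \<le> \<Phi> z"
  proof (cases "D = {}")
    case True then show ?thesis by (auto intro: exI[of _ 1])
  next
    case False
    have "continuous_on D \<Phi>" unfolding \<Phi>_def
      using Uc2 C(1) by (intro continuous_intros continuous_on_subset[OF Uc2(1)] continuous_on_subset[OF Uc2(2)]) auto
    from continuous_attains_inf[OF D False this] obtain z where z: "z \<in> D" "\<forall>y\<in>D. \<Phi> z \<le> \<Phi> y" by auto
    obtain q where "q \<in> C" "U q (fst z) \<noteq> U q (snd z)" using C z(1) by auto
    then have "0 < \<Phi> z" unfolding \<Phi>_def using C(2) by (intro sum_pos2[of _ q]) auto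
    then show ?thesis using z by auto
  qed
  then obtain \<delta> where \<delta>: "\<delta> > 0" "\<And>z. z \<in> D \<Longrightarrow> \<delta> \<le> \<Phi> z" by auto
  obtain K where K: "0 \<le> K" "\<And>y x :: 'e. dist y x \<le> K" using diameter_bounded by blast
  have le: "dist y x \<le> \<epsilon> / 2 + K / \<delta> * \<Phi> (y, x)" for y x
  proof (cases "(y, x) \<in> D")
    case True
    have "dist y x \<le> K / \<delta> * \<delta>" using K(2)[of y x] \<delta>(1) by simp
    also have "\<dots> \<le> K / \<delta> * \<Phi> (y, x)" using \<delta>(2)[OF True] K(1) \<delta>(1) by (intro mult_left_mono) auto
    finally show ?thesis using eps by simp
  next
    case False
    then show ?thesis using \<Phi>0[of "(y, x)"] K(1) \<delta>(1) by (auto simp: D_def intro!: add_increasing2)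
  qed
  define \<epsilon>' where "\<epsilon>' = \<epsilon> / 2 / (K / \<delta> * real (card C) + 1)"
  have e': "0 < \<epsilon>'" using eps K(1) \<delta>(1) by (auto simp: \<epsilon>'_def intro!: divide_pos_pos add_nonneg_pos)
  define H where "H q = (SOME h. h > 0 \<and> (\<forall>r x. 0 \<le> r \<longrightarrow> r \<le> h \<longrightarrow> transition r (\<lambda>y. \<bar>U q y - U q x\<bar>) x \<le> \<epsilon>'))" for q
  have H: "H q > 0 \<and> (\<forall>r x. 0 \<le> r \<longrightarrow> r \<le> H q \<longrightarrow> transition r (\<lambda>y. \<bar>U q y - U q x\<bar>) x \<le> \<epsilon>')" if "q \<in> C" for q
    unfolding H_def by (rule someI_ex) (use U[of q] that C(1) e' in \<open>auto simp: G_def\<close>)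
  show ?thesis
  proof (intro exI[of _ "Min (insert 1 (H ` C))"] conjI allI impI)
    show "0 < Min (insert 1 (H ` C))" using C(2) H by simp
    fix r x assume r: "0 \<le> r" "r \<le> Min (insert 1 (H ` C))"
    have rH: "r \<le> H q" if "q \<in> C" for q using r C(2) that by simp
    interpret prob_space "P x" by (rule prob_space_P)
    have i: "integrable (P x) (\<lambda>\<omega>. \<bar>U q (X r \<omega>) - U q x\<bar>)" if "q \<in> C" for q
      using that C(1) by (intro P_integrable[OF r(1), of "\<lambda>y. \<bar>U q y - U q x\<bar>"] continuous_intros Uc) (rule subsetD)
    have id: "integrable (P x) (\<lambda>\<omega>. dist (X r \<omega>) x)"
      by (intro P_integrable[OF r(1), of "\<lambda>y. dist y x"] continuous_intros)
    have "transition r (\<lambda>y. dist y x) x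
        \<le> (LINT \<omega>|P x. \<epsilon> / 2 + K / \<delta> * (\<Sum>q\<in>C. \<bar>U q (X r \<omega>) - U q x\<bar>))"
      unfolding transition_def using le i id
      by (intro integral_mono) (auto simp: \<Phi>_def)
    also have "\<dots> = \<epsilon> / 2 + K / \<delta> * (\<Sum>q\<in>C. transition r (\<lambda>y. \<bar>U q y - U q x\<bar>) x)"
      using i by (simp add: prob_space transition_def)
    also have "\<dots> \<le> \<epsilon> / 2 + K / \<delta> * (\<Sum>q\<in>C. \<epsilon>')"
      using H rH r K(1) \<delta>(1) by (intro add_left_mono mult_left_mono sum_mono) auto
    also have "K / \<delta> * (\<Sum>q\<in>C. \<epsilon>') = (K / \<delta> * real (card C)) * \<epsilon>'" by simp
    also have "\<epsilon> / 2 + (K / \<delta> * real (card C)) * \<epsilon>' \<le> \<epsilon> / 2 + (K / \<delta> * real (card C) + 1) * \<epsilon>'"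
      using e' by (intro add_left_mono mult_right_mono) auto
    also have "(K / \<delta> * real (card C) + 1) * \<epsilon>' = \<epsilon> / 2"
    proof -
      have "K / \<delta> * real (card C) + 1 \<noteq> 0" using K(1) \<delta>(1)
        by (metis add_nonneg_pos divide_nonneg_pos less_numeral_extra(1) less_numeral_extra(3) mult_nonneg_nonneg of_nat_0_le_iff)
      from nonzero_eq_divide_eq[THEN iffD1, OF this \<epsilon>'_def] show ?thesis by (simp only: mult.commute)
    qed
    finally show "transition r (\<lambda>y. dist y x) x \<le> \<epsilon>" by simp
  qed
qed

end

section \<open>The impulse problem and its one-step Bellman equation\<close>

lemma integrable_indicator_Icc: "integrable lborel (\<lambda>s. indicator {a..b::real} s * (K :: real))"
  by (intro integrable_mult_left integrable_real_indicator) (auto simp: emeasure_lborel_Icc_eq)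

lemma set_integrable_Icc_bounded:
  fixes f :: "real \<Rightarrow> real"
  assumes f: "f \<in> borel_measurable borel" "\<And>s. \<bar>f s\<bar> \<le> K"
  shows "set_integrable lborel {a..b} f"
  unfolding set_integrable_def
proof (rule Bochner_Integration.integrable_bound[OF integrable_indicator_Icc[of a b K]])
  show "AE s in lborel. norm (indicator {a..b} s *\<^sub>R f s) \<le> norm (indicator {a..b} s * K)"
    using f(2) by (intro AE_I2) (auto simp: indicator_def intro: order_trans[OF _ abs_ge_self])
qed (use f(1) in measurable)

lemma set_integral_nonneg_time:
  fixes a b :: real
  assumes "0 \<le> a" "\<And>s. 0 \<le> s \<Longrightarrow> f s = f' s"
  shows "(LINT s:{a..b}|lborel. f s) = (LINT s:{a..b}|lborel. (f' s :: real))"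
  using assms by (intro set_lebesgue_integral_cong) auto

lemma set_integral_split:
  assumes f: "\<And>a b. set_integrable lborel {a..b} (f :: real \<Rightarrow> real)" and ab: "a \<le> b" "b \<le> c"
  shows "(LINT s:{a..c}|lborel. f s) = (LINT s:{a..b}|lborel. f s) + (LINT s:{b..c}|lborel. f s)"
proof -
  have eq: "{a..c} = {a..b} \<union> {b..c}" using ab by auto
  have ae: "AE s in lborel. \<not> (s \<in> {a..b} \<and> s \<in> {b..c})"
    using AE_lborel_singleton[of b] by eventually_elim auto
  show ?thesis unfolding eq by (rule set_integral_Un_AE[OF ae]) (auto intro: f)
qed

lemma set_integral_Icc_bound:
  fixes f :: "real \<Rightarrow> real"
  assumes f: "f \<in> borel_measurable borel" "\<And>s. \<bar>f s\<bar> \<le> K" and ab: "a \<le> b"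
  shows "\<bar>LINT s:{a..b}|lborel. f s\<bar> \<le> K * (b - a)"
proof -
  have "\<bar>LINT s:{a..b}|lborel. f s\<bar> \<le> (LINT s:{a..b}|lborel. \<bar>f s\<bar>)"
    using set_integral_norm_bound[OF set_integrable_Icc_bounded[OF f]] by simp
  also have "\<dots> \<le> (LINT s:{a..b}|lborel. K)"
  proof (rule set_integral_mono)
    show "set_integrable lborel {a..b} (\<lambda>s. \<bar>f s\<bar>)" by (rule set_integrable_abs[OF set_integrable_Icc_bounded[OF f]])
    show "set_integrable lborel {a..b} (\<lambda>s. K)" unfolding set_integrable_def using integrable_indicator_Icc[of a b K] by (simp del: integrable_mult_left_iff)
  qed (rule f(2))
  also have "\<dots> = K * (b - a)" using ab by (simp add: set_lebesgue_integral_def)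
  finally show ?thesis .
qed

locale impulse_problem = feller_process \<Omega> F X P
  for \<Omega> :: "'w set" and F :: "ennreal \<Rightarrow> 'w measure"
    and X :: "real \<Rightarrow> 'w \<Rightarrow> 'e::polish_space" and P :: "'e \<Rightarrow> 'w measure" +
  fixes g :: "'e \<Rightarrow> real" and c :: "'e \<Rightarrow> 'e \<Rightarrow> real" and c\<^sub>0 :: real
  assumes g_continuous: "continuous_on UNIV g"
    and c_continuous: "continuous_on UNIV (\<lambda>(x, \<xi>). c x \<xi>)"
    and c0: "0 < c\<^sub>0" "\<And>x \<xi>. c\<^sub>0 \<le> c x \<xi>"
    and c_triangle: "\<And>x \<xi> \<eta>. c x \<xi> \<le> c x \<eta> + c \<eta> \<xi>"
begin

definition running_cost :: "real \<Rightarrow> 'e \<Rightarrow> real" where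
  "running_cost h x = (LINT s:{0..h}|lborel. transition (max 0 s) g x)"

definition intervene :: "('e \<Rightarrow> real) \<Rightarrow> 'e \<Rightarrow> real" where
  "intervene u x = (INF \<xi>. c x \<xi> + u \<xi>)"

lemma c_nonneg: "0 \<le> c x \<xi>"
  using c0(1) c0(2)[of x \<xi>] by linarith

lemma compact_E2: "compact (UNIV :: ('e \<times> 'e) set)"
  using compact_Times[OF compact_E compact_E] by simp

lemma c_bounded:
  obtains K where "0 < K" "\<And>x \<xi>. c x \<xi> \<le> K"
proof -
  obtain K where "0 \<le> K" "\<And>z. \<bar>(\<lambda>(x, \<xi>). c x \<xi>) z\<bar> \<le> K"
    using continuous_on_compact_UNIV_bounded[OF compact_E2 c_continuous] by blast
  then have "c x \<xi> \<le> K + 1" for x \<xi> by (metis abs_le_D1 case_prod_conv le_add_same_cancel1 order_trans zero_le_one)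
  then show ?thesis using \<open>0 \<le> K\<close> by (intro that[of "K + 1"]) auto
qed

text \<open>
  Uniform continuity handles small displacements and boundedness the others.  An affine bound is linear
  in the displacements and can therefore be integrated.
\<close>

lemma c_modulus:
  assumes e: "0 < e"
  obtains K where "0 \<le> K" "\<And>x \<xi> x' \<xi>'. \<bar>c x \<xi> - c x' \<xi>'\<bar> \<le> e + K * (dist x x' + dist \<xi> \<xi>')"
proof -
  obtain B where B: "0 < B" "\<And>x \<xi>. c x \<xi> \<le> B" using c_bounded by blast
  have "uniformly_continuous_on UNIV (\<lambda>(x, \<xi>). c x \<xi>)"
    by (rule compact_uniformly_continuous[OF c_continuous compact_E2])
  then obtain d where d: "d > 0"
    "\<And>z z'. dist z' z < d \<Longrightarrow> dist ((\<lambda>(x, \<xi>). c x \<xi>) z') ((\<lambda>(x, \<xi>). c x \<xi>) z) < e"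
    using e unfolding uniformly_continuous_on_def by blast
  show ?thesis
  proof (rule that[of "B / d"])
    show "0 \<le> B / d" using B d by simp
    fix x \<xi> x' \<xi>'
    show "\<bar>c x \<xi> - c x' \<xi>'\<bar> \<le> e + B / d * (dist x x' + dist \<xi> \<xi>')"
    proof (cases "dist x x' + dist \<xi> \<xi>' < d")
      case True
      have "dist (x, \<xi>) (x', \<xi>') \<le> dist x x' + dist \<xi> \<xi>'"
        unfolding dist_prod_def by (simp add: sqrt_sum_squares_le_sum)
      then have "\<bar>c x \<xi> - c x' \<xi>'\<bar> < e" using d(2)[of "(x, \<xi>)" "(x', \<xi>')"] True by (simp add: dist_real_def)
      moreover have "0 \<le> B / d * (dist x x' + dist \<xi> \<xi>')" using B d by simp
      ultimately show ?thesis by linarith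
    next
      case False
      have "\<bar>c x \<xi> - c x' \<xi>'\<bar> \<le> B / d * d"
        using B(2)[of x \<xi>] B(2)[of x' \<xi>'] c_nonneg[of x \<xi>] c_nonneg[of x' \<xi>'] d by simp
      also have "\<dots> \<le> B / d * (dist x x' + dist \<xi> \<xi>')"
        using False B d by (intro mult_left_mono) auto
      finally show ?thesis using e by linarith
    qed
  qed
qed

lemma intervene_lower:
  assumes "continuous_on UNIV u" shows "intervene u x \<le> c x \<xi> + u \<xi>"
proof -
  obtain K where K: "\<And>x. \<bar>u x\<bar> \<le> K" using continuous_bounded[OF assms] by metis
  have "bdd_below (range (\<lambda>\<xi>. c x \<xi> + u \<xi>))"
  proof (rule bdd_belowI[of _ "- K"])
    fix y assume "y \<in> range (\<lambda>\<xi>. c x \<xi> + u \<xi>)"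
    then obtain \<xi> where "y = c x \<xi> + u \<xi>" by auto
    then show "- K \<le> y" using K[of \<xi>] c_nonneg[of x \<xi>] by linarith
  qed
  then show ?thesis unfolding intervene_def by (rule cINF_lower) simp
qed

lemma intervene_greatest: "(\<And>\<xi>. a \<le> c x \<xi> + u \<xi>) \<Longrightarrow> a \<le> intervene u x"
  unfolding intervene_def by (rule cINF_greatest) auto

lemma intervene_continuous:
  assumes u: "continuous_on UNIV u" shows "continuous_on UNIV (intervene u)"
  unfolding continuous_on_iff
proof (intro ballI allI impI)
  fix x and e :: real assume e: "0 < e"
  obtain K where K: "0 \<le> K" "\<And>x \<xi> x' \<xi>'. \<bar>c x \<xi> - c x' \<xi>'\<bar> \<le> e / 2 + K * (dist x x' + dist \<xi> \<xi>')"
    using c_modulus[of "e / 2"] e by (metis half_gt_zero)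
  have one: "intervene u x \<le> intervene u y + e / 2 + K * dist x y" for x y
  proof -
    have "intervene u x - (e / 2 + K * dist x y) \<le> intervene u y"
    proof (rule intervene_greatest)
      fix \<xi>
      show "intervene u x - (e / 2 + K * dist x y) \<le> c y \<xi> + u \<xi>"
        using intervene_lower[OF u, of x \<xi>] K(2)[of x \<xi> y \<xi>] by simp
    qed
    then show ?thesis by simp
  qed
  show "\<exists>d>0. \<forall>y\<in>UNIV. dist y x < d \<longrightarrow> dist (intervene u y) (intervene u x) < e"
  proof (intro exI[of _ "e / 2 / (K + 1)"] conjI ballI impI)
    show "0 < e / 2 / (K + 1)" using e K(1) by simp
    fix y assume "dist y x < e / 2 / (K + 1)"
    then have "(K + 1) * dist y x < e / 2" using K(1) by (simp add: field_simps)
    moreover have "K * dist y x \<le> (K + 1) * dist y x" by (intro mult_right_mono) auto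
    ultimately have "K * dist y x < e / 2" by linarith
    then show "dist (intervene u y) (intervene u x) < e"
      using one[of x y] one[of y x] by (simp add: dist_real_def dist_commute)
  qed
qed

lemma transition_g_time_measurable: "(\<lambda>s. transition (max 0 s) g x) \<in> borel_measurable borel"
  using measurable_compose[OF measurable_Pair2' transition_jointly_measurable[OF g_continuous], of x] by simp

lemma g_bound:
  obtains K where "0 \<le> K" "\<And>x. \<bar>g x\<bar> \<le> K"
  using continuous_bounded[OF g_continuous] by blast

lemma transition_g_bound: "(\<And>x. \<bar>g x\<bar> \<le> K) \<Longrightarrow> \<bar>transition (max 0 s) g x\<bar> \<le> K"
  by (intro transition_bounded continuous_borel[OF g_continuous]) auto

lemma running_cost_bound:
  assumes h: "0 \<le> h" and K: "\<And>x. \<bar>g x\<bar> \<le> K"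
  shows "\<bar>running_cost h x\<bar> \<le> K * h"
  using set_integral_Icc_bound[OF transition_g_time_measurable transition_g_bound[OF K] h]
  by (simp add: running_cost_def)

lemma running_cost_continuous: "continuous_on UNIV (running_cost h)"
proof (rule continuous_on_sequentiallyI)
  fix u and a :: 'e assume u: "u \<longlonglongrightarrow> a"
  obtain K where K: "0 \<le> K" "\<And>x. \<bar>g x\<bar> \<le> K" using g_bound by blast
  note [measurable] = transition_g_time_measurable
  show "(\<lambda>n. running_cost h (u n)) \<longlonglongrightarrow> running_cost h a"
    unfolding running_cost_def set_lebesgue_integral_def
  proof (rule integral_dominated_convergence[where w="\<lambda>s. indicator {0..h} s * K"])
    show "integrable lborel (\<lambda>s. indicator {0..h} s * K)" by (rule integrable_indicator_Icc)
    show "AE s in lborel. (\<lambda>n. indicator {0..h} s *\<^sub>R transition (max 0 s) g (u n))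
      \<longlonglongrightarrow> indicator {0..h} s *\<^sub>R transition (max 0 s) g a"
      using u by (intro AE_I2 tendsto_intros continuous_on_tendsto_compose[OF transition_continuous[OF _ g_continuous]]) auto
    show "AE s in lborel. norm (indicator {0..h} s *\<^sub>R transition (max 0 s) g (u n)) \<le> indicator {0..h} s * K" for n
      by (intro AE_I2) (auto simp: abs_mult intro!: mult_left_mono transition_g_bound[OF K(2)])
  qed measurable
qed

text \<open>
  Minimizing over one impulse or none is non-expansive in the supremum norm, and the transition operator
  is multiplied by \<open>\<rho>\<close>: the right-hand side is a contraction of the bounded continuous functions.
\<close>

lemma discounted_bellman:
  assumes h: "0 < h" and \<rho>: "0 \<le> \<rho>" "\<rho> < 1"
  obtains v where "continuous_on UNIV v"
    "\<And>x. v x = min (running_cost h x + \<rho> * transition h v x)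
                     (intervene (\<lambda>y. running_cost h y + \<rho> * transition h v y) x)"
proof -
  define L where "L v x = running_cost h x + \<rho> * transition h v x" for v x
  define T where "T v = Bcontfun (\<lambda>x. min (L (apply_bcontfun v) x) (intervene (L (apply_bcontfun v)) x))"
    for v :: "'e \<Rightarrow>\<^sub>C real"
  have h0: "0 \<le> h" using h by simp
  have Lc: "continuous_on UNIV (L v)" if "continuous_on UNIV v" for v
    unfolding L_def using running_cost_continuous transition_continuous[OF h0 that] by (intro continuous_intros)
  have bc: "f \<in> bcontfun" if "continuous_on UNIV f" for f :: "'e \<Rightarrow> real"
    using continuous_bounded[OF that] that by (metis bcontfun_normI real_norm_def)
  have T: "apply_bcontfun (T v) x = min (L (apply_bcontfun v) x) (intervene (L (apply_bcontfun v)) x)" for v x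
    unfolding T_def by (subst Bcontfun_inverse) (auto intro!: bc continuous_intros Lc intervene_continuous)
  have "dist (T v) (T w) \<le> \<rho> * dist v w" for v w
  proof (rule dist_bound)
    fix x
    let ?v = "apply_bcontfun v" and ?w = "apply_bcontfun w"
    have vw: "\<bar>?v y - ?w y\<bar> \<le> dist v w" for y using dist_bounded[of v y w] by (simp add: dist_real_def)
    have cv: "continuous_on UNIV ?v" "continuous_on UNIV ?w" by auto
    have LL: "\<bar>L ?v y - L ?w y\<bar> \<le> \<rho> * dist v w" for y
    proof -
      obtain K where K: "\<And>x. \<bar>?v x\<bar> \<le> K" using continuous_bounded[OF cv(1)] by metis
      obtain K' where K': "\<And>x. \<bar>?w x\<bar> \<le> K'" using continuous_bounded[OF cv(2)] by metis
      have "L ?v y - L ?w y = \<rho> * transition h (\<lambda>z. ?v z - ?w z) y"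
        unfolding L_def using transition_diff[OF h0 continuous_borel[OF cv(1)] K continuous_borel[OF cv(2)] K']
        by (simp add: right_diff_distrib)
      also have "\<bar>\<dots>\<bar> \<le> \<rho> * dist v w"
        unfolding abs_mult using \<rho>(1) vw
        by (auto intro!: mult_left_mono transition_bounded[OF h0] continuous_borel continuous_intros)
      finally show ?thesis .
    qed
    have I: "intervene (L ?v) x - \<rho> * dist v w \<le> intervene (L ?w) x"
    proof (rule intervene_greatest)
      show "intervene (L ?v) x - \<rho> * dist v w \<le> c x \<xi> + L ?w \<xi>" for \<xi>
        using intervene_lower[OF Lc[OF cv(1)], of x \<xi>] LL[of \<xi>] by linarith
    qed
    have I': "intervene (L ?w) x - \<rho> * dist v w \<le> intervene (L ?v) x"
    proof (rule intervene_greatest)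
      show "intervene (L ?w) x - \<rho> * dist v w \<le> c x \<xi> + L ?v \<xi>" for \<xi>
        using intervene_lower[OF Lc[OF cv(2)], of x \<xi>] LL[of \<xi>] by linarith
    qed
    show "dist (apply_bcontfun (T v) x) (apply_bcontfun (T w) x) \<le> \<rho> * dist v w"
      unfolding T dist_real_def using I I' LL[of x] by linarith
  qed
  then obtain v where "T v = v" using banach_fix_type[OF \<rho>, of T] by blast
  have L_eq: "L w = (\<lambda>y. running_cost h y + \<rho> * transition h w y)" for w by (rule ext) (simp add: L_def)
  have "apply_bcontfun v x = min (running_cost h x + \<rho> * transition h (apply_bcontfun v) x)
      (intervene (\<lambda>y. running_cost h y + \<rho> * transition h (apply_bcontfun v) y) x)" for x
    using T[of v x] unfolding \<open>T v = v\<close> L_eq .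
  then show ?thesis by (rule that[rotated]) auto
qed

text \<open>
  The pair \<open>(v, u)\<close> is the discounted solution and its one-step continuation, both shifted by the value
  of the former at an arbitrary point.  Two consecutive impulses are never better than one, which gives
  \<open>v(x) \<le> c(x,\<xi>) + v(\<xi>)\<close> and bounds the oscillation of \<open>v\<close> by \<open>sup c\<close>; the term \<open>(1 - \<rho>) P\<^sub>h v\<close> dropped
  from the equation is thus at most \<open>(1 - \<rho>) sup c\<close>.
\<close>

lemma approximate_bellman:
  assumes h: "0 < h" and \<eta>: "0 < \<eta>" and Kg: "\<And>x. \<bar>g x\<bar> \<le> Kg"
  obtains v u \<mu> where "continuous_on UNIV v" "continuous_on UNIV u"
    "\<And>x. v x = min (u x) (intervene u x)" "\<And>x \<xi>. v x \<le> c x \<xi> + v \<xi>"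
    "\<And>x. \<bar>u x - (running_cost h x + transition h v x - \<mu> * h)\<bar> \<le> \<eta>"
    "\<bar>\<mu>\<bar> \<le> Kg"
proof -
  obtain Kc where Kc: "0 < Kc" "\<And>x \<xi>. c x \<xi> \<le> Kc" using c_bounded by blast
  have h0: "0 \<le> h" using h by simp
  \<comment> \<open>so that \<open>0 \<le> \<rho> < 1\<close> and \<open>(1 - \<rho>) sup c \<le> \<eta>\<close>\<close>
  define \<rho> where "\<rho> = 1 - min 1 (\<eta> / Kc)"
  have \<rho>: "0 \<le> \<rho>" "\<rho> < 1" using \<eta> Kc by (auto simp: \<rho>_def)
  have "(1 - \<rho>) * Kc \<le> \<eta> / Kc * Kc" using Kc(1) by (intro mult_right_mono) (auto simp: \<rho>_def)
  then have \<rho>K: "(1 - \<rho>) * Kc \<le> \<eta>" using Kc(1) by simp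
  obtain w where wc: "continuous_on UNIV w" and w: "\<And>x. w x = min (running_cost h x + \<rho> * transition h w x)
                     (intervene (\<lambda>y. running_cost h y + \<rho> * transition h w y) x)"
    using discounted_bellman[OF h \<rho>] by blast
  define L where "L x = running_cost h x + \<rho> * transition h w x" for x
  have Lc: "continuous_on UNIV L"
    unfolding L_def using running_cost_continuous transition_continuous[OF h0 wc] by (intro continuous_intros)
  have wL: "w x = min (L x) (intervene L x)" for x unfolding L_def by (rule w)
  obtain Kw where Kw: "\<And>x. \<bar>w x\<bar> \<le> Kw" using continuous_bounded[OF wc] by metis
  have tri: "w x \<le> c x \<xi> + w \<xi>" for x \<xi>
  proof -
    have "w x \<le> c x \<xi> + L \<xi>" using wL[of x] intervene_lower[OF Lc, of x \<xi>] by linarith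
    moreover have "w x - c x \<xi> \<le> intervene L \<xi>"
    proof (rule intervene_greatest)
      show "w x - c x \<xi> \<le> c \<xi> \<zeta> + L \<zeta>" for \<zeta>
        using wL[of x] intervene_lower[OF Lc, of x \<zeta>] c_triangle[of x \<zeta> \<xi>] by linarith
    qed
    ultimately show ?thesis using wL[of \<xi>] by linarith
  qed
  have span: "\<bar>w x - w y\<bar> \<le> Kc" for x y
    using tri[of x y] tri[of y x] Kc(2)[of x y] Kc(2)[of y x] by linarith
  define z where "z = (undefined :: 'e)"
  define v where "v x = w x - w z" for x
  define u where "u x = L x - w z" for x
  define \<mu> where "\<mu> = (1 - \<rho>) * w z / h"
  have \<mu>h: "\<mu> * h = (1 - \<rho>) * w z" using h by (simp add: \<mu>_def)
  have tv: "transition h v x = transition h w x - w z" for x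
    unfolding v_def using transition_diff[OF h0 continuous_borel[OF wc] Kw, of "\<lambda>_. w z" Kw x] Kw
    by (simp add: transition_const)
  have tvK: "\<bar>transition h v x\<bar> \<le> Kc" for x
    using span wc by (intro transition_bounded[OF h0] continuous_borel) (auto simp: v_def intro!: continuous_intros)
  \<comment> \<open>at its extreme points the equation confines \<open>(1 - \<rho>) w\<close> to \<open>[-h sup \<bar>g\<bar>, h sup \<bar>g\<bar>]\<close>, which bounds \<open>\<mu>\<close>\<close>
  obtain a where a: "\<And>y. w a \<le> w y"
    using continuous_attains_inf[OF compact_E _ wc] by auto
  obtain b where b: "\<And>y. w y \<le> w b"
    using continuous_attains_sup[OF compact_E _ wc] by auto
  note rb = running_cost_bound[OF h0 Kg]
  have La: "- (Kg * h) + \<rho> * w a \<le> L y" for y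
  proof -
    have "transition h (\<lambda>_. w a) y \<le> transition h w y"
      by (rule transition_mono[OF h0 _ _ continuous_borel[OF wc] Kw, of _ "\<bar>w a\<bar>"]) (use a in auto)
    then have "\<rho> * w a \<le> \<rho> * transition h w y" using \<rho>(1) by (intro mult_left_mono) (auto simp: transition_const)
    then show ?thesis using rb[of y] by (simp add: L_def)
  qed
  have Lb: "L y \<le> Kg * h + \<rho> * w b" for y
  proof -
    have "transition h w y \<le> transition h (\<lambda>_. w b) y"
      by (rule transition_mono[OF h0 continuous_borel[OF wc] Kw, of _ "\<bar>w b\<bar>"]) (use b in auto)
    then have "\<rho> * transition h w y \<le> \<rho> * w b" using \<rho>(1) by (intro mult_left_mono) (auto simp: transition_const)
    then show ?thesis using rb[of y] by (simp add: L_def)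
  qed
  have "- (Kg * h) + \<rho> * w a \<le> intervene L a"
  proof (rule intervene_greatest)
    show "- (Kg * h) + \<rho> * w a \<le> c a \<xi> + L \<xi>" for \<xi> using La[of \<xi>] c_nonneg[of a \<xi>] by linarith
  qed
  then have "- (Kg * h) + \<rho> * w a \<le> w a" using La[of a] wL[of a] by linarith
  moreover have "(1 - \<rho>) * w a \<le> (1 - \<rho>) * w z" using a \<rho> by (intro mult_left_mono) auto
  ultimately have 1: "- (Kg * h) \<le> (1 - \<rho>) * w z" by (simp add: left_diff_distrib)
  have "w b \<le> Kg * h + \<rho> * w b" using Lb[of b] wL[of b] by linarith
  moreover have "(1 - \<rho>) * w z \<le> (1 - \<rho>) * w b" using b \<rho> by (intro mult_left_mono) auto
  ultimately have 2: "(1 - \<rho>) * w z \<le> Kg * h" by (simp add: left_diff_distrib)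
  show ?thesis
  proof (rule that[of v u \<mu>])
    show "continuous_on UNIV v" "continuous_on UNIV u"
      unfolding v_def u_def using wc Lc by (auto intro!: continuous_intros)
    show "v x \<le> c x \<xi> + v \<xi>" for x \<xi> using tri[of x \<xi>] by (simp add: v_def)
    show "\<bar>\<mu>\<bar> \<le> Kg" unfolding \<mu>_def using 1 2 h by (simp add: abs_le_iff field_simps)
    show "\<bar>u x - (running_cost h x + transition h v x - \<mu> * h)\<bar> \<le> \<eta>" for x
    proof -
      have "u x - (running_cost h x + transition h v x - \<mu> * h) = - (1 - \<rho>) * transition h v x"
        unfolding u_def L_def tv \<mu>h by (simp add: algebra_simps)
      also have "\<bar>\<dots>\<bar> \<le> (1 - \<rho>) * Kc" unfolding abs_mult using \<rho> tvK[of x] by (intro mult_mono) auto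
      finally show ?thesis using \<rho>K by linarith
    qed
    show "v x = min (u x) (intervene u x)" for x
    proof -
      have "intervene u x \<le> intervene L x - w z"
      proof -
        have "intervene u x + w z \<le> intervene L x"
        proof (rule intervene_greatest)
          have "continuous_on UNIV u" unfolding u_def using Lc by (intro continuous_intros)
          then show "intervene u x + w z \<le> c x \<xi> + L \<xi>" for \<xi>
            using intervene_lower[of u x \<xi>] by (simp add: u_def)
        qed
        then show ?thesis by simp
      qed
      moreover have "intervene L x - w z \<le> intervene u x"
      proof (rule intervene_greatest)
        show "intervene L x - w z \<le> c x \<xi> + u \<xi>" for \<xi>
          using intervene_lower[OF Lc, of x \<xi>] by (simp add: u_def)
      qed
      ultimately show ?thesis using wL[of x] by (simp add: v_def u_def)
    qed
  qed
qed

text \<open>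
  The infimum is nearly attained on a countable dense set; the first good point of an enumeration
  depends measurably on the state.
\<close>

lemma measurable_near_minimizer:
  assumes u: "continuous_on UNIV u" and \<eta>: "0 < \<eta>"
  obtains sel where "sel \<in> borel \<rightarrow>\<^sub>M borel" "\<And>x. c x (sel x) + u (sel x) \<le> intervene u x + \<eta>"
proof -
  obtain D :: "'e set" where D: "countable D" "\<And>X. open X \<Longrightarrow> X \<noteq> {} \<Longrightarrow> \<exists>d\<in>D. d \<in> X"
    using countable_dense_setE by auto
  have "D \<noteq> {}" using D(2)[of UNIV] by auto
  define d where "d = from_nat_into D"
  have d: "range d = D" unfolding d_def using range_from_nat_into[OF \<open>D \<noteq> {}\<close> D(1)] .
  define n where "n x = (LEAST n. c x (d n) + u (d n) < intervene u x + \<eta>)" for x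
  have cc: "continuous_on UNIV (\<lambda>x. c x \<xi>)" "continuous_on UNIV (c x)" for x \<xi>
    by (rule continuous_on_compose2[OF c_continuous, of UNIV "\<lambda>x. (x, \<xi>)", simplified],
        auto intro!: continuous_intros)
      (rule continuous_on_compose2[OF c_continuous, of UNIV "\<lambda>\<xi>. (x, \<xi>)", simplified],
        auto intro!: continuous_intros)
  have ex: "\<exists>n. c x (d n) + u (d n) < intervene u x + \<eta>" for x
  proof -
    have "open {\<xi>. c x \<xi> + u \<xi> < intervene u x + \<eta>}"
      using u cc by (intro open_Collect_less continuous_intros) auto
    moreover have "{\<xi>. c x \<xi> + u \<xi> < intervene u x + \<eta>} \<noteq> {}"
    proof
      assume "{\<xi>. c x \<xi> + u \<xi> < intervene u x + \<eta>} = {}"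
      then have "intervene u x + \<eta> \<le> c x \<xi> + u \<xi>" for \<xi> by (auto simp: not_less)
      then have "intervene u x + \<eta> \<le> intervene u x" by (rule intervene_greatest)
      then show False using \<eta> by simp
    qed
    ultimately obtain \<xi> where "\<xi> \<in> D" "c x \<xi> + u \<xi> < intervene u x + \<eta>" using D(2) by blast
    then show ?thesis using d by (metis imageE)
  qed
  note [measurable] = continuous_borel[OF cc(1)] continuous_borel[OF intervene_continuous[OF u]]
  show ?thesis
  proof (rule that[of "\<lambda>x. d (n x)"])
    have "n \<in> borel \<rightarrow>\<^sub>M count_space UNIV" unfolding n_def by measurable
    then show "(\<lambda>x. d (n x)) \<in> borel \<rightarrow>\<^sub>M borel" by (rule measurable_compose) simp
    show "c x (d (n x)) + u (d (n x)) \<le> intervene u x + \<eta>" for x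
      unfolding n_def using LeastI_ex[OF ex[of x]] by simp
  qed
qed

end

section \<open>Laws of controlled processes\<close>

lemma sets_PiM_mono:
  assumes "\<And>j. j \<in> I \<Longrightarrow> space (A j) = space (B j)" "\<And>j. j \<in> I \<Longrightarrow> sets (A j) \<subseteq> sets (B j)"
  shows "sets (PiM I A) \<subseteq> sets (PiM I B)"
proof
  fix S assume S: "S \<in> sets (PiM I A)"
  have sp: "space (PiM I A) = space (PiM I B)" using assms(1) by (simp add: space_PiM cong: PiE_cong)
  have "(\<lambda>\<omega>. \<omega>) \<in> PiM I B \<rightarrow>\<^sub>M PiM I A"
  proof (rule measurable_PiM_single)
    show "(\<lambda>\<omega>. \<omega>) \<in> space (PiM I B) \<rightarrow> (\<Pi>\<^sub>E i\<in>I. space (A i))"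
      using sp by (auto simp: space_PiM)
    fix Y i assume "Y \<in> sets (A i)" "i \<in> I"
    then have "Y \<in> sets (B i)" using assms(2) by auto
    then show "{\<omega> \<in> space (PiM I B). \<omega> i \<in> Y} \<in> sets (PiM I B)"
      using \<open>i \<in> I\<close> by measurable
  qed
  from measurable_sets[OF this S] show "S \<in> sets (PiM I B)"
    using sets.sets_into_space[OF S] sp by (simp add: Int_absorb2)
qed

lemma sets_sigma_empty: "sets (sigma \<Omega> {}) = {{}, \<Omega>}"
  by (simp add: sigma_sets_empty_eq)

context filtration
begin

abbreviation paths :: "(nat \<Rightarrow> 'a) set" where
  "paths \<equiv> (\<Pi>\<^sub>E j\<in>{1..}. \<Omega>)"

end

context markov_process
begin

abbreviation "\<F> \<equiv> prod_filtration \<Omega> F"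

lemma space_prod_filtration: "space (\<F> i t) = paths"
  unfolding prod_filtration_def space_PiM by (rule PiE_cong) (simp add: space_F)

lemma sets_prod_filtration_mono:
  assumes "i \<le> k" "s \<le> t" shows "sets (\<F> i s) \<subseteq> sets (\<F> k t)"
  unfolding prod_filtration_def
proof (rule sets_PiM_mono)
  fix j
  have "{{}, \<Omega>} \<subseteq> sets (F t)" using sets.top[of "F t"] by (simp add: space_F)
  then show "sets (if j \<le> i then F s else sigma \<Omega> {}) \<subseteq> sets (if j \<le> k then F t else sigma \<Omega> {})"
    using assms sets_F_mono[of s t] by (auto simp: sets_sigma_empty)
qed (auto simp: space_F)

lemma sets_prod_filtration_subset: "sets (\<F> i t) \<subseteq> sets (\<Pi>\<^sub>M j\<in>{1..}. F \<infinity>)"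
  unfolding prod_filtration_def
proof (rule sets_PiM_mono)
  fix j
  have "{{}, \<Omega>} \<subseteq> sets (F \<infinity>)" using sets.top[of "F \<infinity>"] by (simp add: space_F)
  then show "sets (if j \<le> i then F t else sigma \<Omega> {}) \<subseteq> sets (F \<infinity>)"
    using sets_F_mono[of t \<infinity>] by (auto simp: sets_sigma_empty)
qed (auto simp: space_F)

lemma filtration_prod: "filtration paths (\<F> i)"
  by unfold_locales (use space_prod_filtration sets_prod_filtration_mono in auto)

lemma copy_adapted:
  assumes "1 \<le> j" "j \<le> i" "0 \<le> s" "ennreal s \<le> t"
  shows "(\<lambda>\<omega>. X s (\<omega> j)) \<in> borel_measurable (\<F> i t)"
proof -
  have "X s \<in> borel_measurable (F t)"
    using measurable_mono[OF order_refl refl sets_F_mono[OF assms(4)]] adapted[OF assms(3)]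
    by (auto simp: space_F)
  moreover have "(\<lambda>\<omega>. \<omega> j) \<in> \<F> i t \<rightarrow>\<^sub>M (if j \<le> i then F t else sigma \<Omega> {})"
    unfolding prod_filtration_def by (rule measurable_component_singleton) (use assms in simp)
  ultimately show ?thesis using assms by (auto intro: measurable_compose)
qed

text \<open>
  All factors beyond the first carry the trivial \<open>\<sigma>\<close>-algebra.  This reduces the Markov property of the
  first copy, whose law is \<open>P x\<close>, to that of the original process.
\<close>

lemma prod_filtration_first_copy:
  assumes "A \<in> sets (\<F> 1 t)"
  obtains A' where "A' \<in> sets (F t)" "A = {\<omega> \<in> paths. \<omega> 1 \<in> A'}"
proof -
  have sp: "(\<Pi>\<^sub>E j\<in>{1..}. space (if j \<le> 1 then F t else sigma \<Omega> {})) = paths"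
    by (rule PiE_cong) (simp add: space_F)
  have "A \<in> sigma_sets paths {{\<omega> \<in> paths. \<omega> j \<in> B} | j B. j \<in> {1::nat..} \<and> B \<in> sets (if j \<le> 1 then F t else sigma \<Omega> {})}"
    using assms unfolding prod_filtration_def sets_PiM_single sp .
  then have "\<exists>A'\<in>sets (F t). A = {\<omega> \<in> paths. \<omega> 1 \<in> A'}"
  proof induction
    case (Basic a)
    then obtain j B where a: "a = {\<omega> \<in> paths. \<omega> j \<in> B}" "1 \<le> j"
      and B: "B \<in> sets (if j \<le> 1 then F t else sigma \<Omega> {})" by auto
    show ?case
    proof (cases "j = 1")
      case True then show ?thesis using a B by (intro bexI[of _ B]) auto
    next
      case False
      then have "B = {} \<or> B = \<Omega>" using a B by (auto simp: sets_sigma_empty)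
      then show ?thesis
      proof
        assume "B = \<Omega>"
        then have "a = {\<omega> \<in> paths. \<omega> 1 \<in> \<Omega>}" using a by auto
        then show ?thesis using sets.top[of "F t"] by (auto simp: space_F)
      qed (use a in \<open>auto intro!: bexI[of _ "{}"]\<close>)
    qed
  next
    case Empty then show ?case by (intro bexI[of _ "{}"]) auto
  next
    case (Compl a)
    then obtain A' where A': "A' \<in> sets (F t)" "a = {\<omega> \<in> paths. \<omega> 1 \<in> A'}" by auto
    then have "paths - a = {\<omega> \<in> paths. \<omega> 1 \<in> space (F t) - A'}" by (auto simp: space_F)
    then show ?case using A' by (intro bexI[of _ "space (F t) - A'"]) auto
  next
    case (Union a)
    then have "\<forall>i. \<exists>A'. A' \<in> sets (F t) \<and> a i = {\<omega> \<in> paths. \<omega> 1 \<in> A'}"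
      unfolding Bex_def by (intro allI)
    from choice[OF this] obtain A' where "\<forall>i. A' i \<in> sets (F t) \<and> a i = {\<omega> \<in> paths. \<omega> 1 \<in> A' i}" ..
    then have A': "A' i \<in> sets (F t)" "a i = {\<omega> \<in> paths. \<omega> 1 \<in> A' i}" for i by auto
    have "(\<Union>i. a i) = {\<omega> \<in> paths. \<omega> 1 \<in> (\<Union>i. A' i)}" unfolding A'(2) by blast
    then show ?case using A'(1) by (intro bexI[of _ "\<Union>i. A' i"]) auto
  qed
  then show ?thesis using that by blast
qed

end

locale controlled = impulse_problem \<Omega> F X P g c c\<^sub>0
  for \<Omega> :: "'w set" and F :: "ennreal \<Rightarrow> 'w measure"
    and X :: "real \<Rightarrow> 'w \<Rightarrow> 'e::polish_space" and P :: "'e \<Rightarrow> 'w measure"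
    and g :: "'e \<Rightarrow> real" and c :: "'e \<Rightarrow> 'e \<Rightarrow> real" and c\<^sub>0 :: real +
  fixes x :: 'e and \<tau> :: "nat \<Rightarrow> (nat \<Rightarrow> 'w) \<Rightarrow> ennreal" and \<xi> :: "nat \<Rightarrow> (nat \<Rightarrow> 'w) \<Rightarrow> 'e"
    and M :: "(nat \<Rightarrow> 'w) measure"
  assumes strategy: "(\<tau>, \<xi>) \<in> strategies \<Omega> F"
    and law: "controlled_law \<Omega> F X P x (\<tau>, \<xi>) M"
begin

sublocale M: prob_space M
  using law by (simp add: controlled_law_def)

lemma sets_M: "sets M = sets (\<Pi>\<^sub>M j\<in>{1..}. F \<infinity>)"
  using law by (simp add: controlled_law_def)

lemma space_M: "space M = paths"
  using sets_eq_imp_space_eq[OF sets_M] by (simp add: space_PiM space_F)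

lemma prod_filtration_sets_M: "A \<in> sets (\<F> i t) \<Longrightarrow> A \<in> sets M"
  using sets_prod_filtration_subset sets_M by auto

lemma tau_0: "\<tau> 0 \<omega> = 0"
  using strategy by (simp add: strategies_def)

lemma tau_Suc: "\<omega> \<in> paths \<Longrightarrow> \<tau> n \<omega> \<le> \<tau> (Suc n) \<omega>"
  using strategy by (simp add: strategies_def)

lemma tau_mono: "\<omega> \<in> paths \<Longrightarrow> m \<le> n \<Longrightarrow> \<tau> m \<omega> \<le> \<tau> n \<omega>"
  by (rule lift_Suc_mono_le[of "\<lambda>n. \<tau> n \<omega>", OF tau_Suc])

lemma tau_stopping: "1 \<le> i \<Longrightarrow> stopping_time (\<F> i) (\<tau> i)"
  using strategy by (simp add: strategies_def)

lemma tau_stopping_later: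
  assumes "l \<le> i" "1 \<le> i" shows "stopping_time (\<F> i) (\<tau> l)"
proof (cases "l = 0")
  case True
  then have "\<tau> l = (\<lambda>_. 0)" using tau_0 by auto
  then show ?thesis by (simp add: stopping_time_const)
next
  case False
  show ?thesis
  proof
    fix t
    have "Measurable.pred (\<F> l t) (\<lambda>\<omega>. \<tau> l \<omega> \<le> t)" using tau_stopping[of l] False by (auto dest: stopping_timeD)
    then show "Measurable.pred (\<F> i t) (\<lambda>\<omega>. \<tau> l \<omega> \<le> t)"
      using sets_prod_filtration_mono[OF assms(1) order_refl, of t] by (auto simp: pred_def space_prod_filtration)
  qed
qed

lemma tau_measurable [measurable]: "\<tau> l \<in> borel_measurable M"
proof (rule measurable_stopping_time)
  show "stopping_time (\<F> (Suc l)) (\<tau> l)" by (rule tau_stopping_later) auto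
  show "sets (\<F> (Suc l) t) \<subseteq> sets M" for t using sets_prod_filtration_subset sets_M by auto
  show "space (\<F> (Suc l) t) = space M" for t by (simp add: space_prod_filtration space_M)
qed

lemma tau_event:
  assumes "l \<le> i" "1 \<le> i" "s \<le> t"
  shows "{\<omega> \<in> paths. \<tau> l \<omega> \<le> s} \<in> sets (\<F> i t)"
proof -
  have "Measurable.pred (\<F> i s) (\<lambda>\<omega>. \<tau> l \<omega> \<le> s)"
    using tau_stopping_later[OF assms(1,2)] by (rule stopping_timeD)
  then show ?thesis
    using sets_prod_filtration_mono[OF order_refl assms(3), of i] by (auto simp: pred_def space_prod_filtration)
qed

lemma copy_measurable: "1 \<le> i \<Longrightarrow> (\<lambda>\<omega>. \<omega> i) \<in> M \<rightarrow>\<^sub>M F \<infinity>"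
  unfolding measurable_cong_sets[OF sets_M refl] by (rule measurable_component_singleton) simp

lemma copy_jointly_measurable:
  assumes "1 \<le> i"
  shows "(\<lambda>p. X (max 0 (fst p)) (snd p i)) \<in> borel_measurable (borel \<Otimes>\<^sub>M M)"
proof -
  have 1: "(\<lambda>p. X (max 0 (fst p)) (snd p)) \<in> borel_measurable (borel \<Otimes>\<^sub>M F \<infinity>)"
    using X_measurable_F right_continuous_paths
    by (intro jointly_measurable_right_continuous) (auto simp: space_F)
  have 2: "(\<lambda>p. (fst p, snd p i)) \<in> borel \<Otimes>\<^sub>M M \<rightarrow>\<^sub>M borel \<Otimes>\<^sub>M F \<infinity>"
    using copy_measurable[OF assms] by measurable
  from measurable_compose[OF 2 1] show ?thesis by simp
qed

lemma copy_at_measurable: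
  assumes "1 \<le> i" "T \<in> borel_measurable M" "\<And>\<omega>. 0 \<le> T \<omega>"
  shows "(\<lambda>\<omega>. X (T \<omega>) (\<omega> i)) \<in> borel_measurable M"
proof -
  have "(\<lambda>\<omega>. (T \<omega>, \<omega>)) \<in> M \<rightarrow>\<^sub>M borel \<Otimes>\<^sub>M M" using assms(2) by measurable
  from measurable_compose[OF this copy_jointly_measurable[OF assms(1)]] show ?thesis
    using assms(3) by (simp add: max_absorb2)
qed

text \<open>
  The uniform version of the two clauses that define a controlled law: with \<open>\<tau> 0 = 0\<close> the first copy needs
  no separate treatment later on.
\<close>

lemma copy_markov:
  assumes i: "1 \<le> i" and t: "0 \<le> t" and s: "0 \<le> s" and A: "A \<in> sets (\<F> i (ennreal t))"
    and At: "A \<subseteq> {\<omega>. \<tau> (i - 1) \<omega> \<le> ennreal t}" and B: "B \<in> sets borel"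
  shows "measure M {\<omega> \<in> A. X (t + s) (\<omega> i) \<in> B} = (LINT \<omega>:A|M. trans_prob X P s (X t (\<omega> i)) B)"
proof (cases "i = 1")
  case True
  obtain A' where A': "A' \<in> sets (F (ennreal t))" "A = {\<omega> \<in> paths. \<omega> 1 \<in> A'}"
    using prod_filtration_first_copy[of A "ennreal t"] A True by blast
  have P: "distr M (F \<infinity>) (\<lambda>\<omega>. \<omega> 1) = P x" using law by (simp add: controlled_law_def)
  have A'2: "A' \<in> sets (F \<infinity>)" using sets_F_mono[of "ennreal t" \<infinity>] A'(1) by auto
  have c1: "(\<lambda>\<omega>. \<omega> 1) \<in> M \<rightarrow>\<^sub>M F \<infinity>" by (rule copy_measurable) simp
  have AB: "{w \<in> A'. X (t + s) w \<in> B} \<in> sets (F \<infinity>)"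
  proof -
    have "{w \<in> A'. X (t + s) w \<in> B} = A' \<inter> (X (t + s) -` B \<inter> space (F \<infinity>))"
      using sets.sets_into_space[OF A'2] by auto
    also have "\<dots> \<in> sets (F \<infinity>)" using A'2 measurable_sets[OF X_measurable_F[of "t + s"] B] t s by auto
    finally show ?thesis .
  qed
  have "{\<omega> \<in> A. X (t + s) (\<omega> i) \<in> B} = (\<lambda>\<omega>. \<omega> 1) -` {w \<in> A'. X (t + s) w \<in> B} \<inter> space M"
    unfolding A'(2) space_M True by auto
  then have "measure M {\<omega> \<in> A. X (t + s) (\<omega> i) \<in> B} = measure (P x) {w \<in> A'. X (t + s) w \<in> B}"
    using measure_distr[OF c1 AB] P by simp
  also have "\<dots> = (LINT w:A'|P x. trans_prob X P s (X t w) B)"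
    by (rule markov[OF s t A'(1) B])
  also have "\<dots> = (LINT \<omega>|M. indicator A' (\<omega> 1) * trans_prob X P s (X t (\<omega> 1)) B)"
  proof -
    have m: "(\<lambda>w. indicator A' w * trans_prob X P s (X t w) B) \<in> borel_measurable (F \<infinity>)"
      using A'2 measurable_compose[OF X_measurable_F[OF t] measurable_trans_prob[OF s B]] by measurable
    show ?thesis unfolding set_lebesgue_integral_def P[symmetric]
      using integral_distr[OF c1 m] by simp
  qed
  also have "\<dots> = (LINT \<omega>:A|M. trans_prob X P s (X t (\<omega> i)) B)"
    unfolding set_lebesgue_integral_def A'(2) True
    by (intro Bochner_Integration.integral_cong refl) (auto simp: indicator_def space_M)
  finally show ?thesis .
next
  case False
  then obtain k where k: "i = Suc k" "1 \<le> k" using i by (cases i) auto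
  show ?thesis using law t s A At B k unfolding controlled_law_def by simp
qed

lemma copy_markov_integral:
  assumes i: "1 \<le> i" and t: "0 \<le> t" and s: "0 \<le> s" and A: "A \<in> sets (\<F> i (ennreal t))"
    and At: "A \<subseteq> {\<omega>. \<tau> (i - 1) \<omega> \<le> ennreal t}"
    and f: "continuous_on UNIV f"
  shows "(LINT \<omega>|M. indicator A \<omega> * f (X (t + s) (\<omega> i))) = (LINT \<omega>|M. indicator A \<omega> * transition s f (X t (\<omega> i)))"
proof -
  obtain K where K: "\<And>x. \<bar>f x\<bar> \<le> K" using continuous_bounded[OF f] by metis
  show ?thesis
    by (rule markov_integral[OF M.finite_measure_axioms prod_filtration_sets_M[OF A] s _ _
          copy_markov[OF i t s A At] continuous_borel[OF f] K])
      (use t s i in \<open>auto intro!: copy_at_measurable\<close>)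
qed

text \<open>
  If infinitely many impulses occur up to time \<open>t\<close>, this is an arbitrary number; the predicate \<open>active\<close>
  excludes this case.  The copy that is alive at time \<open>t\<close> has index one more.
\<close>

definition n_impulses :: "real \<Rightarrow> (nat \<Rightarrow> 'w) \<Rightarrow> nat" where
  "n_impulses t \<omega> = (LEAST i. ennreal t < \<tau> (Suc i) \<omega>)"

definition active :: "real \<Rightarrow> (nat \<Rightarrow> 'w) \<Rightarrow> bool" where
  "active t \<omega> \<longleftrightarrow> (\<exists>i. ennreal t < \<tau> (Suc i) \<omega>)"

definition state :: "real \<Rightarrow> (nat \<Rightarrow> 'w) \<Rightarrow> 'e" where
  "state t \<omega> = X t (\<omega> (Suc (n_impulses t \<omega>)))"

text \<open>
  The state to which the process would have evolved had all impulses after time \<open>t\<close> been cancelled.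
\<close>

definition uninterrupted :: "real \<Rightarrow> real \<Rightarrow> (nat \<Rightarrow> 'w) \<Rightarrow> 'e" where
  "uninterrupted t s \<omega> = X (t + s) (\<omega> (Suc (n_impulses t \<omega>)))"

lemma n_impulses_less: "active t \<omega> \<Longrightarrow> ennreal t < \<tau> (Suc (n_impulses t \<omega>)) \<omega>"
  unfolding active_def n_impulses_def by (rule LeastI_ex)

lemma tau_le_iff:
  assumes "active t \<omega>" "\<omega> \<in> paths"
  shows "\<tau> l \<omega> \<le> ennreal t \<longleftrightarrow> l \<le> n_impulses t \<omega>"
proof
  assume "\<tau> l \<omega> \<le> ennreal t"
  show "l \<le> n_impulses t \<omega>"
  proof (rule ccontr)
    assume "\<not> l \<le> n_impulses t \<omega>"
    then have "\<tau> (Suc (n_impulses t \<omega>)) \<omega> \<le> \<tau> l \<omega>" using assms(2) by (intro tau_mono) auto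
    then show False using n_impulses_less[OF assms(1)] \<open>\<tau> l \<omega> \<le> ennreal t\<close> by auto
  qed
next
  assume l: "l \<le> n_impulses t \<omega>"
  show "\<tau> l \<omega> \<le> ennreal t"
  proof (cases l)
    case 0 then show ?thesis by (simp add: tau_0)
  next
    case (Suc m)
    then show ?thesis using l not_less_Least[of m "\<lambda>i. ennreal t < \<tau> (Suc i) \<omega>"] by (auto simp: n_impulses_def)
  qed
qed

lemma active_antimono: "active t \<omega> \<Longrightarrow> s \<le> t \<Longrightarrow> active s \<omega>"
  unfolding active_def by (meson ennreal_leI le_less_trans)

lemma n_impulses_mono:
  assumes "active t \<omega>" "\<omega> \<in> paths" "s \<le> t" shows "n_impulses s \<omega> \<le> n_impulses t \<omega>"
proof -
  have "\<tau> (n_impulses s \<omega>) \<omega> \<le> ennreal s" using tau_le_iff[OF active_antimono[OF assms(1,3)] assms(2)] by simp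
  also have "\<dots> \<le> ennreal t" using assms(3) by (rule ennreal_leI)
  finally show ?thesis using tau_le_iff[OF assms(1,2)] by simp
qed

lemma controlled_process_eq:
  assumes "\<omega> \<in> paths"
  shows "controlled_process X (\<tau>, \<xi>) t \<omega> = (if active t \<omega> then state t \<omega> else undefined)"
proof (cases "active t \<omega>")
  case True
  let ?Q = "\<lambda>i. 1 \<le> i \<and> \<tau> (i - 1) \<omega> \<le> ennreal t \<and> ennreal t < \<tau> i \<omega>"
  have Q: "?Q i \<longleftrightarrow> i = Suc (n_impulses t \<omega>)" for i
  proof
    assume i: "?Q i"
    then have "i - 1 \<le> n_impulses t \<omega>" using tau_le_iff[OF True assms, of "i - 1"] by simp
    moreover have "\<not> i \<le> n_impulses t \<omega>" using tau_le_iff[OF True assms, of i] i by auto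
    ultimately show "i = Suc (n_impulses t \<omega>)" by simp
  next
    assume "i = Suc (n_impulses t \<omega>)"
    then show "?Q i" using n_impulses_less[OF True] tau_le_iff[OF True assms, of "n_impulses t \<omega>"] by simp
  qed
  then have "(THE i. ?Q i) = Suc (n_impulses t \<omega>)" by auto
  moreover have "\<exists>i\<ge>1. \<tau> (i - 1) \<omega> \<le> ennreal t \<and> ennreal t < \<tau> i \<omega>" using Q by blast
  ultimately show ?thesis using True unfolding controlled_process_def state_def by simp
next
  case False
  have "\<not> ennreal t < \<tau> i \<omega>" if "1 \<le> i" for i
    using False that unfolding active_def by (metis Suc_le_D One_nat_def)
  then show ?thesis using False unfolding controlled_process_def by auto
qed

lemma n_impulses_measurable [measurable]: "n_impulses t \<in> M \<rightarrow>\<^sub>M count_space UNIV"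
  unfolding n_impulses_def[abs_def] by measurable

lemma active_measurable [measurable]: "Measurable.pred M (active t)"
  unfolding active_def[abs_def] by measurable

lemma controlled_process_jointly_measurable:
  "(\<lambda>p. controlled_process X (\<tau>, \<xi>) (max 0 (fst p)) (snd p)) \<in> borel_measurable (borel \<Otimes>\<^sub>M M)"
proof -
  have c: "(\<lambda>p. n_impulses (max 0 (fst p)) (snd p)) \<in> borel \<Otimes>\<^sub>M M \<rightarrow>\<^sub>M count_space UNIV"
    unfolding n_impulses_def by measurable
  have a: "Measurable.pred (borel \<Otimes>\<^sub>M M) (\<lambda>p. active (max 0 (fst p)) (snd p))"
    unfolding active_def by measurable
  have "(\<lambda>p. X (max 0 (fst p)) (snd p (Suc (n_impulses (max 0 (fst p)) (snd p))))) \<in> borel_measurable (borel \<Otimes>\<^sub>M M)"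
    by (rule measurable_compose_countable[where f="\<lambda>k p. X (max 0 (fst p)) (snd p (Suc k))", OF _ c])
       (auto intro!: copy_jointly_measurable)
  then have m: "(\<lambda>p. if active (max 0 (fst p)) (snd p) then state (max 0 (fst p)) (snd p) else undefined)
      \<in> borel_measurable (borel \<Otimes>\<^sub>M M)"
    unfolding state_def using a by measurable
  have "snd p \<in> paths" if "p \<in> space (borel \<Otimes>\<^sub>M M)" for p
    using that by (auto simp: space_pair_measure space_M)
  note eq = controlled_process_eq[OF this]
  show ?thesis by (rule measurable_cong[THEN iffD2, OF eq m])
qed

lemma uninterrupted_measurable:
  assumes "0 \<le> t" "0 \<le> s"
  shows "uninterrupted t s \<in> borel_measurable M"
  unfolding uninterrupted_def[abs_def]
  by (rule measurable_compose_countable[where f="\<lambda>k \<omega>. X (t + s) (\<omega> (Suc k))" and g="n_impulses t"])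
     (use assms in \<open>auto intro!: copy_at_measurable\<close>)

lemma state_measurable: "0 \<le> t \<Longrightarrow> state t \<in> borel_measurable M"
  using uninterrupted_measurable[of t 0] by (simp add: uninterrupted_def[abs_def] state_def[abs_def])

lemma uninterrupted_integrable:
  assumes f: "continuous_on UNIV (f :: 'e \<Rightarrow> real)" and ts: "0 \<le> t" "0 \<le> s"
  shows "integrable M (\<lambda>\<omega>. f (uninterrupted t s \<omega>))"
proof -
  obtain K where K: "\<And>x. \<bar>f x\<bar> \<le> K" using continuous_bounded[OF f] by metis
  show ?thesis
    using measurable_compose[OF uninterrupted_measurable[OF ts] continuous_borel[OF f]] K
    by (intro M.integrable_const_bound[where B=K]) auto
qed

lemma state_integrable:
  "continuous_on UNIV (f :: 'e \<Rightarrow> real) \<Longrightarrow> 0 \<le> t \<Longrightarrow> integrable M (\<lambda>\<omega>. f (state t \<omega>))"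
  using uninterrupted_integrable[of f t 0] by (simp add: uninterrupted_def[abs_def] state_def[abs_def])

lemma integral_by_copy:
  assumes act: "AE \<omega> in M. active t \<omega>"
    and H: "\<And>k. H k \<in> borel_measurable M" "\<And>k \<omega>. \<bar>H k \<omega>\<bar> \<le> (K :: real)"
  shows "(LINT \<omega>|M. H (n_impulses t \<omega>) \<omega>)
      = (\<Sum>k. LINT \<omega>|M. indicator {\<omega> \<in> paths. active t \<omega> \<and> n_impulses t \<omega> = k} \<omega> * H k \<omega>)"
proof -
  define A where "A k = {\<omega> \<in> paths. active t \<omega> \<and> n_impulses t \<omega> = k}" for k
  have Am [measurable]: "A k \<in> sets M" for k
    unfolding A_def space_M[symmetric] by measurable
  have Hc: "(\<lambda>\<omega>. H (n_impulses t \<omega>) \<omega>) \<in> borel_measurable M"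
    by (rule measurable_compose_countable[where f=H, OF H(1)]) measurable
  have int: "integrable M (\<lambda>\<omega>. H (n_impulses t \<omega>) \<omega>)"
    using Hc H(2) by (intro M.integrable_const_bound[where B=K]) auto
  have "(LINT \<omega>|M. H (n_impulses t \<omega>) \<omega>) = (LINT \<omega>:(\<Union>k. A k)|M. H (n_impulses t \<omega>) \<omega>)"
    unfolding set_lebesgue_integral_def
  proof (rule integral_cong_AE)
    show "AE \<omega> in M. H (n_impulses t \<omega>) \<omega> = indicator (\<Union>k. A k) \<omega> *\<^sub>R H (n_impulses t \<omega>) \<omega>"
      using act AE_space by eventually_elim (auto simp: A_def space_M)
  qed (use Hc in measurable)
  also have "\<dots> = (\<Sum>k. LINT \<omega>:A k|M. H (n_impulses t \<omega>) \<omega>)"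
  proof (rule lebesgue_integral_countable_add[OF Am])
    show "A i \<inter> A j = {}" if "i \<noteq> j" for i j using that by (auto simp: A_def)
    show "set_integrable M (\<Union>i. A i) (\<lambda>\<omega>. H (n_impulses t \<omega>) \<omega>)"
      unfolding set_integrable_def using int by (intro integrable_mult_indicator) measurable
  qed
  also have "\<dots> = (\<Sum>k. LINT \<omega>|M. indicator (A k) \<omega> * H k \<omega>)"
    unfolding set_lebesgue_integral_def
    by (intro suminf_cong Bochner_Integration.integral_cong) (auto simp: A_def indicator_def)
  finally show ?thesis unfolding A_def .
qed

text \<open>
  On the event that \<open>k\<close> impulses have occurred, which the first \<open>k + 1\<close> copies reveal at time \<open>t\<close>, the
  live copy is the one with index \<open>k + 1\<close> and \<open>copy_markov_integral\<close> applies; the events are summed.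
\<close>

lemma state_markov:
  assumes act: "AE \<omega> in M. active t \<omega>" and t: "0 \<le> t" and s: "0 \<le> s"
    and f: "continuous_on UNIV f"
  shows "(LINT \<omega>|M. f (uninterrupted t s \<omega>)) = (LINT \<omega>|M. transition s f (state t \<omega>))"
proof -
  obtain K where K: "\<And>x. \<bar>f x\<bar> \<le> K" using continuous_bounded[OF f] by metis
  note tc = transition_continuous[OF s f]
  have tK: "\<bar>transition s f y\<bar> \<le> K" for y by (rule transition_bounded[OF s continuous_borel[OF f] K])
  have m: "(\<lambda>\<omega>. X r (\<omega> (Suc k))) \<in> borel_measurable M" if "0 \<le> r" for r k
    using that by (intro copy_at_measurable) auto
  have "(LINT \<omega>|M. f (uninterrupted t s \<omega>))
     = (\<Sum>k. LINT \<omega>|M. indicator {\<omega> \<in> paths. active t \<omega> \<and> n_impulses t \<omega> = k} \<omega> * f (X (t + s) (\<omega> (Suc k))))"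
    unfolding uninterrupted_def using measurable_compose[OF m continuous_borel[OF f]] t s K
    by (intro integral_by_copy[OF act, of "\<lambda>k \<omega>. f (X (t + s) (\<omega> (Suc k)))" K]) auto
  also have "\<dots> = (\<Sum>k. LINT \<omega>|M. indicator {\<omega> \<in> paths. active t \<omega> \<and> n_impulses t \<omega> = k} \<omega> * transition s f (X t (\<omega> (Suc k))))"
  proof (rule suminf_cong)
    fix k
    have "{\<omega> \<in> paths. active t \<omega> \<and> n_impulses t \<omega> = k}
        = {\<omega> \<in> paths. \<tau> k \<omega> \<le> ennreal t} - {\<omega> \<in> paths. \<tau> (Suc k) \<omega> \<le> ennreal t}" (is "?L = ?R")
    proof (rule set_eqI)
      fix \<omega>
      show "\<omega> \<in> ?L \<longleftrightarrow> \<omega> \<in> ?R"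
      proof (cases "\<omega> \<in> paths \<and> active t \<omega>")
        case True
        then show ?thesis using tau_le_iff[of t \<omega> k] tau_le_iff[of t \<omega> "Suc k"] by auto
      next
        case False
        then have "\<omega> \<in> paths \<Longrightarrow> \<tau> (Suc k) \<omega> \<le> ennreal t" unfolding active_def not_ex not_less de_Morgan_conj by blast
        then show ?thesis using False by auto
      qed
    qed
    also have "\<dots> \<in> sets (\<F> (Suc k) (ennreal t))" by (intro sets.Diff tau_event) auto
    finally show "(LINT \<omega>|M. indicator {\<omega> \<in> paths. active t \<omega> \<and> n_impulses t \<omega> = k} \<omega> * f (X (t + s) (\<omega> (Suc k))))
      = (LINT \<omega>|M. indicator {\<omega> \<in> paths. active t \<omega> \<and> n_impulses t \<omega> = k} \<omega> * transition s f (X t (\<omega> (Suc k))))"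
      using t s f by (intro copy_markov_integral) (auto simp: tau_le_iff)
  qed
  also have "\<dots> = (LINT \<omega>|M. transition s f (state t \<omega>))"
    unfolding state_def using measurable_compose[OF m continuous_borel[OF tc]] t tK
    by (intro integral_by_copy[OF act, of "\<lambda>k \<omega>. transition s f (X t (\<omega> (Suc k)))" K, symmetric]) auto
  finally show ?thesis .
qed

end

section \<open>Displacement of the copies after random times\<close>

context feller_process
begin

lemma continuous_dist_to: "continuous_on UNIV (\<lambda>z :: 'e. dist z a)"
  by (intro continuous_intros)

lemma X_tendsto_from_right:
  assumes "\<omega> \<in> \<Omega>" "0 \<le> r" "\<And>n. r \<le> \<rho> n" "\<rho> \<longlonglongrightarrow> r"
  shows "(\<lambda>n. X (\<rho> n) \<omega>) \<longlonglongrightarrow> X r \<omega>"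
proof -
  have "continuous (at r within {r..}) (\<lambda>s. X s \<omega>)"
    using right_continuous_paths[OF assms(1,2)] by (simp add: at_within_Ici_at_right)
  then show ?thesis
    by (rule continuous_within_tendsto_compose'[OF _ _ assms(4)]) (use assms(3) in simp)
qed

end

context controlled
begin

lemma integrable_indicator: "S \<in> sets M \<Longrightarrow> integrable M (indicator S :: _ \<Rightarrow> real)"
  by (rule M.integrable_const_bound[where B=1]) (auto simp: indicator_def)

text \<open>
  The Markov property is available for functions of the later position alone.  Replacing the earlier
  position by the nearest of finitely many points costs an arbitrarily small \<open>\<delta>\<close> and makes it constant
  on each piece of a finite partition.
\<close>

lemma copy_displacement_fixed:
  assumes disp: "\<And>r y. 0 \<le> r \<Longrightarrow> r \<le> h \<Longrightarrow> transition r (\<lambda>z. dist z y) y \<le> \<epsilon>"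
    and i: "1 \<le> i" and t: "0 \<le> t" and s: "0 \<le> s" "s \<le> h" and A: "A \<in> sets (\<F> i (ennreal t))"
    and At: "A \<subseteq> {\<omega>. \<tau> (i - 1) \<omega> \<le> ennreal t}"
  shows "(LINT \<omega>|M. indicator A \<omega> * dist (X (t + s) (\<omega> i)) (X t (\<omega> i))) \<le> \<epsilon> * measure M A"
proof (rule field_le_epsilon)
  fix e :: real assume "0 < e"
  define \<delta> where "\<delta> = e / 2"
  have \<delta>: "0 < \<delta>" using \<open>0 < e\<close> by (simp add: \<delta>_def)
  obtain C where C: "finite C" "(UNIV :: 'e set) \<subseteq> (\<Union>a\<in>C. ball a \<delta>)"
    using compact_E \<delta> unfolding compact_eq_totally_bounded by blast
  obtain cs where cs: "set cs = C" using finite_list[OF C(1)] by blast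
  define m where "m = length cs"
  define q where "q y = (LEAST n. n < m \<and> dist y (cs ! n) < \<delta>)" for y
  have q: "q y < m \<and> dist y (cs ! q y) < \<delta>" for y
  proof -
    have "y \<in> (\<Union>a\<in>C. ball a \<delta>)" using C(2) by blast
    then obtain a where "a \<in> C" "dist a y < \<delta>" by auto
    then have "\<exists>n. n < m \<and> dist y (cs ! n) < \<delta>"
      using cs by (metis dist_commute in_set_conv_nth m_def)
    then show ?thesis unfolding q_def by (rule LeastI_ex)
  qed
  have [measurable]: "q \<in> borel \<rightarrow>\<^sub>M count_space UNIV" unfolding q_def by measurable
  obtain K where K: "0 \<le> K" "\<And>y x :: 'e. dist y x \<le> K" using diameter_bounded by blast
  let ?U = "\<lambda>\<omega>. X t (\<omega> i)" and ?W = "\<lambda>\<omega>. X (t + s) (\<omega> i)"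
  have [measurable]: "?U \<in> borel_measurable M" "?W \<in> borel_measurable M"
    using t s i by (auto intro!: copy_at_measurable)
  define B where "B k = A \<inter> {\<omega> \<in> paths. q (?U \<omega>) = k}" for k
  have B: "B k \<in> sets (\<F> i (ennreal t))" for k
  proof -
    have "(\<lambda>\<omega>. q (?U \<omega>)) \<in> \<F> i (ennreal t) \<rightarrow>\<^sub>M count_space UNIV"
      using copy_adapted[OF i order_refl t order_refl] by (rule measurable_compose) measurable
    then have "{\<omega> \<in> space (\<F> i (ennreal t)). q (?U \<omega>) = k} \<in> sets (\<F> i (ennreal t))" by measurable
    then show ?thesis using A unfolding B_def by (auto simp: space_prod_filtration)
  qed
  have BM [measurable]: "B k \<in> sets M" for k using B by (rule prod_filtration_sets_M)
  have AM [measurable]: "A \<in> sets M" using A by (rule prod_filtration_sets_M)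
  have Asub: "A \<subseteq> paths" using sets.sets_into_space[OF A] by (simp add: space_prod_filtration)
  have ind: "indicator A \<omega> = (\<Sum>k<m. indicator (B k) \<omega> :: real)" for \<omega>
  proof (cases "\<omega> \<in> A")
    case True
    have "(\<Sum>k<m. indicator (B k) \<omega> :: real) = (\<Sum>k<m. if q (?U \<omega>) = k then 1 else 0)"
      using True Asub by (intro sum.cong) (auto simp: B_def indicator_def)
    also have "\<dots> = 1" using q[of "?U \<omega>"] by simp
    finally show ?thesis using True by simp
  qed (simp add: B_def)
  have int: "integrable M (\<lambda>\<omega>. indicator (B k) \<omega> * f \<omega>)" if "f \<in> borel_measurable M" "\<And>\<omega>. \<bar>f \<omega>\<bar> \<le> L" for f :: "_ \<Rightarrow> real" and L k
    using that(1) that(2) order_trans[OF abs_ge_zero that(2)]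
    by (intro M.integrable_const_bound[where B=L]) (auto simp: indicator_def)
  have mA: "measure M A = (\<Sum>k<m. measure M (B k))"
  proof -
    have "measure M A = (LINT \<omega>|M. indicator A \<omega>)" using AM by simp
    also have "\<dots> = (LINT \<omega>|M. (\<Sum>k<m. indicator (B k) \<omega>))" by (simp only: ind)
    also have "\<dots> = (\<Sum>k<m. measure M (B k))" by (subst Bochner_Integration.integral_sum) (auto intro: integrable_indicator BM)
    finally show ?thesis .
  qed
  have one: "(LINT \<omega>|M. indicator (B k) \<omega> * dist (?W \<omega>) (?U \<omega>)) \<le> (\<epsilon> + 2 * \<delta>) * measure M (B k)" for k
  proof -
    let ?a = "cs ! k"
    have i1: "integrable M (\<lambda>\<omega>. indicator (B k) \<omega> * dist (?W \<omega>) ?a)"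
      using K by (intro int[of _ K]) auto
    have i2: "integrable M (\<lambda>\<omega>. indicator (B k) \<omega> * \<delta>)" by (rule int[of _ "\<bar>\<delta>\<bar>"]) auto
    have "(LINT \<omega>|M. indicator (B k) \<omega> * dist (?W \<omega>) (?U \<omega>))
        \<le> (LINT \<omega>|M. indicator (B k) \<omega> * dist (?W \<omega>) ?a + indicator (B k) \<omega> * \<delta>)"
    proof (rule integral_mono)
      show "integrable M (\<lambda>\<omega>. indicator (B k) \<omega> * dist (?W \<omega>) (?U \<omega>))"
        using K by (intro int[of _ K]) auto
      show "integrable M (\<lambda>\<omega>. indicator (B k) \<omega> * dist (?W \<omega>) ?a + indicator (B k) \<omega> * \<delta>)"
        by (rule Bochner_Integration.integrable_add[OF i1 i2])
      fix \<omega>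
      show "indicator (B k) \<omega> * dist (?W \<omega>) (?U \<omega>) \<le> indicator (B k) \<omega> * dist (?W \<omega>) ?a + indicator (B k) \<omega> * \<delta>"
        using q[of "?U \<omega>"] dist_triangle[of "?W \<omega>" "?U \<omega>" ?a]
        by (auto simp: B_def indicator_def dist_commute)
    qed
    also have "\<dots> = (LINT \<omega>|M. indicator (B k) \<omega> * dist (?W \<omega>) ?a) + \<delta> * measure M (B k)"
      by (subst Bochner_Integration.integral_add[OF i1 i2]) (simp add: mult.commute)
    also have "(LINT \<omega>|M. indicator (B k) \<omega> * dist (?W \<omega>) ?a)
        = (LINT \<omega>|M. indicator (B k) \<omega> * transition s (\<lambda>z. dist z ?a) (?U \<omega>))"
      using At by (intro copy_markov_integral[OF i t s(1) B _ continuous_dist_to]) (auto simp: B_def)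
    also have "\<dots> \<le> (LINT \<omega>|M. indicator (B k) \<omega> * (\<epsilon> + \<delta>))"
    proof (rule integral_mono)
      show "integrable M (\<lambda>\<omega>. indicator (B k) \<omega> * transition s (\<lambda>z. dist z ?a) (?U \<omega>))"
      proof (rule int[of _ K])
        show "(\<lambda>\<omega>. transition s (\<lambda>z. dist z ?a) (?U \<omega>)) \<in> borel_measurable M"
          using continuous_borel[OF transition_continuous[OF s(1) continuous_dist_to, of ?a]] by measurable
        show "\<bar>transition s (\<lambda>z. dist z ?a) y\<bar> \<le> K" for y
          using K by (intro transition_bounded[OF s(1) continuous_borel[OF continuous_dist_to]]) auto
      qed
      show "integrable M (\<lambda>\<omega>. indicator (B k) \<omega> * (\<epsilon> + \<delta>))" by (intro int[of _ "\<bar>\<epsilon> + \<delta>\<bar>"]) auto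
      fix \<omega>
      show "indicator (B k) \<omega> * transition s (\<lambda>z. dist z ?a) (?U \<omega>) \<le> indicator (B k) \<omega> * (\<epsilon> + \<delta>)"
      proof (cases "\<omega> \<in> B k")
        case True
        then have ua: "dist (?U \<omega>) ?a \<le> \<delta>" using q[of "?U \<omega>"] by (auto simp: B_def)
        have "transition s (\<lambda>z. dist z ?a) (?U \<omega>) - transition s (\<lambda>z. dist z (?U \<omega>)) (?U \<omega>)
            = transition s (\<lambda>z. dist z ?a - dist z (?U \<omega>)) (?U \<omega>)"
          using K by (intro transition_diff[OF s(1), symmetric] continuous_borel[OF continuous_dist_to]) auto
        also have "\<bar>\<dots>\<bar> \<le> \<delta>"
        proof (intro transition_bounded[OF s(1)] borel_measurable_diff continuous_borel[OF continuous_dist_to])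
          show "\<bar>dist y ?a - dist y (?U \<omega>)\<bar> \<le> \<delta>" for y
            using dist_triangle[of y ?a "?U \<omega>"] dist_triangle[of y "?U \<omega>" ?a] ua
            by (auto simp: dist_commute)
        qed
        finally show ?thesis using disp[OF s, of "?U \<omega>"] True by simp
      qed simp
    qed
    also have "\<dots> = (\<epsilon> + \<delta>) * measure M (B k)" by simp
    finally show ?thesis by (simp add: algebra_simps)
  qed
  have "(LINT \<omega>|M. indicator A \<omega> * dist (?W \<omega>) (?U \<omega>)) = (\<Sum>k<m. LINT \<omega>|M. indicator (B k) \<omega> * dist (?W \<omega>) (?U \<omega>))"
    unfolding ind sum_distrib_right using K by (intro Bochner_Integration.integral_sum int[of _ K]) auto
  also have "\<dots> \<le> (\<Sum>k<m. (\<epsilon> + 2 * \<delta>) * measure M (B k))" by (intro sum_mono one)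
  also have "\<dots> = (\<epsilon> + e) * measure M A" by (simp add: mA sum_distrib_left \<delta>_def)
  also have "\<dots> \<le> \<epsilon> * measure M A + e"
    using M.prob_le_1[of A] \<open>0 < e\<close> by (simp add: distrib_right mult_left_le)
  finally show "(LINT \<omega>|M. indicator A \<omega> * dist (?W \<omega>) (?U \<omega>)) \<le> \<epsilon> * measure M A + e" .
qed

text \<open>
  The stopping time is rounded up to a grid that refines \<open>[a, b]\<close>: on each cell the previous lemma
  applies at the right end point, and right-continuity of the paths gives the limit.
\<close>

lemma copy_displacement:
  assumes disp: "\<And>r y. 0 \<le> r \<Longrightarrow> r \<le> h \<Longrightarrow> transition r (\<lambda>z. dist z y) y \<le> \<epsilon>"
    and i: "1 \<le> i" and T: "stopping_time (\<F> i) T" and \<tau>T: "\<And>\<omega>. \<omega> \<in> paths \<Longrightarrow> \<tau> (i - 1) \<omega> \<le> T \<omega>"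
    and ab: "0 \<le> a" "a < b" "b \<le> a + h"
  defines "I \<equiv> {\<omega> \<in> paths. ennreal a < T \<omega> \<and> T \<omega> \<le> ennreal b}"
  shows "(LINT \<omega>|M. indicator I \<omega> * dist (X b (\<omega> i)) (X (enn2real (T \<omega>)) (\<omega> i))) \<le> \<epsilon> * measure M I"
proof -
  obtain K where K: "0 \<le> K" "\<And>y x :: 'e. dist y x \<le> K" using diameter_bounded by blast
  define d where "d n = (b - a) / real (Suc n)" for n
  define p where "p n k = a + real k * d n" for n k
  have d: "0 < d n" for n using ab by (simp add: d_def)
  have p0: "0 \<le> p n k" for n k using ab d[of n] by (simp add: p_def less_imp_le)
  have p_mono: "p n k \<le> p n k'" if "k \<le> k'" for n k k'
    using that d[of n] by (simp add: p_def mult_right_mono)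
  have p_last: "p n (Suc n) = b" for n by (simp add: p_def d_def)
  have p_Suc: "p n (Suc k) = p n k + d n" for n k by (simp add: p_def algebra_simps)
  define A where "A n k = {\<omega> \<in> paths. ennreal (p n k) < T \<omega> \<and> T \<omega> \<le> ennreal (p n (Suc k))}" for n k
  have AF: "A n k \<in> sets (\<F> i (ennreal (p n (Suc k))))" for n k
  proof -
    have "{\<omega> \<in> paths. T \<omega> \<le> s} \<in> sets (\<F> i (ennreal (p n (Suc k))))" if "s \<le> ennreal (p n (Suc k))" for s
      using stopping_timeD[OF T, of s] sets_prod_filtration_mono[OF order_refl that, of i]
      by (auto simp: pred_def space_prod_filtration)
    from sets.Diff[OF this this, of "ennreal (p n (Suc k))" "ennreal (p n k)"]
    have "{\<omega> \<in> paths. T \<omega> \<le> ennreal (p n (Suc k))} - {\<omega> \<in> paths. T \<omega> \<le> ennreal (p n k)} \<in> sets (\<F> i (ennreal (p n (Suc k))))"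
      using p_mono[of k "Suc k" n] by (simp add: ennreal_leI)
    also have "{\<omega> \<in> paths. T \<omega> \<le> ennreal (p n (Suc k))} - {\<omega> \<in> paths. T \<omega> \<le> ennreal (p n k)} = A n k"
      by (auto simp: A_def not_le)
    finally show ?thesis .
  qed
  have AM [measurable]: "A n k \<in> sets M" for n k using AF by (rule prod_filtration_sets_M)
  have T_M [measurable]: "T \<in> borel_measurable M"
  proof (rule measurable_stopping_time[OF T])
    show "sets (\<F> i t) \<subseteq> sets M" for t using sets_prod_filtration_subset sets_M by auto
    show "space (\<F> i t) = space M" for t by (simp add: space_prod_filtration space_M)
  qed
  have IM [measurable]: "I \<in> sets M" unfolding I_def space_M[symmetric] by measurable
  have Xb [measurable]: "(\<lambda>\<omega>. X b (\<omega> i)) \<in> borel_measurable M"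
    using ab i by (intro copy_at_measurable) auto
  have XT [measurable]: "(\<lambda>\<omega>. X (enn2real (T \<omega>)) (\<omega> i)) \<in> borel_measurable M"
    using i by (intro copy_at_measurable) auto
  have Xp [measurable]: "(\<lambda>\<omega>. X (p n k) (\<omega> i)) \<in> borel_measurable M" for n k
    using p0 i by (intro copy_at_measurable) auto
  have cell: "\<exists>k<Suc n. \<forall>k'. \<omega> \<in> A n k' \<longleftrightarrow> k' = k" if \<omega>: "\<omega> \<in> I" for \<omega> n
  proof -
    define k where "k = (LEAST k. T \<omega> \<le> ennreal (p n (Suc k)))"
    have le: "T \<omega> \<le> ennreal (p n (Suc n))" using \<omega> by (simp add: I_def p_last)
    have k1: "T \<omega> \<le> ennreal (p n (Suc k))" unfolding k_def using le by (rule LeastI)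
    have k2: "k \<le> n" unfolding k_def using le by (rule Least_le)
    have k3: "ennreal (p n k) < T \<omega>"
    proof (cases k)
      case 0 then show ?thesis using \<omega> by (simp add: I_def p_def)
    next
      case (Suc j)
      then show ?thesis using not_less_Least[of j "\<lambda>k. T \<omega> \<le> ennreal (p n (Suc k))"] by (simp add: k_def[symmetric] not_le)
    qed
    have uniq: "k' = k" if k': "\<omega> \<in> A n k'" for k'
    proof (rule ccontr)
      assume "k' \<noteq> k"
      then consider "Suc k' \<le> k" | "Suc k \<le> k'" by linarith
      then show False
      proof cases
        case 1
        from p_mono[OF this, of n] have "ennreal (p n (Suc k')) \<le> ennreal (p n k)" by (rule ennreal_leI)
        then show False using k3 k' by (auto simp: A_def)
      next
        case 2
        from p_mono[OF this, of n] have "ennreal (p n (Suc k)) \<le> ennreal (p n k')" by (rule ennreal_leI)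
        then show False using k1 k' by (auto simp: A_def)
      qed
    qed
    have "\<omega> \<in> A n k" using k1 k3 \<omega> by (simp add: A_def I_def)
    with uniq have "\<forall>k'. \<omega> \<in> A n k' \<longleftrightarrow> k' = k" by metis
    then show ?thesis using le_imp_less_Suc[OF k2] by blast
  qed
  have outside: "\<omega> \<notin> A n k" if "\<omega> \<notin> I" "k < Suc n" for \<omega> n k
  proof
    assume \<omega>: "\<omega> \<in> A n k"
    have "ennreal a \<le> ennreal (p n k)" "ennreal (p n (Suc k)) \<le> ennreal b"
      using p_mono[of 0 k n] p_mono[of "Suc k" "Suc n" n] that(2) by (auto simp: p_last intro!: ennreal_leI) (simp add: p_def)
    then show False using \<omega> that(1) by (auto simp: A_def I_def)
  qed
  define S where "S n \<omega> = (\<Sum>k<Suc n. indicator (A n k) \<omega> * dist (X b (\<omega> i)) (X (p n (Suc k)) (\<omega> i)))" for n \<omega>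
  have S_eq: "S n \<omega> = dist (X b (\<omega> i)) (X (p n (Suc k)) (\<omega> i))"
    if "k < Suc n" "\<forall>k'. \<omega> \<in> A n k' \<longleftrightarrow> k' = k" for n k \<omega>
  proof -
    have "S n \<omega> = (\<Sum>k'<Suc n. if k = k' then dist (X b (\<omega> i)) (X (p n (Suc k')) (\<omega> i)) else 0)"
      unfolding S_def using that(2) by (intro sum.cong) (auto simp: indicator_def)
    also have "\<dots> = dist (X b (\<omega> i)) (X (p n (Suc k)) (\<omega> i))" using that(1) by (subst sum.delta'[OF finite_lessThan]) simp
    finally show ?thesis .
  qed
  have S_out: "S n \<omega> = 0" if "\<omega> \<notin> I" for n \<omega>
    unfolding S_def using outside[OF that] by (intro sum.neutral) auto
  have S_le: "\<bar>S n \<omega>\<bar> \<le> K" for n \<omega>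
  proof (cases "\<omega> \<in> I")
    case True
    from cell[OF this, of n] obtain k where "k < Suc n" "\<forall>k'. \<omega> \<in> A n k' \<longleftrightarrow> k' = k" by blast
    from S_eq[OF this] show ?thesis using K by simp
  qed (use S_out K in simp)
  have intA: "integrable M (\<lambda>\<omega>. indicator (A n k) \<omega> * dist (X b (\<omega> i)) (X (p n (Suc k)) (\<omega> i)))" for n k
    using K by (intro M.integrable_const_bound[where B=K]) (auto simp: indicator_def)
  have mI: "measure M I = (\<Sum>k<Suc n. measure M (A n k))" for n
  proof -
    have ind: "indicator I \<omega> = (\<Sum>k<Suc n. indicator (A n k) \<omega> :: real)" for \<omega>
    proof (cases "\<omega> \<in> I")
      case True
      from cell[OF this, of n] obtain k where k: "k < Suc n" "\<forall>k'. \<omega> \<in> A n k' \<longleftrightarrow> k' = k" by blast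
      have "(\<Sum>k'<Suc n. indicator (A n k') \<omega> :: real) = (\<Sum>k'<Suc n. if k = k' then 1 else 0)"
        using k(2) by (intro sum.cong) (auto simp: indicator_def)
      also have "\<dots> = 1" using k(1) by (subst sum.delta'[OF finite_lessThan]) simp
      finally show ?thesis using True by simp
    next
      case False
      then show ?thesis using outside[OF False] by (subst sum.neutral) auto
    qed
    have "measure M I = (LINT \<omega>|M. indicator I \<omega>)" using IM by simp
    also have "\<dots> = (LINT \<omega>|M. (\<Sum>k<Suc n. indicator (A n k) \<omega>))" by (simp only: ind)
    also have "\<dots> = (\<Sum>k<Suc n. measure M (A n k))"
      by (subst Bochner_Integration.integral_sum) (auto intro: integrable_indicator AM)
    finally show ?thesis .
  qed
  have bound: "(LINT \<omega>|M. S n \<omega>) \<le> \<epsilon> * measure M I" for n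
  proof -
    have "(LINT \<omega>|M. S n \<omega>) = (\<Sum>k<Suc n. LINT \<omega>|M. indicator (A n k) \<omega> * dist (X b (\<omega> i)) (X (p n (Suc k)) (\<omega> i)))"
      unfolding S_def using intA by (intro Bochner_Integration.integral_sum) auto
    also have "\<dots> \<le> (\<Sum>k<Suc n. \<epsilon> * measure M (A n k))"
    proof (rule sum_mono)
      fix k assume k: "k \<in> {..<Suc n}"
      have pb: "a \<le> p n (Suc k)" "p n (Suc k) \<le> b"
        using p_mono[of "Suc k" "Suc n" n] p_mono[of 0 "Suc k" n] k by (auto simp: p_last) (simp add: p_def)
      have "A n k \<subseteq> {\<omega>. \<tau> (i - 1) \<omega> \<le> ennreal (p n (Suc k))}"
        using \<tau>T order_trans by (fastforce simp: A_def)
      from copy_displacement_fixed[where h=h and s="b - p n (Suc k)", OF disp i p0 _ _ AF this]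
      show "(LINT \<omega>|M. indicator (A n k) \<omega> * dist (X b (\<omega> i)) (X (p n (Suc k)) (\<omega> i))) \<le> \<epsilon> * measure M (A n k)"
        using pb ab by simp
    qed
    also have "\<dots> = \<epsilon> * measure M I" by (simp only: mI[of n] sum_distrib_left)
    finally show ?thesis .
  qed
  have "(\<lambda>n. LINT \<omega>|M. S n \<omega>) \<longlonglongrightarrow> (LINT \<omega>|M. indicator I \<omega> * dist (X b (\<omega> i)) (X (enn2real (T \<omega>)) (\<omega> i)))"
  proof (rule integral_dominated_convergence[where w="\<lambda>_. K"])
    show "S n \<in> borel_measurable M" for n unfolding S_def by measurable
    show "AE \<omega> in M. (\<lambda>n. S n \<omega>) \<longlonglongrightarrow> indicator I \<omega> * dist (X b (\<omega> i)) (X (enn2real (T \<omega>)) (\<omega> i))"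
    proof (rule AE_I2)
      fix \<omega> assume "\<omega> \<in> space M"
      show "(\<lambda>n. S n \<omega>) \<longlonglongrightarrow> indicator I \<omega> * dist (X b (\<omega> i)) (X (enn2real (T \<omega>)) (\<omega> i))"
      proof (cases "\<omega> \<in> I")
        case True
        have \<omega>i: "\<omega> i \<in> \<Omega>" using True i by (auto simp: I_def PiE_iff)
        have "\<forall>n. \<exists>k<Suc n. \<forall>k'. \<omega> \<in> A n k' \<longleftrightarrow> k' = k" using cell[OF True] by blast
        then obtain k where k: "\<And>n. k n < Suc n" "\<And>n. \<forall>k'. \<omega> \<in> A n k' \<longleftrightarrow> k' = k n" by metis
        define R where "R = enn2real (T \<omega>)"
        have TR: "T \<omega> = ennreal R" unfolding R_def using True
          by (intro ennreal_enn2real[symmetric]) (auto simp: I_def intro: le_less_trans[OF _ ennreal_less_top])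
        have Rp: "p n (k n) < R \<and> R \<le> p n (Suc (k n))" for n
        proof -
          have "\<omega> \<in> A n (k n)" using k(2) by blast
          then show ?thesis using p0 by (auto simp: A_def TR ennreal_less_iff)
        qed
        have "(\<lambda>n. R + d n) \<longlonglongrightarrow> R + 0"
          unfolding d_def by (intro tendsto_intros LIMSEQ_Suc[OF lim_const_over_n])
        then have up: "(\<lambda>n. R + d n) \<longlonglongrightarrow> R" by simp
        have "(\<lambda>n. p n (Suc (k n))) \<longlonglongrightarrow> R"
        proof (rule tendsto_sandwich[OF _ _ tendsto_const up])
          show "\<forall>\<^sub>F n in sequentially. R \<le> p n (Suc (k n))" using Rp by simp
          show "\<forall>\<^sub>F n in sequentially. p n (Suc (k n)) \<le> R + d n"
            using Rp by (intro always_eventually allI) (simp add: p_Suc less_imp_le)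
        qed
        then have "(\<lambda>n. X (p n (Suc (k n))) (\<omega> i)) \<longlonglongrightarrow> X R (\<omega> i)"
          using Rp by (intro X_tendsto_from_right[OF \<omega>i]) (auto simp: R_def)
        then have "(\<lambda>n. dist (X b (\<omega> i)) (X (p n (Suc (k n))) (\<omega> i))) \<longlonglongrightarrow> dist (X b (\<omega> i)) (X R (\<omega> i))"
          by (intro tendsto_intros)
        then show ?thesis using True S_eq[OF k] by (simp add: R_def)
      qed (simp add: S_out)
    qed
    show "AE \<omega> in M. norm (S n \<omega>) \<le> K" for n using S_le by simp
  qed auto
  then show ?thesis by (rule LIMSEQ_le_const2) (use bound in auto)
qed

definition impulse_cost :: "nat \<Rightarrow> (nat \<Rightarrow> 'w) \<Rightarrow> real" where
  "impulse_cost l \<omega> = c (X (enn2real (\<tau> l \<omega>)) (\<omega> l)) (X (enn2real (\<tau> l \<omega>)) (\<omega> (Suc l)))"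

definition impulse_in :: "real \<Rightarrow> real \<Rightarrow> nat \<Rightarrow> (nat \<Rightarrow> 'w) set" where
  "impulse_in a b l = {\<omega> \<in> paths. ennreal a < \<tau> l \<omega> \<and> \<tau> l \<omega> \<le> ennreal b}"

lemma impulse_in_sets [measurable]: "impulse_in a b l \<in> sets M"
  unfolding impulse_in_def space_M[symmetric] by measurable

lemma c_measurable:
  assumes "U \<in> borel_measurable N" "W \<in> borel_measurable N"
  shows "(\<lambda>\<omega>. c (U \<omega>) (W \<omega>)) \<in> borel_measurable N"
proof -
  have "(\<lambda>(x, \<xi>). c x \<xi>) \<in> borel_measurable (borel \<Otimes>\<^sub>M borel)"
    unfolding borel_prod using borel_measurable_continuous_onI[OF c_continuous] .
  from measurable_compose[OF measurable_Pair[OF assms] this] show ?thesis by simp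
qed

lemma impulse_cost_measurable: "1 \<le> l \<Longrightarrow> impulse_cost l \<in> borel_measurable M"
  unfolding impulse_cost_def[abs_def] by (intro c_measurable copy_at_measurable) auto

text \<open>
  The price of an impulse at \<open>\<tau> l\<close> and its price if charged at the end of the cell differ, in
  expectation, by a small amount per impulse: both the copy that is left and the copy that is entered
  obey \<open>copy_displacement\<close> with the same stopping time.
\<close>

lemma delayed_impulse_cost:
  assumes disp: "\<And>r y. 0 \<le> r \<Longrightarrow> r \<le> h \<Longrightarrow> transition r (\<lambda>z. dist z y) y \<le> \<epsilon>"
    and cmod: "0 \<le> L" "\<And>x \<xi> x' \<xi>'. \<bar>c x \<xi> - c x' \<xi>'\<bar> \<le> e + L * (dist x x' + dist \<xi> \<xi>')"
    and l: "1 \<le> l" and ab: "0 \<le> a" "a < b" "b \<le> a + h"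
  shows "(LINT \<omega>|M. indicator (impulse_in a b l) \<omega> * c (X b (\<omega> l)) (X b (\<omega> (Suc l))))
      \<le> (LINT \<omega>|M. indicator (impulse_in a b l) \<omega> * impulse_cost l \<omega>) + (e + 2 * L * \<epsilon>) * measure M (impulse_in a b l)"
proof -
  let ?I = "impulse_in a b l" and ?R = "\<lambda>\<omega>. enn2real (\<tau> l \<omega>)"
  obtain K where K: "0 \<le> K" "\<And>y x :: 'e. dist y x \<le> K" using diameter_bounded by blast
  obtain Kc where Kc: "0 < Kc" "\<And>x \<xi>. c x \<xi> \<le> Kc" using c_bounded by blast
  have m [measurable]: "(\<lambda>\<omega>. X b (\<omega> i)) \<in> borel_measurable M" "(\<lambda>\<omega>. X (?R \<omega>) (\<omega> i)) \<in> borel_measurable M" if "1 \<le> i" for i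
    using ab that by (auto intro!: copy_at_measurable)
  have int: "integrable M (\<lambda>\<omega>. indicator ?I \<omega> * f \<omega>)" if "f \<in> borel_measurable M" "\<And>\<omega>. \<bar>f \<omega>\<bar> \<le> B" for f :: "_ \<Rightarrow> real" and B
    using that(1) that(2) order_trans[OF abs_ge_zero that(2)]
    by (intro M.integrable_const_bound[where B=B]) (auto simp: indicator_def)
  let ?D = "\<lambda>i \<omega>. indicator ?I \<omega> * dist (X b (\<omega> i)) (X (?R \<omega>) (\<omega> i))"
  have Dint: "integrable M (?D i)" if "1 \<le> i" for i
    using K m[OF that] by (intro int[of _ K]) auto
  have cint: "integrable M (\<lambda>\<omega>. indicator ?I \<omega> * impulse_cost l \<omega>)"
    using impulse_cost_measurable[OF l]
  proof (rule int)
    show "\<bar>impulse_cost l \<omega>\<bar> \<le> Kc" for \<omega> by (simp add: impulse_cost_def c_nonneg Kc)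
  qed
  have D: "(LINT \<omega>|M. ?D i \<omega>) \<le> \<epsilon> * measure M ?I" if "i = l \<or> i = Suc l" for i
    unfolding impulse_in_def
  proof (rule copy_displacement[where h=h, OF disp])
    show "1 \<le> i" using that l by auto
    show "stopping_time (\<F> i) (\<tau> l)" using that l by (intro tau_stopping_later) auto
    show "\<tau> (i - 1) \<omega> \<le> \<tau> l \<omega>" if "\<omega> \<in> paths" for \<omega>
      using \<open>i = l \<or> i = Suc l\<close> that by (intro tau_mono) auto
  qed (use ab in auto)
  have "(LINT \<omega>|M. indicator ?I \<omega> * c (X b (\<omega> l)) (X b (\<omega> (Suc l))))
      \<le> (LINT \<omega>|M. indicator ?I \<omega> * impulse_cost l \<omega> + (indicator ?I \<omega> * e + L * (?D l \<omega> + ?D (Suc l) \<omega>)))"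
  proof (rule integral_mono)
    show "integrable M (\<lambda>\<omega>. indicator ?I \<omega> * c (X b (\<omega> l)) (X b (\<omega> (Suc l))))"
      using c_measurable[OF m(1) m(1), of l "Suc l"] l c_nonneg Kc by (intro int[of _ Kc]) auto
    show "integrable M (\<lambda>\<omega>. indicator ?I \<omega> * impulse_cost l \<omega> + (indicator ?I \<omega> * e + L * (?D l \<omega> + ?D (Suc l) \<omega>)))"
      using Dint[of l] Dint[of "Suc l"] l cint int[of "\<lambda>_. e" "\<bar>e\<bar>"] by (intro Bochner_Integration.integrable_add integrable_mult_right) auto
    fix \<omega>
    show "indicator ?I \<omega> * c (X b (\<omega> l)) (X b (\<omega> (Suc l)))
       \<le> indicator ?I \<omega> * impulse_cost l \<omega> + (indicator ?I \<omega> * e + L * (?D l \<omega> + ?D (Suc l) \<omega>))"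
      using cmod(2)[of "X b (\<omega> l)" "X b (\<omega> (Suc l))" "X (?R \<omega>) (\<omega> l)" "X (?R \<omega>) (\<omega> (Suc l))"]
      by (auto simp: indicator_def impulse_cost_def)
  qed
  also have "\<dots> = (LINT \<omega>|M. indicator ?I \<omega> * impulse_cost l \<omega>)
      + (e * measure M ?I + L * ((LINT \<omega>|M. ?D l \<omega>) + (LINT \<omega>|M. ?D (Suc l) \<omega>)))"
    using Dint[of l] Dint[of "Suc l"] l cint int[of "\<lambda>_. e" "\<bar>e\<bar>"] by (simp add: mult.commute)
  also have "\<dots> \<le> (LINT \<omega>|M. indicator ?I \<omega> * impulse_cost l \<omega>)
      + (e * measure M ?I + L * (\<epsilon> * measure M ?I + \<epsilon> * measure M ?I))"
    using D cmod(1) by (intro add_left_mono mult_left_mono add_mono) auto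
  finally show ?thesis by (simp add: algebra_simps)
qed

end

section \<open>Weights and summation by parts\<close>

locale discount =
  fixes \<beta> :: "real \<Rightarrow> real"
  assumes beta_range: "\<And>t. 0 \<le> t \<Longrightarrow> 0 < \<beta> t \<and> \<beta> t \<le> 1"
    and beta_decreasing: "\<And>s t. 0 \<le> s \<Longrightarrow> s \<le> t \<Longrightarrow> \<beta> t \<le> \<beta> s"
    and beta_continuous: "continuous_on {0..} \<beta>"
    and beta_0: "\<beta> 0 = 1"
    and beta_supermult: "\<And>s t. 0 \<le> s \<Longrightarrow> 0 \<le> t \<Longrightarrow> \<beta> t * \<beta> s \<le> \<beta> (t + s)"
    and beta_integral: "(\<integral>\<^sup>+ s\<in>{0..}. ennreal (\<beta> s) \<partial>lborel) = \<infinity>"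
begin

definition mass :: "real \<Rightarrow> real" where
  "mass T = (LINT s:{0..T}|lborel. \<beta> s)"

lemma beta_measurable: "(\<lambda>s. \<beta> (max 0 s)) \<in> borel_measurable borel"
proof (rule borel_measurable_continuous_onI)
  show "continuous_on UNIV (\<lambda>s. \<beta> (max 0 s))"
    by (rule continuous_on_compose2[OF beta_continuous]) (auto intro!: continuous_intros)
qed

lemma beta_max: "\<bar>\<beta> (max 0 s)\<bar> \<le> 1"
  using beta_range[of "max 0 s"] by simp

lemma set_integrable_weighted:
  assumes "f \<in> borel_measurable borel" "\<And>s. \<bar>f s\<bar> \<le> (K :: real)"
  shows "set_integrable lborel {a..b} (\<lambda>s. \<beta> (max 0 s) * f s)"
proof (rule set_integrable_Icc_bounded)
  show "(\<lambda>s. \<beta> (max 0 s) * f s) \<in> borel_measurable borel"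
    using beta_measurable assms(1) by measurable
  show "\<bar>\<beta> (max 0 s) * f s\<bar> \<le> 1 * K" for s
    unfolding abs_mult using beta_max assms(2) by (intro mult_mono) auto
qed

lemma mass_eq: "mass T = (LINT s:{0..T}|lborel. \<beta> (max 0 s) * 1)"
  unfolding mass_def by (rule set_integral_nonneg_time) auto

text \<open>
  Freezing the weight at the left end of a cell: the errors of consecutive cells telescope, since they
  involve the decrements of \<open>\<beta>\<close> only.
\<close>

lemma weighted_step:
  assumes f: "f \<in> borel_measurable borel" "\<And>s. \<bar>f s\<bar> \<le> K" and ab: "0 \<le> a" "a \<le> b"
  shows "\<bar>\<beta> a * (LINT s:{a..b}|lborel. f s) - (LINT s:{a..b}|lborel. \<beta> (max 0 s) * f s)\<bar>
    \<le> K * (b - a) * (\<beta> a - \<beta> b)"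
proof -
  have K: "0 \<le> K" using f(2)[of 0] by simp
  have dec: "\<beta> b \<le> \<beta> a" using beta_decreasing ab by simp
  have "\<beta> a * (LINT s:{a..b}|lborel. f s) - (LINT s:{a..b}|lborel. \<beta> (max 0 s) * f s)
      = (LINT s:{a..b}|lborel. \<beta> a * f s - \<beta> (max 0 s) * f s)"
    using set_integrable_Icc_bounded[OF f] set_integrable_weighted[OF f]
    by (subst set_integral_diff) auto
  also have "\<dots> = (LINT s:{a..b}|lborel. (\<beta> a - \<beta> (min b (max a s))) * f s)"
    using ab by (intro set_lebesgue_integral_cong) (auto simp: algebra_simps)
  also have "\<bar>\<dots>\<bar> \<le> (\<beta> a - \<beta> b) * K * (b - a)"
  proof (rule set_integral_Icc_bound[OF _ _ ab(2)])
    have "(\<lambda>s. \<beta> (max 0 (min b (max a s)))) \<in> borel_measurable borel"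
      by (rule measurable_compose[OF _ beta_measurable]) measurable
    moreover have "max 0 (min b (max a s)) = min b (max a s)" for s using ab by auto
    ultimately show "(\<lambda>s. (\<beta> a - \<beta> (min b (max a s))) * f s) \<in> borel_measurable borel"
      using f(1) by simp
    fix s
    have "\<beta> (min b (max a s)) \<le> \<beta> a" "\<beta> b \<le> \<beta> (min b (max a s))"
      using ab by (auto intro!: beta_decreasing)
    then show "\<bar>(\<beta> a - \<beta> (min b (max a s))) * f s\<bar> \<le> (\<beta> a - \<beta> b) * K"
      unfolding abs_mult using f(2)[of s] dec by (intro mult_mono) auto
  qed
  finally show ?thesis by (simp add: mult_ac)
qed

lemma mass_grid:
  assumes h: "0 < h"
  shows "\<bar>h * (\<Sum>j<n. \<beta> (real j * h)) - mass (real n * h)\<bar> \<le> h"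
proof -
  have "\<bar>h * (\<Sum>j<n. \<beta> (real j * h)) - mass (real n * h)\<bar> \<le> h * (1 - \<beta> (real n * h))"
  proof (induction n)
    case 0
    have "mass 0 = 0"
    proof -
      have "\<bar>LINT s:{0..0}|lborel. \<beta> (max 0 s) * 1\<bar> \<le> 1 * (0 - 0)"
        using beta_measurable beta_max by (intro set_integral_Icc_bound) auto
      then show ?thesis unfolding mass_eq by simp
    qed
    then show ?case by (simp add: beta_0)
  next
    case (Suc n)
    let ?a = "real n * h" and ?b = "real (Suc n) * h"
    have ab: "0 \<le> ?a" "?a \<le> ?b" "?b - ?a = h" using h by (auto simp: algebra_simps)
    have "mass ?b = mass ?a + (LINT s:{?a..?b}|lborel. \<beta> (max 0 s) * 1)"
      unfolding mass_eq by (rule set_integral_split[OF set_integrable_weighted[where K=1]]) (use ab in auto)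
    moreover have "\<bar>\<beta> ?a * (LINT s:{?a..?b}|lborel. 1) - (LINT s:{?a..?b}|lborel. \<beta> (max 0 s) * 1)\<bar>
      \<le> 1 * (?b - ?a) * (\<beta> ?a - \<beta> ?b)"
      by (rule weighted_step) (use ab in auto)
    moreover have "(LINT s:{?a..?b}|lborel. 1::real) = h"
      using ab by (simp add: set_lebesgue_integral_def)
    ultimately show ?case using Suc ab(3) by (simp add: algebra_simps abs_le_iff)
  qed
  also have "\<dots> \<le> h" using beta_range[of "real n * h"] h by simp
  finally show ?thesis .
qed

text \<open>
  A one-step inequality without weights becomes an inequality for the weighted sums.  Summation by parts
  against the decreasing weights leaves at most \<open>2 sup \<bar>a\<bar>\<close>, and freezing the weights at most \<open>h sup \<bar>\<gamma>\<bar>\<close>.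
  The remainders \<open>R j\<close> may have either sign, so the lemma serves for lower and for upper bounds.
\<close>

lemma discounted_telescope:
  assumes h: "0 < h" and \<gamma>: "\<gamma> \<in> borel_measurable borel" "\<And>s. \<bar>\<gamma> s\<bar> \<le> Kg"
    and a: "\<And>j. \<bar>a j\<bar> \<le> (Ka :: real)"
    and step: "\<And>j. j < n \<Longrightarrow> a j - a (Suc j) \<le> (LINT s:{real j * h..real (Suc j) * h}|lborel. \<gamma> s) + R j - \<theta>"
  shows "\<theta> * (\<Sum>j<n. \<beta> (real j * h)) \<le> (LINT s:{0..real n * h}|lborel. \<beta> (max 0 s) * \<gamma> s)
      + (\<Sum>j<n. \<beta> (real j * h) * R j) + (2 * Ka + Kg * h)"
proof -
  let ?b = "\<lambda>j. \<beta> (real j * h)"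
  have bpos: "0 \<le> ?b j" for j using beta_range[of "real j * h"] h by simp
  have bdec: "?b (Suc j) \<le> ?b j" for j using h by (intro beta_decreasing) (auto intro: mult_right_mono)
  have Kg: "0 \<le> Kg" using \<gamma>(2)[of 0] by simp
  \<comment> \<open>the term with \<open>Ka - a n\<close>, nonnegative, strengthens the claim for the induction\<close>
  have "\<theta> * (\<Sum>j<n. ?b j) + ?b n * (Ka - a n) \<le> (LINT s:{0..real n * h}|lborel. \<beta> (max 0 s) * \<gamma> s)
      + (\<Sum>j<n. ?b j * R j) + (2 * Ka * (1 - 0) + Kg * h * (1 - ?b n))"
    using step
  proof (induction n)
    case 0
    have "\<bar>LINT s:{0..0}|lborel. \<beta> (max 0 s) * \<gamma> s\<bar> \<le> Kg * (0 - 0)"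
    proof (rule set_integral_Icc_bound)
      show "(\<lambda>s. \<beta> (max 0 s) * \<gamma> s) \<in> borel_measurable borel" using beta_measurable \<gamma>(1) by measurable
      show "\<bar>\<beta> (max 0 s) * \<gamma> s\<bar> \<le> Kg" for s
        using mult_mono[OF beta_max \<gamma>(2), of s s] by (simp add: abs_mult)
    qed simp
    then show ?case using a[of 0] by (simp add: beta_0)
  next
    case (Suc n)
    let ?G = "LINT s:{real n * h..real (Suc n) * h}|lborel. \<gamma> s"
    let ?H = "LINT s:{real n * h..real (Suc n) * h}|lborel. \<beta> (max 0 s) * \<gamma> s"
    have ab: "0 \<le> real n * h" "real n * h \<le> real (Suc n) * h" "real (Suc n) * h - real n * h = h"
      using h by (auto simp: algebra_simps)
    have sp: "(LINT s:{0..real (Suc n) * h}|lborel. \<beta> (max 0 s) * \<gamma> s)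
      = (LINT s:{0..real n * h}|lborel. \<beta> (max 0 s) * \<gamma> s) + ?H"
      by (rule set_integral_split[OF set_integrable_weighted[OF \<gamma>]]) (use ab in auto)
    have w: "?b n * ?G - ?H \<le> Kg * h * (?b n - ?b (Suc n))"
      using weighted_step[OF \<gamma> ab(1,2)] unfolding ab(3) by linarith
    have "?b n * (\<theta> + (a n - a (Suc n))) \<le> ?b n * (?G + R n)"
      using Suc.prems[of n] by (intro mult_left_mono bpos) auto
    then have s: "?b n * \<theta> + ?b n * a n - ?b n * a (Suc n) \<le> ?b n * ?G + ?b n * R n"
      by (simp add: algebra_simps)
    have "(?b n - ?b (Suc n)) * (Ka - a (Suc n)) \<ge> 0"
      using bdec[of n] a[of "Suc n"] by (intro mult_nonneg_nonneg) auto
    then have d: "?b (Suc n) * (Ka - a (Suc n)) \<le> ?b n * Ka - ?b n * a (Suc n)"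
      by (simp add: algebra_simps)
    have IH: "\<theta> * (\<Sum>j<n. ?b j) + (?b n * Ka - ?b n * a n) \<le> (LINT s:{0..real n * h}|lborel. \<beta> (max 0 s) * \<gamma> s)
      + (\<Sum>j<n. ?b j * R j) + (2 * Ka * (1 - 0) + Kg * h * (1 - ?b n))"
      using Suc.IH[OF Suc.prems] by (simp add: right_diff_distrib)
    have e: "Kg * h * (1 - ?b (Suc n)) = Kg * h * (1 - ?b n) + Kg * h * (?b n - ?b (Suc n))"
      by (simp add: algebra_simps)
    have "\<theta> * (\<Sum>j<Suc n. ?b j) = \<theta> * (\<Sum>j<n. ?b j) + ?b n * \<theta>" by (simp add: algebra_simps)
    then show ?case unfolding sp e sum.lessThan_Suc[of "\<lambda>j. ?b j * R j"] using IH s d w by linarith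
  qed
  moreover have "0 \<le> ?b n * (Ka - a n)" using bpos a[of n] by (intro mult_nonneg_nonneg) auto
  moreover have "Kg * h * (1 - ?b n) \<le> Kg * h" using mult_left_mono[of "1 - ?b n" 1 "Kg * h"] bpos[of n] Kg h by simp
  ultimately show ?thesis by simp
qed

lemma mass_at_top: "filterlim mass at_top at_top"
proof -
  have mono: "mass s \<le> mass t" if "0 \<le> s" "s \<le> t" for s t
  proof -
    have "mass t = mass s + (LINT r:{s..t}|lborel. \<beta> (max 0 r) * 1)"
      unfolding mass_eq by (rule set_integral_split[OF set_integrable_weighted[where K=1]]) (use that in auto)
    moreover have "0 \<le> (LINT r:{s..t}|lborel. \<beta> (max 0 r) * 1)"
      unfolding set_lebesgue_integral_def using beta_range by (intro Bochner_Integration.integral_nonneg) (simp add: less_imp_le)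
    ultimately show ?thesis by simp
  qed
  have m: "mass (real n) = enn2real (\<integral>\<^sup>+ s. ennreal (\<beta> (max 0 s)) * indicator {0..real n} s \<partial>lborel)"
    and fin: "(\<integral>\<^sup>+ s. ennreal (\<beta> (max 0 s)) * indicator {0..real n} s \<partial>lborel) = ennreal (mass (real n))" for n
  proof -
    have i: "integrable lborel (\<lambda>s. indicator {0..real n} s * (\<beta> (max 0 s) * 1))"
      using set_integrable_weighted[of "\<lambda>_. 1" 1 0 "real n"] by (simp add: set_integrable_def)
    have "(\<integral>\<^sup>+ s. ennreal (\<beta> (max 0 s)) * indicator {0..real n} s \<partial>lborel)
        = (\<integral>\<^sup>+ s. ennreal (indicator {0..real n} s * (\<beta> (max 0 s) * 1)) \<partial>lborel)"
      by (intro nn_integral_cong) (auto simp: indicator_def)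
    also have "\<dots> = ennreal (mass (real n))"
      unfolding mass_eq set_lebesgue_integral_def using i beta_range
      by (subst nn_integral_eq_integral) (auto simp: less_imp_le)
    finally show fin: "(\<integral>\<^sup>+ s. ennreal (\<beta> (max 0 s)) * indicator {0..real n} s \<partial>lborel) = ennreal (mass (real n))" .
    have "0 \<le> mass (real n)"
      unfolding mass_eq set_lebesgue_integral_def using beta_range by (intro Bochner_Integration.integral_nonneg) (simp add: less_imp_le)
    then show "mass (real n) = enn2real (\<integral>\<^sup>+ s. ennreal (\<beta> (max 0 s)) * indicator {0..real n} s \<partial>lborel)"
      unfolding fin by simp
  qed
  have "(SUP n. \<integral>\<^sup>+ s. ennreal (\<beta> (max 0 s)) * indicator {0..real n} s \<partial>lborel)
      = (\<integral>\<^sup>+ s. (SUP n. ennreal (\<beta> (max 0 s)) * indicator {0..real n} s) \<partial>lborel)"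
  proof (rule nn_integral_monotone_convergence_SUP[symmetric])
    show "incseq (\<lambda>n s. ennreal (\<beta> (max 0 s)) * indicator {0..real n} s)"
      by (auto simp: incseq_def le_fun_def indicator_def)
    show "(\<lambda>s. ennreal (\<beta> (max 0 s)) * indicator {0..real n} s) \<in> borel_measurable lborel" for n
      using beta_measurable by measurable
  qed
  also have "\<dots> = (\<integral>\<^sup>+ s\<in>{0..}. ennreal (\<beta> s) \<partial>lborel)"
  proof (rule nn_integral_cong)
    fix s :: real
    show "(SUP n. ennreal (\<beta> (max 0 s)) * indicator {0..real n} s) = ennreal (\<beta> s) * indicator {0..} s"
    proof (cases "0 \<le> s")
      case True
      show ?thesis
      proof (rule antisym)
        show "(SUP n. ennreal (\<beta> (max 0 s)) * indicator {0..real n} s) \<le> ennreal (\<beta> s) * indicator {0..} s"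
          using True by (intro SUP_least) (auto simp: indicator_def)
        obtain n where "s \<le> real n" using real_arch_simple by blast
        then show "ennreal (\<beta> s) * indicator {0..} s \<le> (SUP n. ennreal (\<beta> (max 0 s)) * indicator {0..real n} s)"
          using True by (intro SUP_upper2[of n]) (auto simp: indicator_def)
      qed
    qed (simp add: indicator_def)
  qed
  finally have sup: "(SUP n. ennreal (mass (real n))) = \<infinity>" unfolding fin beta_integral .
  show ?thesis
    unfolding filterlim_at_top eventually_at_top_linorder
  proof
    fix Z
    have "\<exists>n. Z \<le> mass (real n)"
    proof (rule ccontr)
      assume "\<not> ?thesis"
      then have "(SUP n. ennreal (mass (real n))) \<le> ennreal Z"
        by (intro SUP_least ennreal_leI) (simp add: not_le less_imp_le)
      then show False unfolding sup by (simp add: top_unique)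
    qed
    then obtain n where "Z \<le> mass (real n)" by blast
    then show "\<exists>N. \<forall>T\<ge>N. Z \<le> mass T" using mono[of "real n"] by (intro exI[of _ "real n"]) (auto intro: order_trans)
  qed
qed

end

context prob_space
begin

lemma integral_Icc_swap:
  fixes f :: "real \<Rightarrow> 'a \<Rightarrow> real"
  assumes f: "(\<lambda>p. f (fst p) (snd p)) \<in> borel_measurable (borel \<Otimes>\<^sub>M M)" and K: "\<And>s \<omega>. \<bar>f s \<omega>\<bar> \<le> K"
  shows "(LINT \<omega>|M. (LINT s:{a..b}|lborel. f s \<omega>)) = (LINT s:{a..b}|lborel. (LINT \<omega>|M. f s \<omega>))"
proof -
  have fin: "emeasure (lborel \<Otimes>\<^sub>M M) ({a..b} \<times> space M) < \<infinity>"
    using emeasure_pair_measure_Times[of "{a..b}" lborel "space M"]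
    by (simp add: emeasure_space_1 emeasure_lborel_Icc_eq)
  interpret pair_sigma_finite lborel M ..
  have f': "(\<lambda>p. f (fst p) (snd p)) \<in> borel_measurable (lborel \<Otimes>\<^sub>M M)"
    using f by (simp cong: measurable_cong_sets sets_pair_measure_cong)
  have "integrable (lborel \<Otimes>\<^sub>M M) (\<lambda>(s, \<omega>). indicator {a..b} s * f s \<omega>)"
  proof (rule integrableI_bounded_set[where A="{a..b} \<times> space M" and B=K])
    show "(\<lambda>(s, \<omega>). indicator {a..b} s * f s \<omega>) \<in> borel_measurable (lborel \<Otimes>\<^sub>M M)"
      unfolding case_prod_beta using f' by measurable
    show "emeasure (lborel \<Otimes>\<^sub>M M) ({a..b} \<times> space M) < \<infinity>"
      by (rule fin)
    show "AE p in lborel \<Otimes>\<^sub>M M. p \<in> {a..b} \<times> space M \<longrightarrow> norm ((\<lambda>(s, \<omega>). indicator {a..b} s * f s \<omega>) p) \<le> K"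
      using K by (intro AE_I2) (auto simp: indicator_def)
    show "AE p in lborel \<Otimes>\<^sub>M M. p \<notin> {a..b} \<times> space M \<longrightarrow> (\<lambda>(s, \<omega>). indicator {a..b} s * f s \<omega>) p = 0"
      by (intro AE_I2) (auto simp: space_pair_measure indicator_def)
  qed auto
  from Fubini_integral[OF this] show ?thesis
    unfolding set_lebesgue_integral_def by simp
qed

end

section \<open>The weighted cost of a strategy\<close>

locale discounted_control = controlled \<Omega> F X P g c c\<^sub>0 x \<tau> \<xi> M + discount \<beta>
  for \<Omega> :: "'w set" and F :: "ennreal \<Rightarrow> 'w measure"
    and X :: "real \<Rightarrow> 'w \<Rightarrow> 'e::polish_space" and P :: "'e \<Rightarrow> 'w measure"
    and g :: "'e \<Rightarrow> real" and c :: "'e \<Rightarrow> 'e \<Rightarrow> real" and c\<^sub>0 :: real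
    and x :: 'e and \<tau> :: "nat \<Rightarrow> (nat \<Rightarrow> 'w) \<Rightarrow> ennreal" and \<xi> :: "nat \<Rightarrow> (nat \<Rightarrow> 'w) \<Rightarrow> 'e"
    and M :: "(nat \<Rightarrow> 'w) measure" and \<beta> :: "real \<Rightarrow> real"
begin

abbreviation Y :: "real \<Rightarrow> (nat \<Rightarrow> 'w) \<Rightarrow> 'e" where
  "Y \<equiv> controlled_process X (\<tau>, \<xi>)"

abbreviation cost :: "real \<Rightarrow> ereal" where
  "cost \<equiv> expected_cost X \<beta> g c M (\<tau>, \<xi>)"

definition mean_g :: "real \<Rightarrow> real" where
  "mean_g s = (LINT \<omega>|M. g (Y (max 0 s) \<omega>))"

lemma g_process_measurable:
  "(\<lambda>p. g (Y (max 0 (fst p)) (snd p))) \<in> borel_measurable (borel \<Otimes>\<^sub>M M)"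
  by (rule measurable_compose[OF controlled_process_jointly_measurable continuous_borel[OF g_continuous]])

lemma g_process_measurable_at:
  "(\<lambda>\<omega>. g (Y (max 0 s) \<omega>)) \<in> borel_measurable M"
  using measurable_compose[OF measurable_Pair1' g_process_measurable, of s] by simp

lemma mean_g_measurable: "mean_g \<in> borel_measurable borel"
  unfolding mean_g_def[abs_def]
  by (rule M.borel_measurable_lebesgue_integral) (simp add: case_prod_beta' g_process_measurable)

lemma mean_g_bound:
  assumes "\<And>x. \<bar>g x\<bar> \<le> K" shows "\<bar>mean_g s\<bar> \<le> K"
proof -
  have "\<bar>mean_g s\<bar> \<le> (LINT \<omega>|M. \<bar>g (Y (max 0 s) \<omega>)\<bar>)"
    unfolding mean_g_def by (rule integral_abs_bound)
  also have "\<dots> \<le> (LINT \<omega>|M. K)"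
    using g_process_measurable_at assms order_trans[OF abs_ge_zero assms[of undefined]]
    by (intro integral_mono M.integrable_const_bound[where B=K]) auto
  finally show ?thesis by (simp add: M.prob_space)
qed

lemma expected_running_cost:
  "(LINT \<omega>|M. (LINT s:{0..T}|lborel. \<beta> s * g (Y s \<omega>)))
    = (LINT s:{0..T}|lborel. \<beta> (max 0 s) * mean_g s)"
proof -
  obtain K where K: "0 \<le> K" "\<And>x. \<bar>g x\<bar> \<le> K" using g_bound by blast
  have "(LINT \<omega>|M. (LINT s:{0..T}|lborel. \<beta> s * g (Y s \<omega>)))
      = (LINT \<omega>|M. (LINT s:{0..T}|lborel. \<beta> (max 0 s) * g (Y (max 0 s) \<omega>)))"
    by (intro Bochner_Integration.integral_cong[OF refl] set_integral_nonneg_time) auto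
  also have "\<dots> = (LINT s:{0..T}|lborel. (LINT \<omega>|M. \<beta> (max 0 s) * g (Y (max 0 s) \<omega>)))"
  proof (rule M.integral_Icc_swap)
    show "(\<lambda>p. \<beta> (max 0 (fst p)) * g (Y (max 0 (fst p)) (snd p))) \<in> borel_measurable (borel \<Otimes>\<^sub>M M)"
      using measurable_compose[OF measurable_fst beta_measurable] g_process_measurable by measurable
    show "\<bar>\<beta> (max 0 s) * g (Y (max 0 s) \<omega>)\<bar> \<le> 1 * K" for s \<omega>
      unfolding abs_mult using beta_max K by (intro mult_mono) auto
  qed
  finally show ?thesis by (simp add: mean_g_def)
qed

definition impulses :: "real \<Rightarrow> ennreal" where
  "impulses T = (\<integral>\<^sup>+ \<omega>. (\<Sum>k. if \<tau> (Suc k) \<omega> \<le> ennreal T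
      then ennreal (\<beta> (enn2real (\<tau> (Suc k) \<omega>)) * impulse_cost (Suc k) \<omega>) else 0) \<partial>M)"

lemma expected_cost_eq:
  "cost T
    = ereal (LINT s:{0..T}|lborel. \<beta> (max 0 s) * mean_g s) + enn2ereal (impulses T)"
  unfolding expected_cost_def impulses_def impulse_cost_def by (simp add: expected_running_cost Let_def)

lemma impulse_cost_bounds: "c\<^sub>0 \<le> impulse_cost l \<omega>" "0 \<le> impulse_cost l \<omega>"
  unfolding impulse_cost_def using c0 c_nonneg by auto

lemma beta_tau_measurable: "(\<lambda>\<omega>. \<beta> (enn2real (\<tau> l \<omega>))) \<in> borel_measurable M"
proof -
  have "(\<lambda>\<omega>. \<beta> (max 0 (enn2real (\<tau> l \<omega>)))) \<in> borel_measurable M"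
    by (rule measurable_compose[OF _ beta_measurable]) measurable
  then show ?thesis by (simp add: max_absorb2)
qed

lemma impulse_term_measurable [measurable]:
  "(\<lambda>\<omega>. if \<tau> (Suc k) \<omega> \<le> ennreal T
      then ennreal (\<beta> (enn2real (\<tau> (Suc k) \<omega>)) * impulse_cost (Suc k) \<omega>) else 0) \<in> borel_measurable M"
proof -
  have [measurable]: "impulse_cost (Suc k) \<in> borel_measurable M" by (rule impulse_cost_measurable) simp
  note beta_tau_measurable[measurable]
  show ?thesis by measurable
qed

text \<open>
  Infinitely many impulses up to time \<open>T\<close> would each cost at least \<open>\<beta>(T) c\<^sub>0\<close>.
\<close>

lemma active_if_finite_cost:
  assumes T: "0 \<le> T" and fin: "impulses T \<noteq> \<infinity>"
  shows "AE \<omega> in M. active T \<omega>"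
proof -
  have "AE \<omega> in M. (\<Sum>k. if \<tau> (Suc k) \<omega> \<le> ennreal T
      then ennreal (\<beta> (enn2real (\<tau> (Suc k) \<omega>)) * impulse_cost (Suc k) \<omega>) else 0) \<noteq> \<infinity>"
    using fin unfolding impulses_def by (intro nn_integral_PInf_AE) auto
  then show ?thesis
  proof eventually_elim
    case (elim \<omega>)
    show ?case
    proof (rule ccontr)
      assume "\<not> active T \<omega>"
      then have le: "\<tau> (Suc k) \<omega> \<le> ennreal T" for k by (simp add: active_def not_less)
      have "ennreal (\<beta> T * c\<^sub>0) \<le> ennreal (\<beta> (enn2real (\<tau> (Suc k) \<omega>)) * impulse_cost (Suc k) \<omega>)" for k
      proof -
        have "enn2real (\<tau> (Suc k) \<omega>) \<le> T" using le[of k] T enn2real_leI by blast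
        then have "\<beta> T \<le> \<beta> (enn2real (\<tau> (Suc k) \<omega>))" by (intro beta_decreasing) auto
        then show ?thesis
          using beta_range[OF T] c0(1) impulse_cost_bounds(1) by (intro ennreal_leI mult_mono) auto
      qed
      then have "(\<Sum>k::nat. ennreal (\<beta> T * c\<^sub>0)) \<le> (\<Sum>k. if \<tau> (Suc k) \<omega> \<le> ennreal T
          then ennreal (\<beta> (enn2real (\<tau> (Suc k) \<omega>)) * impulse_cost (Suc k) \<omega>) else 0)"
        using le by (intro suminf_le) auto
      moreover have "(\<Sum>k::nat. ennreal (\<beta> T * c\<^sub>0)) = \<infinity>"
        using beta_range[OF T] c0(1)
        by (subst nn_integral_count_space_nat[symmetric]) (simp add: ennreal_mult_top)
      ultimately show False using elim by (simp add: top_unique)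
    qed
  qed
qed

definition impulses_between :: "real \<Rightarrow> real \<Rightarrow> ennreal" where
  "impulses_between a b = (\<integral>\<^sup>+ \<omega>. (\<Sum>k. indicator (impulse_in a b (Suc k)) \<omega> * ennreal (impulse_cost (Suc k) \<omega>)) \<partial>M)"

lemma impulse_between_measurable [measurable]:
  "(\<lambda>\<omega>. indicator (impulse_in a b (Suc k)) \<omega> * ennreal (impulse_cost (Suc k) \<omega>)) \<in> borel_measurable M"
proof -
  have [measurable]: "impulse_cost (Suc k) \<in> borel_measurable M" by (rule impulse_cost_measurable) simp
  show ?thesis by measurable
qed

lemma indicator_grid:
  assumes h: "0 \<le> h"
  shows "(\<Sum>j<n. indicator (impulse_in (real j * h) (real (Suc j) * h) l) \<omega> :: ennreal)
      = indicator (impulse_in 0 (real n * h) l) \<omega>"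
proof (induction n)
  case 0 then show ?case by (auto simp: impulse_in_def indicator_def)
next
  case (Suc n)
  have "ennreal (real n * h) \<le> ennreal (real (Suc n) * h)" "ennreal 0 \<le> ennreal (real n * h)"
    using h by (auto intro!: ennreal_leI mult_right_mono)
  then show ?case
    unfolding sum.lessThan_Suc Suc.IH by (auto simp: impulse_in_def indicator_def)
qed

lemma weighted_impulses:
  "(\<Sum>j<n. ennreal (w j) * impulses_between (real j * h) (real (Suc j) * h))
    = (\<integral>\<^sup>+ \<omega>. (\<Sum>k. \<Sum>j<n. ennreal (w j) * (indicator (impulse_in (real j * h) (real (Suc j) * h) (Suc k)) \<omega>
        * ennreal (impulse_cost (Suc k) \<omega>))) \<partial>M)"
proof -
  have "(\<Sum>j<n. ennreal (w j) * impulses_between (real j * h) (real (Suc j) * h))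
      = (\<Sum>j<n. \<integral>\<^sup>+ \<omega>. (\<Sum>k. ennreal (w j) * (indicator (impulse_in (real j * h) (real (Suc j) * h) (Suc k)) \<omega>
        * ennreal (impulse_cost (Suc k) \<omega>))) \<partial>M)"
    unfolding impulses_between_def by (simp add: nn_integral_cmult[symmetric] ennreal_suminf_cmult del: of_nat_Suc)
  also have "\<dots> = (\<integral>\<^sup>+ \<omega>. (\<Sum>j<n. \<Sum>k. ennreal (w j) * (indicator (impulse_in (real j * h) (real (Suc j) * h) (Suc k)) \<omega>
        * ennreal (impulse_cost (Suc k) \<omega>))) \<partial>M)"
    by (rule nn_integral_sum[symmetric]) measurable
  also have "\<dots> = (\<integral>\<^sup>+ \<omega>. (\<Sum>k. \<Sum>j<n. ennreal (w j) * (indicator (impulse_in (real j * h) (real (Suc j) * h) (Suc k)) \<omega>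
        * ennreal (impulse_cost (Suc k) \<omega>))) \<partial>M)"
    by (intro nn_integral_cong suminf_sum[symmetric] summableI)
  finally show ?thesis .
qed

lemma tau_in_cell:
  assumes "\<omega> \<in> impulse_in a b l" "0 \<le> a" "0 \<le> b"
  shows "a < enn2real (\<tau> l \<omega>)" "enn2real (\<tau> l \<omega>) \<le> b"
proof -
  have *: "ennreal a < \<tau> l \<omega>" "\<tau> l \<omega> \<le> ennreal b" using assms(1) by (auto simp: impulse_in_def)
  then have "\<tau> l \<omega> < top" using le_less_trans[OF *(2) ennreal_less_top] by simp
  then have eq: "\<tau> l \<omega> = ennreal (enn2real (\<tau> l \<omega>))" by simp
  show "a < enn2real (\<tau> l \<omega>)" using *(1) assms(2) by (subst (asm) eq) (simp add: ennreal_less_iff)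
  show "enn2real (\<tau> l \<omega>) \<le> b" using *(2) assms(3) by (subst (asm) eq) simp
qed

text \<open>
  An impulse in the cell from \<open>j h\<close> to \<open>(j + 1) h\<close> has weight at least
  \<open>\<beta>((j + 1) h) \<ge> \<beta>(h) \<beta>(j h)\<close>.
\<close>

lemma impulses_ge:
  assumes h: "0 < h"
  shows "(\<Sum>j<n. ennreal (\<beta> h * \<beta> (real j * h)) * impulses_between (real j * h) (real (Suc j) * h)) \<le> impulses (real n * h)"
  unfolding weighted_impulses impulses_def
proof (intro nn_integral_mono suminf_le summableI)
  fix \<omega> k
  let ?b = "ennreal (\<beta> (enn2real (\<tau> (Suc k) \<omega>)))" and ?c = "ennreal (impulse_cost (Suc k) \<omega>)"
  let ?I = "\<lambda>j. impulse_in (real j * h) (real (Suc j) * h) (Suc k)"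
  have "(\<Sum>j<n. ennreal (\<beta> h * \<beta> (real j * h)) * (indicator (?I j) \<omega> * ?c)) \<le> (\<Sum>j<n. indicator (?I j) \<omega> * (?b * ?c))"
  proof (rule sum_mono)
    fix j
    show "ennreal (\<beta> h * \<beta> (real j * h)) * (indicator (?I j) \<omega> * ?c) \<le> indicator (?I j) \<omega> * (?b * ?c)"
    proof (cases "\<omega> \<in> ?I j")
      case True
      have "\<beta> h * \<beta> (real j * h) \<le> \<beta> (real j * h + h)" using beta_supermult[of "real j * h" h] h by (simp add: add.commute)
      also have "\<dots> \<le> \<beta> (enn2real (\<tau> (Suc k) \<omega>))"
        using tau_in_cell[OF True] h by (intro beta_decreasing) (auto simp: algebra_simps)
      finally show ?thesis using True by (auto intro!: mult_right_mono ennreal_leI)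
    qed simp
  qed
  also have "\<dots> = indicator (impulse_in 0 (real n * h) (Suc k)) \<omega> * (?b * ?c)"
    unfolding sum_distrib_right[symmetric] using h by (subst indicator_grid) auto
  also have "\<dots> \<le> (if \<tau> (Suc k) \<omega> \<le> ennreal (real n * h)
      then ennreal (\<beta> (enn2real (\<tau> (Suc k) \<omega>)) * impulse_cost (Suc k) \<omega>) else 0)"
    using impulse_cost_bounds(2)[of "Suc k" \<omega>] beta_range[of "enn2real (\<tau> (Suc k) \<omega>)"]
    by (auto simp: impulse_in_def indicator_def ennreal_mult)
  finally show "(\<Sum>j<n. ennreal (\<beta> h * \<beta> (real j * h)) * (indicator (?I j) \<omega> * ?c))
    \<le> (if \<tau> (Suc k) \<omega> \<le> ennreal (real n * h)
      then ennreal (\<beta> (enn2real (\<tau> (Suc k) \<omega>)) * impulse_cost (Suc k) \<omega>) else 0)" .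
qed

lemma impulses_le:
  assumes h: "0 < h" and pos: "\<And>k \<omega>. \<omega> \<in> paths \<Longrightarrow> 0 < \<tau> (Suc k) \<omega>"
  shows "impulses (real n * h) \<le> (\<Sum>j<n. ennreal (\<beta> (real j * h)) * impulses_between (real j * h) (real (Suc j) * h))"
  unfolding weighted_impulses impulses_def
proof (intro nn_integral_mono suminf_le summableI)
  fix \<omega> k assume "\<omega> \<in> space M"
  let ?b = "ennreal (\<beta> (enn2real (\<tau> (Suc k) \<omega>)))" and ?c = "ennreal (impulse_cost (Suc k) \<omega>)"
  let ?I = "\<lambda>j. impulse_in (real j * h) (real (Suc j) * h) (Suc k)"
  have "(if \<tau> (Suc k) \<omega> \<le> ennreal (real n * h)
      then ennreal (\<beta> (enn2real (\<tau> (Suc k) \<omega>)) * impulse_cost (Suc k) \<omega>) else 0)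
    \<le> indicator (impulse_in 0 (real n * h) (Suc k)) \<omega> * (?b * ?c)"
    using impulse_cost_bounds(2)[of "Suc k" \<omega>] beta_range[of "enn2real (\<tau> (Suc k) \<omega>)"] pos[of \<omega> k] \<open>\<omega> \<in> space M\<close>
    by (auto simp: impulse_in_def indicator_def ennreal_mult space_M)
  also have "\<dots> = (\<Sum>j<n. indicator (?I j) \<omega> * (?b * ?c))"
    unfolding sum_distrib_right[symmetric] using h by (subst indicator_grid) auto
  also have "\<dots> \<le> (\<Sum>j<n. ennreal (\<beta> (real j * h)) * (indicator (?I j) \<omega> * ?c))"
  proof (rule sum_mono)
    fix j
    show "indicator (?I j) \<omega> * (?b * ?c) \<le> ennreal (\<beta> (real j * h)) * (indicator (?I j) \<omega> * ?c)"
    proof (cases "\<omega> \<in> ?I j")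
      case True
      have "\<beta> (enn2real (\<tau> (Suc k) \<omega>)) \<le> \<beta> (real j * h)"
        using tau_in_cell[OF True] h by (intro beta_decreasing) auto
      then show ?thesis using True by (auto intro!: mult_right_mono ennreal_leI)
    qed simp
  qed
  finally show "(if \<tau> (Suc k) \<omega> \<le> ennreal (real n * h)
      then ennreal (\<beta> (enn2real (\<tau> (Suc k) \<omega>)) * impulse_cost (Suc k) \<omega>) else 0)
    \<le> (\<Sum>j<n. ennreal (\<beta> (real j * h)) * (indicator (?I j) \<omega> * ?c))" .
qed

lemma sum_impulses_between:
  assumes \<omega>: "\<omega> \<in> paths" and act: "active b \<omega>" and ab: "a \<le> b" and f: "\<And>k. 0 \<le> f k"
  shows "(\<Sum>k. indicator (impulse_in a b (Suc k)) \<omega> * ennreal (f k)) = ennreal (\<Sum>k\<in>{n_impulses a \<omega>..<n_impulses b \<omega>}. f k)"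
proof -
  have iff: "\<omega> \<in> impulse_in a b (Suc k) \<longleftrightarrow> k \<in> {n_impulses a \<omega>..<n_impulses b \<omega>}" for k
    using \<omega> tau_le_iff[OF act \<omega>, of "Suc k"] tau_le_iff[OF active_antimono[OF act ab] \<omega>, of "Suc k"]
    by (auto simp: impulse_in_def not_le[symmetric])
  have "(\<Sum>k. indicator (impulse_in a b (Suc k)) \<omega> * ennreal (f k))
      = (\<Sum>k\<in>{n_impulses a \<omega>..<n_impulses b \<omega>}. indicator (impulse_in a b (Suc k)) \<omega> * ennreal (f k))"
    by (rule suminf_finite) (use iff in auto)
  also have "\<dots> = (\<Sum>k\<in>{n_impulses a \<omega>..<n_impulses b \<omega>}. ennreal (f k))"
    by (rule sum.cong) (use iff in auto)
  also have "\<dots> = ennreal (\<Sum>k\<in>{n_impulses a \<omega>..<n_impulses b \<omega>}. f k)" using f by (rule sum_ennreal)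
  finally show ?thesis .
qed

text \<open>
  The expected running cost from the state at time \<open>t\<close> ignores the impulses of the following cell.  Only
  times strictly inside the cell are compared, as an impulse at its end point has no influence.
\<close>

lemma running_step:
  assumes t: "0 \<le> t" and h: "0 < h" and act: "AE \<omega> in M. active (t + h) \<omega>"
    and gap: "\<And>s. 0 \<le> s \<Longrightarrow> s < h \<Longrightarrow> \<bar>(LINT \<omega>|M. g (uninterrupted t s \<omega>)) - mean_g (t + s)\<bar> \<le> B"
  shows "\<bar>(LINT \<omega>|M. running_cost h (state t \<omega>)) - (LINT s:{t..t + h}|lborel. mean_g s)\<bar> \<le> B * h"
proof -
  obtain K where K: "0 \<le> K" "\<And>x. \<bar>g x\<bar> \<le> K" using g_bound by blast
  have B: "0 \<le> B" using gap[of 0] h by simp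
  have actt: "AE \<omega> in M. active t \<omega>" using act by eventually_elim (rule active_antimono, use h in auto)
  define G where "G s = (LINT \<omega>|M. transition (max 0 s) g (state t \<omega>))" for s
  have m: "(\<lambda>p. transition (max 0 (fst p)) g (state t (snd p))) \<in> borel_measurable (borel \<Otimes>\<^sub>M M)"
  proof -
    have "(\<lambda>p. (fst p, state t (snd p))) \<in> borel \<Otimes>\<^sub>M M \<rightarrow>\<^sub>M borel \<Otimes>\<^sub>M borel"
      using state_measurable[OF t] by measurable
    from measurable_compose[OF this transition_jointly_measurable[OF g_continuous]] show ?thesis by simp
  qed
  have Gm [measurable]: "G \<in> borel_measurable borel"
    unfolding G_def[abs_def] by (rule M.borel_measurable_lebesgue_integral) (simp add: case_prod_beta' m)
  have GK: "\<bar>G s\<bar> \<le> K" for s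
  proof -
    have "\<bar>G s\<bar> \<le> (LINT \<omega>|M. \<bar>transition (max 0 s) g (state t \<omega>)\<bar>)"
      unfolding G_def by (rule integral_abs_bound)
    also have "\<dots> \<le> (LINT \<omega>|M. K)"
      using measurable_compose[OF measurable_Pair1' m, of s] transition_g_bound[OF K(2)] K(1)
      by (intro integral_mono M.integrable_const_bound[where B=K]) auto
    finally show ?thesis by (simp add: M.prob_space)
  qed
  have run: "(LINT \<omega>|M. running_cost h (state t \<omega>)) = (LINT s:{0..h}|lborel. G s)"
    unfolding running_cost_def G_def by (rule M.integral_Icc_swap[OF m transition_g_bound[OF K(2)]])
  have shift_m [measurable]: "(\<lambda>s. mean_g (t + s)) \<in> borel_measurable borel"
    using mean_g_measurable by measurable
  have shift: "(LINT s:{t..t + h}|lborel. mean_g s) = (LINT s:{0..h}|lborel. mean_g (t + s))"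
    unfolding set_lebesgue_integral_def
    by (subst lborel_integral_real_affine[of 1 _ t]) (auto intro!: Bochner_Integration.integral_cong simp: indicator_def)
  define f where "f s = (if 0 \<le> s \<and> s < h then G s - mean_g (t + s) else 0)" for s
  have fm [measurable]: "f \<in> borel_measurable borel" unfolding f_def[abs_def] by measurable
  have fB: "\<bar>f s\<bar> \<le> B" for s
  proof (cases "0 \<le> s \<and> s < h")
    case True
    have "(LINT \<omega>|M. g (uninterrupted t s \<omega>)) = G s"
      unfolding G_def using True state_markov[OF actt t _ g_continuous, of s] by (simp add: max_absorb2)
    then show ?thesis using gap[of s] True by (simp add: f_def)
  next
    case False
    then have "f s = 0" by (auto simp: f_def)
    then show ?thesis using B by simp
  qed
  have "(LINT s:{0..h}|lborel. G s) - (LINT s:{0..h}|lborel. mean_g (t + s)) = (LINT s:{0..h}|lborel. G s - mean_g (t + s))"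
    using set_integrable_Icc_bounded[OF Gm GK] set_integrable_Icc_bounded[OF shift_m mean_g_bound[OF K(2)]]
    by (subst set_integral_diff) auto
  also have "\<dots> = (LINT s:{0..h}|lborel. f s)"
    unfolding set_lebesgue_integral_def
  proof (rule integral_cong_AE)
    show "AE s in lborel. indicator {0..h} s *\<^sub>R (G s - mean_g (t + s)) = indicator {0..h} s *\<^sub>R f s"
      using AE_lborel_singleton[of h] by eventually_elim (auto simp: f_def indicator_def)
  qed measurable
  also have "\<bar>\<dots>\<bar> \<le> B * (h - 0)" using h by (intro set_integral_Icc_bound[OF fm fB]) simp
  finally show ?thesis unfolding run shift by simp
qed

lemma mean_g_gap:
  assumes t: "0 \<le> t" and s: "0 \<le> s" and act: "AE \<omega> in M. active (t + s) \<omega>" and K: "\<And>x. \<bar>g x\<bar> \<le> K"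
  shows "\<bar>(LINT \<omega>|M. g (uninterrupted t s \<omega>)) - mean_g (t + s)\<bar> \<le> 2 * K * measure M {\<omega> \<in> space M. n_impulses t \<omega> \<noteq> n_impulses (t + s) \<omega>}"
proof -
  let ?C = "{\<omega> \<in> space M. n_impulses t \<omega> \<noteq> n_impulses (t + s) \<omega>}"
  let ?Y = "\<lambda>\<omega>. Y (max 0 (t + s)) \<omega>"
  have C: "?C \<in> sets M" by measurable
  have i1: "integrable M (\<lambda>\<omega>. g (uninterrupted t s \<omega>))"
    by (rule uninterrupted_integrable[OF g_continuous t s])
  have i2: "integrable M (\<lambda>\<omega>. g (?Y \<omega>))"
    using g_process_measurable_at[of "t + s"] K by (intro M.integrable_const_bound[where B=K]) auto
  have "(LINT \<omega>|M. g (uninterrupted t s \<omega>)) - mean_g (t + s) = (LINT \<omega>|M. g (uninterrupted t s \<omega>) - g (?Y \<omega>))"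
    unfolding mean_g_def using i1 i2 by simp
  also have "\<bar>\<dots>\<bar> \<le> (LINT \<omega>|M. \<bar>g (uninterrupted t s \<omega>) - g (?Y \<omega>)\<bar>)" by (rule integral_abs_bound)
  also have "\<dots> \<le> (LINT \<omega>|M. 2 * K * indicator ?C \<omega>)"
  proof (rule integral_mono_AE)
    show "integrable M (\<lambda>\<omega>. \<bar>g (uninterrupted t s \<omega>) - g (?Y \<omega>)\<bar>)" using i1 i2 by simp
    show "integrable M (\<lambda>\<omega>. 2 * K * indicator ?C \<omega>)" using integrable_indicator[OF C] by simp
    show "AE \<omega> in M. \<bar>g (uninterrupted t s \<omega>) - g (?Y \<omega>)\<bar> \<le> 2 * K * indicator ?C \<omega>"
      using act AE_space
    proof eventually_elim
      case (elim \<omega>)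
      show ?case
      proof (cases "\<omega> \<in> ?C")
        case True
        then show ?thesis using K[of "uninterrupted t s \<omega>"] K[of "?Y \<omega>"] by simp
      next
        case False
        then have "uninterrupted t s \<omega> = ?Y \<omega>"
          using elim t s by (simp add: controlled_process_eq space_M uninterrupted_def state_def max_absorb2)
        then show ?thesis using False by simp
      qed
    qed
  qed
  also have "\<dots> = 2 * K * measure M ?C" using C by simp
  finally show ?thesis .
qed

section \<open>A lower bound for every strategy\<close>

text \<open>
  The running cost is altered only if an impulse occurs in the cell, and such an impulse costs at least
  \<open>c\<^sub>0\<close>.
\<close>

lemma interruption_costs:
  assumes t: "0 \<le> t" and s: "0 \<le> s" "s \<le> h" and act: "AE \<omega> in M. active (t + h) \<omega>"
    and fin: "impulses_between t (t + h) < \<infinity>"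
  shows "c\<^sub>0 * measure M {\<omega> \<in> space M. n_impulses t \<omega> \<noteq> n_impulses (t + s) \<omega>} \<le> enn2real (impulses_between t (t + h))"
proof -
  let ?C = "{\<omega> \<in> space M. n_impulses t \<omega> \<noteq> n_impulses (t + s) \<omega>}"
  have C: "?C \<in> sets M" by measurable
  have "ennreal c\<^sub>0 * emeasure M ?C = (\<integral>\<^sup>+ \<omega>. ennreal c\<^sub>0 * indicator ?C \<omega> \<partial>M)"
    using C by (simp add: nn_integral_cmult_indicator)
  also have "\<dots> \<le> impulses_between t (t + h)"
    unfolding impulses_between_def
  proof (rule nn_integral_mono_AE)
    show "AE \<omega> in M. ennreal c\<^sub>0 * indicator ?C \<omega>
      \<le> (\<Sum>k. indicator (impulse_in t (t + h) (Suc k)) \<omega> * ennreal (impulse_cost (Suc k) \<omega>))"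
      using act AE_space
    proof eventually_elim
      case (elim \<omega>)
      then have \<omega>: "\<omega> \<in> paths" by (simp add: space_M)
      show ?case
      proof (cases "\<omega> \<in> ?C")
        case True
        have act_s: "active (t + s) \<omega>" using active_antimono[OF elim(1)] s by simp
        have "n_impulses t \<omega> \<le> n_impulses (t + s) \<omega>" "n_impulses (t + s) \<omega> \<le> n_impulses (t + h) \<omega>"
          using n_impulses_mono[OF act_s \<omega>] n_impulses_mono[OF elim(1) \<omega>] s by auto
        then have lt: "n_impulses t \<omega> \<in> {n_impulses t \<omega>..<n_impulses (t + h) \<omega>}" using True by auto
        have "c\<^sub>0 \<le> (\<Sum>k\<in>{n_impulses t \<omega>}. impulse_cost (Suc k) \<omega>)" using impulse_cost_bounds by simp
        also have "\<dots> \<le> (\<Sum>k\<in>{n_impulses t \<omega>..<n_impulses (t + h) \<omega>}. impulse_cost (Suc k) \<omega>)"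
          using lt impulse_cost_bounds by (intro sum_mono2) auto
        finally have "ennreal c\<^sub>0 \<le> ennreal (\<Sum>k\<in>{n_impulses t \<omega>..<n_impulses (t + h) \<omega>}. impulse_cost (Suc k) \<omega>)"
          by (rule ennreal_leI)
        then show ?thesis
          using sum_impulses_between[OF \<omega> elim(1), of t "\<lambda>k. impulse_cost (Suc k) \<omega>"] s impulse_cost_bounds
          by (simp add: indicator_def)
      qed simp
    qed
  qed
  finally have "ennreal (c\<^sub>0 * measure M ?C) \<le> impulses_between t (t + h)"
    using c0(1) by (simp add: M.emeasure_eq_measure ennreal_mult)
  from enn2real_mono[OF this fin[simplified]] show ?thesis using c0(1) by simp
qed

text \<open>
  At the end of the cell, follow the copies from the one that was alive at its beginning to the one that
  is alive now: by \<open>v(x) \<le> c(x,\<xi>) + v(\<xi>)\<close> each passage is paid by the cost of the impulse charged at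
  this time.  Charging late increases the expected cost of each impulse at most by a factor \<open>1 + \<kappa>\<close>, as
  the error \<open>\<kappa> c\<^sub>0\<close> is a fraction \<open>\<kappa>\<close> of the least possible cost.
\<close>

lemma expected_intervention_step:
  assumes v: "continuous_on UNIV v" and tri: "\<And>x \<xi>. v x \<le> c x \<xi> + v \<xi>"
    and t: "0 \<le> t" and h: "0 < h" and act: "AE \<omega> in M. active (t + h) \<omega>"
    and fin: "impulses_between t (t + h) < \<infinity>" and \<kappa>: "0 \<le> \<kappa>"
    and delay: "\<And>l. 1 \<le> l \<Longrightarrow>
      (LINT \<omega>|M. indicator (impulse_in t (t + h) l) \<omega> * c (X (t + h) (\<omega> l)) (X (t + h) (\<omega> (Suc l))))
      \<le> (LINT \<omega>|M. indicator (impulse_in t (t + h) l) \<omega> * impulse_cost l \<omega>) + \<kappa> * c\<^sub>0 * measure M (impulse_in t (t + h) l)"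
  shows "(LINT \<omega>|M. v (uninterrupted t h \<omega>))
    \<le> (LINT \<omega>|M. v (state (t + h) \<omega>)) + (1 + \<kappa>) * enn2real (impulses_between t (t + h))"
proof -
  let ?I = "\<lambda>k. impulse_in t (t + h) (Suc k)"
  let ?d = "\<lambda>k \<omega>. c (X (t + h) (\<omega> (Suc k))) (X (t + h) (\<omega> (Suc (Suc k))))"
  obtain Kc where Kc: "0 < Kc" "\<And>x \<xi>. c x \<xi> \<le> Kc" using c_bounded by blast
  have dm [measurable]: "?d k \<in> borel_measurable M" for k
    using t h by (intro c_measurable copy_at_measurable) auto
  have im [measurable]: "impulse_cost (Suc k) \<in> borel_measurable M" for k by (rule impulse_cost_measurable) simp
  have int: "integrable M (\<lambda>\<omega>. indicator (?I k) \<omega> * f \<omega>)" if "f \<in> borel_measurable M" "\<And>\<omega>. \<bar>f \<omega>\<bar> \<le> Kc" for f :: "_ \<Rightarrow> real" and k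
    using that(1) that(2) Kc(1) by (intro M.integrable_const_bound[where B=Kc]) (auto simp: indicator_def)
  have id: "integrable M (\<lambda>\<omega>. indicator (?I k) \<omega> * ?d k \<omega>)" for k
    using Kc c_nonneg by (intro int) auto
  have ii: "integrable M (\<lambda>\<omega>. indicator (?I k) \<omega> * impulse_cost (Suc k) \<omega>)" for k
  proof (rule int[OF im])
    show "\<bar>impulse_cost (Suc k) \<omega>\<bar> \<le> Kc" for \<omega> by (simp add: impulse_cost_def c_nonneg Kc)
  qed
  define R where "R \<omega> = (\<Sum>k. indicator (?I k) \<omega> * ennreal (?d k \<omega>))" for \<omega>
  have Rm [measurable]: "R \<in> borel_measurable M" unfolding R_def by measurable
  have "(\<integral>\<^sup>+ \<omega>. R \<omega> \<partial>M) = (\<Sum>k. \<integral>\<^sup>+ \<omega>. indicator (?I k) \<omega> * ennreal (?d k \<omega>) \<partial>M)"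
    unfolding R_def by (rule nn_integral_suminf) measurable
  also have "\<dots> \<le> (\<Sum>k. ennreal (1 + \<kappa>) * (\<integral>\<^sup>+ \<omega>. indicator (?I k) \<omega> * ennreal (impulse_cost (Suc k) \<omega>) \<partial>M))"
  proof (intro suminf_le summableI)
    fix k
    have nn: "(\<integral>\<^sup>+ \<omega>. indicator (?I k) \<omega> * ennreal (f \<omega>) \<partial>M) = ennreal (LINT \<omega>|M. indicator (?I k) \<omega> * f \<omega>)"
      if "integrable M (\<lambda>\<omega>. indicator (?I k) \<omega> * f \<omega>)" "\<And>\<omega>. 0 \<le> f \<omega>" for f
    proof -
      have "(\<integral>\<^sup>+ \<omega>. indicator (?I k) \<omega> * ennreal (f \<omega>) \<partial>M) = (\<integral>\<^sup>+ \<omega>. ennreal (indicator (?I k) \<omega> * f \<omega>) \<partial>M)"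
        by (intro nn_integral_cong) (simp add: indicator_def)
      also have "\<dots> = ennreal (LINT \<omega>|M. indicator (?I k) \<omega> * f \<omega>)"
        using that by (intro nn_integral_eq_integral) auto
      finally show ?thesis .
    qed
    have "c\<^sub>0 * measure M (?I k) = (LINT \<omega>|M. indicator (?I k) \<omega> * c\<^sub>0)" by simp
    also have "\<dots> \<le> (LINT \<omega>|M. indicator (?I k) \<omega> * impulse_cost (Suc k) \<omega>)"
      using impulse_cost_bounds integrable_indicator[OF impulse_in_sets] ii by (intro integral_mono mult_left_mono) auto
    finally have "\<kappa> * (c\<^sub>0 * measure M (?I k)) \<le> \<kappa> * (LINT \<omega>|M. indicator (?I k) \<omega> * impulse_cost (Suc k) \<omega>)"
      using \<kappa> by (rule mult_left_mono)
    then have "(LINT \<omega>|M. indicator (?I k) \<omega> * ?d k \<omega>) \<le> (1 + \<kappa>) * (LINT \<omega>|M. indicator (?I k) \<omega> * impulse_cost (Suc k) \<omega>)"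
      using delay[of "Suc k"] by (simp add: algebra_simps)
    then have "ennreal (LINT \<omega>|M. indicator (?I k) \<omega> * ?d k \<omega>)
        \<le> ennreal (1 + \<kappa>) * ennreal (LINT \<omega>|M. indicator (?I k) \<omega> * impulse_cost (Suc k) \<omega>)"
      using \<kappa> impulse_cost_bounds by (subst ennreal_mult[symmetric]) (auto intro!: ennreal_leI)
    then show "(\<integral>\<^sup>+ \<omega>. indicator (?I k) \<omega> * ennreal (?d k \<omega>) \<partial>M)
      \<le> ennreal (1 + \<kappa>) * (\<integral>\<^sup>+ \<omega>. indicator (?I k) \<omega> * ennreal (impulse_cost (Suc k) \<omega>) \<partial>M)"
      using nn[OF id c_nonneg] nn[OF ii impulse_cost_bounds(2)] by simp
  qed
  also have "\<dots> = ennreal (1 + \<kappa>) * impulses_between t (t + h)"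
    unfolding impulses_between_def by (subst nn_integral_suminf) (auto simp: ennreal_suminf_cmult)
  finally have Rle: "(\<integral>\<^sup>+ \<omega>. R \<omega> \<partial>M) \<le> ennreal (1 + \<kappa>) * impulses_between t (t + h)" .
  have lt: "ennreal (1 + \<kappa>) * impulses_between t (t + h) < \<infinity>"
    using fin by (simp add: ennreal_mult_less_top)
  then have Rfin: "(\<integral>\<^sup>+ \<omega>. R \<omega> \<partial>M) \<noteq> \<infinity>" using Rle by (auto simp: top_unique)
  have Rae: "AE \<omega> in M. R \<omega> \<noteq> \<infinity>" using Rfin by (intro nn_integral_PInf_AE) auto
  have Req: "(\<integral>\<^sup>+ \<omega>. ennreal (enn2real (R \<omega>)) \<partial>M) = (\<integral>\<^sup>+ \<omega>. R \<omega> \<partial>M)"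
    using Rae by (intro nn_integral_cong_AE) (auto simp: less_top)
  have iR: "integrable M (\<lambda>\<omega>. enn2real (R \<omega>))"
    using Rfin Req by (intro integrableI_nonneg) (auto simp: less_top)
  have LR: "(LINT \<omega>|M. enn2real (R \<omega>)) \<le> (1 + \<kappa>) * enn2real (impulses_between t (t + h))"
  proof -
    have "(LINT \<omega>|M. enn2real (R \<omega>)) = enn2real (\<integral>\<^sup>+ \<omega>. R \<omega> \<partial>M)"
      by (subst integral_eq_nn_integral) (auto simp: Req)
    also have "\<dots> \<le> enn2real (ennreal (1 + \<kappa>) * impulses_between t (t + h))"
      using Rle lt by (intro enn2real_mono) auto
    finally show ?thesis using \<kappa> by (simp add: enn2real_mult del: ennreal_plus)
  qed
  have iu: "integrable M (\<lambda>\<omega>. v (uninterrupted t h \<omega>))" using v t h by (intro uninterrupted_integrable) auto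
  have ist: "integrable M (\<lambda>\<omega>. v (state (t + h) \<omega>))" using v t h by (intro state_integrable) auto
  have "(LINT \<omega>|M. v (uninterrupted t h \<omega>)) \<le> (LINT \<omega>|M. v (state (t + h) \<omega>) + enn2real (R \<omega>))"
  proof (rule integral_mono_AE)
    show "AE \<omega> in M. v (uninterrupted t h \<omega>) \<le> v (state (t + h) \<omega>) + enn2real (R \<omega>)"
      using act AE_space
    proof eventually_elim
      case (elim \<omega>)
      then have \<omega>: "\<omega> \<in> paths" by (simp add: space_M)
      have chain: "v (X (t + h) (\<omega> (Suc m))) \<le> v (X (t + h) (\<omega> (Suc n))) + (\<Sum>k\<in>{m..<n}. ?d k \<omega>)" if "m \<le> n" for m n
        using that
      proof (induction n rule: dec_induct)
        case (step n)
        then show ?case using tri[of "X (t + h) (\<omega> (Suc n))" "X (t + h) (\<omega> (Suc (Suc n)))"] by simp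
      qed simp
      have "R \<omega> = ennreal (\<Sum>k\<in>{n_impulses t \<omega>..<n_impulses (t + h) \<omega>}. ?d k \<omega>)"
        unfolding R_def using h c_nonneg by (intro sum_impulses_between[OF \<omega> elim(1)]) auto
      then have "enn2real (R \<omega>) = (\<Sum>k\<in>{n_impulses t \<omega>..<n_impulses (t + h) \<omega>}. ?d k \<omega>)"
        using c_nonneg by (simp add: sum_nonneg)
      then show ?case
        using chain[OF n_impulses_mono[OF elim(1) \<omega>]] h by (simp add: uninterrupted_def state_def)
    qed
  qed (use iu ist iR in auto)
  also have "\<dots> = (LINT \<omega>|M. v (state (t + h) \<omega>)) + (LINT \<omega>|M. enn2real (R \<omega>))"
    using ist iR by simp
  finally show ?thesis using LR by linarith
qed

lemma expected_bellman_step: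
  assumes u: "continuous_on UNIV u" and v: "continuous_on UNIV v"
    and t: "0 \<le> t" and h: "0 < h" and act: "AE \<omega> in M. active t \<omega>"
    and bellman: "\<And>x. \<bar>u x - (running_cost h x + transition h v x - \<mu> * h)\<bar> \<le> \<eta>"
  shows "\<bar>(LINT \<omega>|M. u (state t \<omega>)) - ((LINT \<omega>|M. running_cost h (state t \<omega>)) + (LINT \<omega>|M. v (uninterrupted t h \<omega>)) - \<mu> * h)\<bar> \<le> \<eta>"
proof -
  have h0: "0 \<le> h" using h by simp
  have i: "integrable M (\<lambda>\<omega>. u (state t \<omega>))" "integrable M (\<lambda>\<omega>. running_cost h (state t \<omega>))"
    "integrable M (\<lambda>\<omega>. transition h v (state t \<omega>))"
    using u running_cost_continuous transition_continuous[OF h0 v] t by (auto intro: state_integrable)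
  have eq: "(LINT \<omega>|M. u (state t \<omega>)) - ((LINT \<omega>|M. running_cost h (state t \<omega>)) + (LINT \<omega>|M. v (uninterrupted t h \<omega>)) - \<mu> * h)
     = (LINT \<omega>|M. u (state t \<omega>) - (running_cost h (state t \<omega>) + transition h v (state t \<omega>) - \<mu> * h))"
    unfolding state_markov[OF act t h0 v] using i by (simp add: M.prob_space)
  have "\<bar>LINT \<omega>|M. u (state t \<omega>) - (running_cost h (state t \<omega>) + transition h v (state t \<omega>) - \<mu> * h)\<bar>
      \<le> (LINT \<omega>|M. \<bar>u (state t \<omega>) - (running_cost h (state t \<omega>) + transition h v (state t \<omega>) - \<mu> * h)\<bar>)"
    by (rule integral_abs_bound)
  also have "\<dots> \<le> (LINT \<omega>|M. \<eta>)" using bellman i by (intro integral_mono) auto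
  finally show ?thesis unfolding eq by (simp add: M.prob_space)
qed

lemma expected_state_bound:
  fixes v :: "'e \<Rightarrow> real"
  assumes "continuous_on UNIV v" "\<And>x. \<bar>v x\<bar> \<le> K" "0 \<le> t"
  shows "\<bar>LINT \<omega>|M. v (state t \<omega>)\<bar> \<le> K"
proof -
  have "\<bar>LINT \<omega>|M. v (state t \<omega>)\<bar> \<le> (LINT \<omega>|M. \<bar>v (state t \<omega>)\<bar>)" by (rule integral_abs_bound)
  also have "\<dots> \<le> (LINT \<omega>|M. K)"
    using state_integrable[OF assms(1,3)] assms(2) by (intro integral_mono) auto
  finally show ?thesis by (simp add: M.prob_space)
qed

text \<open>
  Summing the one-step inequalities gives a bound in which the impulse costs carry the factor \<open>1/q\<close>.
  Multiplication by \<open>q\<close> and the trivial bound for the remaining part \<open>1 - q\<close> of the running cost give a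
  bound for the true cost.  If the impulse costs are infinite there is nothing to prove.
\<close>

lemma lower_bound_grid:
  assumes h: "0 < h" and v: "continuous_on UNIV v" "\<And>x. \<bar>v x\<bar> \<le> Kv" and u: "continuous_on UNIV u"
    and vu: "\<And>x. v x \<le> u x" and tri: "\<And>x \<xi>. v x \<le> c x \<xi> + v \<xi>"
    and bellman: "\<And>x. \<bar>u x - (running_cost h x + transition h v x - \<mu> * h)\<bar> \<le> \<eta>"
    and Kg: "\<And>x. \<bar>g x\<bar> \<le> Kg" and \<kappa>: "0 \<le> \<kappa>"
    and delay: "\<And>l a. 1 \<le> l \<Longrightarrow> 0 \<le> a \<Longrightarrow>
      (LINT \<omega>|M. indicator (impulse_in a (a + h) l) \<omega> * c (X (a + h) (\<omega> l)) (X (a + h) (\<omega> (Suc l))))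
      \<le> (LINT \<omega>|M. indicator (impulse_in a (a + h) l) \<omega> * impulse_cost l \<omega>) + \<kappa> * c\<^sub>0 * measure M (impulse_in a (a + h) l)"
  defines "q \<equiv> \<beta> h / (1 + \<kappa> + 2 * Kg * h / c\<^sub>0)"
  shows "ereal ((q * (\<mu> - \<eta> / h) - (1 - q) * Kg) * mass (real n * h) - (\<bar>\<mu> * h - \<eta>\<bar> + (2 * Kv + Kg * h)))
    \<le> cost (real n * h)"
proof (cases "impulses (real n * h) = \<infinity>")
  case True
  then show ?thesis by (simp add: expected_cost_eq)
next
  case False
  have Kg0: "0 \<le> Kg" using Kg[of undefined] by simp
  have bh: "0 < \<beta> h" "\<beta> h \<le> 1" using beta_range[of h] h by auto
  define D where "D = 1 + \<kappa> + 2 * Kg * h / c\<^sub>0"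
  have D1: "1 \<le> D" unfolding D_def using \<kappa> Kg0 h c0(1) by simp
  have q: "0 < q" "q \<le> 1" "q * D = \<beta> h" using bh D1 by (auto simp: q_def D_def[symmetric] divide_le_eq_1)
  have actn: "AE \<omega> in M. active (real n * h) \<omega>"
    using active_if_finite_cost[OF _ False] h by simp
  let ?S = "\<lambda>j. impulses_between (real j * h) (real (Suc j) * h)"
  define A where "A = enn2real (impulses (real n * h))"
  have A: "impulses (real n * h) = ennreal A" "0 \<le> A" using False by (auto simp: A_def less_top)
  have bpos: "0 < \<beta> (real j * h)" for j using beta_range[of "real j * h"] h by simp
  have Sfin: "?S j < \<infinity>" if "j < n" for j
  proof -
    have "ennreal (\<beta> h * \<beta> (real j * h)) * ?S j \<le> impulses (real n * h)"
      by (rule order_trans[OF member_le_sum impulses_ge[OF h]]) (use that in auto)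
    then have "ennreal (\<beta> h * \<beta> (real j * h)) * ?S j < \<infinity>" unfolding A(1) by (simp add: le_less_trans[OF _ ennreal_less_top])
    then show ?thesis using bh bpos[of j] by (auto simp: ennreal_mult_less_top)
  qed
  define S where "S j = enn2real (?S j)" for j
  have S: "?S j = ennreal (S j)" if "j < n" for j using Sfin[OF that] by (simp add: S_def)
  have S0: "0 \<le> S j" for j by (simp add: S_def)
  have SA: "\<beta> h * (\<Sum>j<n. \<beta> (real j * h) * S j) \<le> A"
  proof -
    have "ennreal (\<Sum>j<n. \<beta> h * \<beta> (real j * h) * S j) = (\<Sum>j<n. ennreal (\<beta> h * \<beta> (real j * h)) * ?S j)"
      using bh bpos S0 S by (subst sum_ennreal[symmetric]) (auto simp: ennreal_mult less_imp_le intro!: sum.cong mult_nonneg_nonneg)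
    also have "\<dots> \<le> ennreal A" using impulses_ge[OF h, of n] unfolding A(1) .
    finally show ?thesis using A(2) by (simp add: sum_distrib_left mult.assoc)
  qed
  define a where "a j = (LINT \<omega>|M. v (state (real j * h) \<omega>))" for j
  define G where "G = (LINT s:{0..real n * h}|lborel. \<beta> (max 0 s) * mean_g s)"
  have "(\<mu> * h - \<eta>) * (\<Sum>j<n. \<beta> (real j * h)) \<le> G + (\<Sum>j<n. \<beta> (real j * h) * (D * S j)) + (2 * Kv + Kg * h)"
    unfolding G_def
  proof (rule discounted_telescope[OF h mean_g_measurable mean_g_bound[OF Kg]])
    show "\<bar>a j\<bar> \<le> Kv" for j unfolding a_def using h by (intro expected_state_bound v) auto
    fix j assume j: "j < n"
    let ?t = "real j * h"
    have t: "0 \<le> ?t" and th: "?t + h = real (Suc j) * h" using h by (auto simp: algebra_simps)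
    have le: "?t + h \<le> real n * h" unfolding th using j h by (intro mult_right_mono) auto
    have act: "AE \<omega> in M. active (?t + h) \<omega>" using actn by eventually_elim (rule active_antimono[OF _ le])
    have actt: "AE \<omega> in M. active ?t \<omega>" using act by eventually_elim (rule active_antimono, use h in auto)
    have fin: "impulses_between ?t (?t + h) < \<infinity>" unfolding th by (rule Sfin[OF j])
    have Sj: "enn2real (impulses_between ?t (?t + h)) = S j" unfolding th S_def ..
    have "\<bar>(LINT \<omega>|M. running_cost h (state ?t \<omega>)) - (LINT s:{?t..?t + h}|lborel. mean_g s)\<bar> \<le> (2 * Kg * S j / c\<^sub>0) * h"
    proof (rule running_step[OF t h act])
      fix s assume s: "0 \<le> s" "s < h"
      let ?m = "measure M {\<omega> \<in> space M. n_impulses ?t \<omega> \<noteq> n_impulses (?t + s) \<omega>}"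
      have acts: "AE \<omega> in M. active (?t + s) \<omega>" using act by eventually_elim (rule active_antimono, use s in auto)
      have "?m \<le> S j / c\<^sub>0"
        using interruption_costs[OF t s(1) less_imp_le[OF s(2)] act fin] c0(1) unfolding Sj by (simp add: pos_le_divide_eq mult.commute)
      then have "2 * Kg * ?m \<le> 2 * Kg * (S j / c\<^sub>0)" using Kg0 by (intro mult_left_mono) auto
      then show "\<bar>(LINT \<omega>|M. g (uninterrupted ?t s \<omega>)) - mean_g (?t + s)\<bar> \<le> 2 * Kg * S j / c\<^sub>0"
        using mean_g_gap[OF t s(1) acts Kg] by simp
    qed
    then have 1: "(LINT \<omega>|M. running_cost h (state ?t \<omega>)) \<le> (LINT s:{?t..real (Suc j) * h}|lborel. mean_g s) + 2 * Kg * h / c\<^sub>0 * S j"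
      unfolding th by (simp add: abs_le_iff algebra_simps)
    have 2: "(LINT \<omega>|M. v (uninterrupted ?t h \<omega>)) \<le> a (Suc j) + (1 + \<kappa>) * S j"
      using expected_intervention_step[OF v(1) tri t h act fin \<kappa> delay[OF _ t]] unfolding Sj unfolding a_def th by simp
    have 3: "a j \<le> (LINT \<omega>|M. u (state ?t \<omega>))"
      unfolding a_def using state_integrable[OF v(1) t] state_integrable[OF u t] vu by (intro integral_mono) auto
    have 4: "(LINT \<omega>|M. u (state ?t \<omega>)) \<le> (LINT \<omega>|M. running_cost h (state ?t \<omega>)) + (LINT \<omega>|M. v (uninterrupted ?t h \<omega>)) - \<mu> * h + \<eta>"
      using expected_bellman_step[OF u v(1) t h actt bellman] by (simp add: abs_le_iff)
    have "D * S j = (1 + \<kappa>) * S j + 2 * Kg * h / c\<^sub>0 * S j" unfolding D_def by (simp add: algebra_simps)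
    then show "a j - a (Suc j) \<le> (LINT s:{?t..real (Suc j) * h}|lborel. mean_g s) + D * S j - (\<mu> * h - \<eta>)"
      using 1 2 3 4 by linarith
  qed
  also have "(\<Sum>j<n. \<beta> (real j * h) * (D * S j)) = D * (\<Sum>j<n. \<beta> (real j * h) * S j)"
    by (simp add: sum_distrib_left mult.left_commute)
  finally have tel: "(\<mu> * h - \<eta>) * (\<Sum>j<n. \<beta> (real j * h)) \<le> G + D * (\<Sum>j<n. \<beta> (real j * h) * S j) + (2 * Kv + Kg * h)" .
  have mg: "\<bar>h * (\<Sum>j<n. \<beta> (real j * h)) - mass (real n * h)\<bar> \<le> h" by (rule mass_grid[OF h])
  have GK: "\<bar>G\<bar> \<le> Kg * mass (real n * h)"
  proof -
    have "\<bar>G\<bar> \<le> (LINT s:{0..real n * h}|lborel. \<bar>\<beta> (max 0 s) * mean_g s\<bar>)"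
      unfolding G_def using set_integral_norm_bound[OF set_integrable_weighted[OF mean_g_measurable mean_g_bound[OF Kg]]] by simp
    also have "\<dots> \<le> (LINT s:{0..real n * h}|lborel. \<beta> (max 0 s) * Kg)"
    proof (rule set_integral_mono)
      show "set_integrable lborel {0..real n * h} (\<lambda>s. \<bar>\<beta> (max 0 s) * mean_g s\<bar>)"
        by (intro set_integrable_abs set_integrable_weighted[OF mean_g_measurable mean_g_bound[OF Kg]])
      show "set_integrable lborel {0..real n * h} (\<lambda>s. \<beta> (max 0 s) * Kg)"
        by (rule set_integrable_weighted[where K="\<bar>Kg\<bar>"]) auto
      show "\<bar>\<beta> (max 0 s) * mean_g s\<bar> \<le> \<beta> (max 0 s) * Kg" for s
        unfolding abs_mult using beta_range[of "max 0 s"] mean_g_bound[OF Kg] by (intro mult_mono) auto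
    qed
    also have "\<dots> = Kg * mass (real n * h)" unfolding mass_eq by simp
    finally show ?thesis .
  qed
  define \<theta> where "\<theta> = \<mu> * h - \<eta>"
  define b where "b = (\<Sum>j<n. \<beta> (real j * h))"
  define m where "m = mass (real n * h)"
  define C where "C = 2 * Kv + Kg * h"
  have C0: "0 \<le> C" unfolding C_def using Kg0 h order_trans[OF abs_ge_zero v(2)] by simp
  have mb: "\<bar>\<theta> * b - (\<theta> / h) * m\<bar> \<le> \<bar>\<theta>\<bar>"
  proof -
    have "\<theta> * b - (\<theta> / h) * m = (\<theta> / h) * (h * b - m)" using h by (simp add: right_diff_distrib)
    also have "\<bar>\<dots>\<bar> \<le> \<bar>\<theta> / h\<bar> * h" unfolding abs_mult using mg by (intro mult_left_mono) (auto simp: b_def m_def)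
    also have "\<dots> = \<bar>\<theta>\<bar>" using h by (simp add: abs_divide)
    finally show ?thesis .
  qed
  have "q * (D * (\<Sum>j<n. \<beta> (real j * h) * S j)) = \<beta> h * (\<Sum>j<n. \<beta> (real j * h) * S j)"
    unfolding q(3)[symmetric] by simp
  from this SA have "q * (D * (\<Sum>j<n. \<beta> (real j * h) * S j)) \<le> A" by (rule ord_eq_le_trans)
  moreover have "q * (\<theta> * b) \<le> q * (G + D * (\<Sum>j<n. \<beta> (real j * h) * S j) + C)"
    using tel q(1) by (intro mult_left_mono) (auto simp: \<theta>_def b_def C_def)
  ultimately have 1: "q * (\<theta> * b) \<le> q * G + A + q * C" by (simp add: distrib_left)
  have 2: "q * ((\<theta> / h) * m - \<bar>\<theta>\<bar>) \<le> q * (\<theta> * b)" using mb q(1) by (intro mult_left_mono) auto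
  have 3: "q * \<bar>\<theta>\<bar> \<le> \<bar>\<theta>\<bar>" "q * C \<le> C" using q C0 by (auto intro!: mult_left_le_one_le)
  have "(1 - q) * (- (Kg * m)) \<le> (1 - q) * G" using GK q(2) by (intro mult_left_mono) (auto simp: m_def)
  then have "q * ((\<theta> / h) * m) - (1 - q) * (Kg * m) - \<bar>\<theta>\<bar> - C \<le> G + A"
    using 1 2 3 by (simp add: algebra_simps)
  moreover have "\<theta> / h = \<mu> - \<eta> / h" using h by (simp add: \<theta>_def diff_divide_distrib)
  ultimately have "(q * (\<mu> - \<eta> / h) - (1 - q) * Kg) * m - (\<bar>\<theta>\<bar> + C) \<le> G + A"
    by (simp add: algebra_simps)
  then show ?thesis
    unfolding expected_cost_eq A(1) using A(2) by (simp add: G_def m_def \<theta>_def C_def)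
qed

lemma average_cost_lower:
  assumes h: "0 < h"
    and le: "\<And>n. ereal (a * mass (real n * h) - C) \<le> cost (real n * h)"
  shows "ereal a \<le> discounted_average_cost X \<beta> g c M (\<tau>, \<xi>)"
proof -
  have lim: "filterlim (\<lambda>n. real n * h) at_top sequentially"
    using h by (intro filterlim_at_top_mult_tendsto_pos[OF tendsto_const] filterlim_real_sequentially)
  have ml: "filterlim (\<lambda>n. mass (real n * h)) at_top sequentially"
    by (rule filterlim_compose[OF mass_at_top lim])
  have "(\<lambda>n. a - C / mass (real n * h)) \<longlonglongrightarrow> a - 0"
    by (intro tendsto_intros real_tendsto_divide_at_top[OF tendsto_const ml])
  then have "(\<lambda>n. ereal (a - C / mass (real n * h))) \<longlonglongrightarrow> ereal a" by simp
  then have "ereal a = Limsup sequentially (\<lambda>n. ereal (a - C / mass (real n * h)))"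
    by (intro lim_imp_Limsup[symmetric]) auto
  also have "\<dots> \<le> Limsup sequentially (\<lambda>n. cost (real n * h) / ereal (mass (real n * h)))"
  proof (rule Limsup_mono)
    have "\<forall>\<^sub>F n in sequentially. 0 < mass (real n * h)"
      using ml by (auto simp: filterlim_at_top_dense)
    then show "\<forall>\<^sub>F n in sequentially. ereal (a - C / mass (real n * h))
        \<le> cost (real n * h) / ereal (mass (real n * h))"
    proof eventually_elim
      case (elim n)
      have "ereal (a - C / mass (real n * h)) = ereal (a * mass (real n * h) - C) / ereal (mass (real n * h))"
        using elim by (simp add: diff_divide_distrib)
      also have "\<dots> \<le> cost (real n * h) / ereal (mass (real n * h))"
        using elim by (intro ereal_divide_right_mono le) auto
      finally show ?case .
    qed
  qed
  also have "\<dots> \<le> Limsup at_top (\<lambda>T. cost T / ereal (mass T))"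
  proof (rule Limsup_greatest)
    fix Q assume "eventually Q (at_top :: real filter)"
    then have "\<forall>\<^sub>F n in sequentially. Q (real n * h)" using lim by (rule eventually_compose_filterlim)
    then show "Limsup sequentially (\<lambda>n. cost (real n * h) / ereal (mass (real n * h)))
        \<le> (SUP T\<in>Collect Q. cost T / ereal (mass T))"
      by (intro Limsup_bounded) (auto elim!: eventually_mono intro!: SUP_upper)
  qed
  finally show ?thesis unfolding discounted_average_cost_def mass_def .
qed

end

section \<open>Strategies of threshold type on the grid\<close>

context markov_process
begin

text \<open>
  The first grid time strictly after the previous impulse at which the live copy is in \<open>D\<close>, and \<open>\<infinity>\<close> if
  there is none.  Strictness forces the impulse times apart, so they cannot accumulate.
\<close>

primrec grid_hit :: "real \<Rightarrow> 'e set \<Rightarrow> nat \<Rightarrow> (nat \<Rightarrow> 'w) \<Rightarrow> ennreal" where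
  "grid_hit h D 0 = (\<lambda>\<omega>. 0)"
| "grid_hit h D (Suc i) = (\<lambda>\<omega>. INF k\<in>{k. grid_hit h D i \<omega> < ennreal (real k * h) \<and> X (real k * h) (\<omega> (Suc i)) \<in> D}. ennreal (real k * h))"

lemma grid_hit_le: "grid_hit h D i \<omega> < ennreal (real k * h) \<Longrightarrow> X (real k * h) (\<omega> (Suc i)) \<in> D
    \<Longrightarrow> grid_hit h D (Suc i) \<omega> \<le> ennreal (real k * h)"
  by (auto intro: INF_lower)

lemma grid_hit_cases:
  assumes h: "0 \<le> h"
  shows "grid_hit h D (Suc i) \<omega> = \<infinity> \<or> (\<exists>k. grid_hit h D (Suc i) \<omega> = ennreal (real k * h)
    \<and> grid_hit h D i \<omega> < ennreal (real k * h) \<and> X (real k * h) (\<omega> (Suc i)) \<in> D)"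
proof -
  let ?Q = "\<lambda>k. grid_hit h D i \<omega> < ennreal (real k * h) \<and> X (real k * h) (\<omega> (Suc i)) \<in> D"
  show ?thesis
  proof (cases "\<exists>k. ?Q k")
    case True
    have Q: "?Q (LEAST k. ?Q k)" using True by (rule LeastI_ex)
    have "grid_hit h D (Suc i) \<omega> = ennreal (real (LEAST k. ?Q k) * h)"
    proof (rule antisym)
      show "grid_hit h D (Suc i) \<omega> \<le> ennreal (real (LEAST k. ?Q k) * h)" using Q by (intro grid_hit_le) auto
      show "ennreal (real (LEAST k. ?Q k) * h) \<le> grid_hit h D (Suc i) \<omega>"
        unfolding grid_hit.simps
      proof (rule INF_greatest)
        fix k assume "k \<in> {k. ?Q k}"
        then have "(LEAST k. ?Q k) \<le> k" by (intro Least_le) simp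
        then show "ennreal (real (LEAST k. ?Q k) * h) \<le> ennreal (real k * h)"
          using h by (intro ennreal_leI mult_right_mono) auto
      qed
    qed
    then show ?thesis using Q by blast
  next
    case False
    then have "{k. ?Q k} = {}" by blast
    then show ?thesis by simp
  qed
qed

lemma grid_hit_stopping:
  assumes h: "0 \<le> h" and D: "D \<in> sets borel" and m: "i \<le> m" "1 \<le> m"
  shows "stopping_time (\<F> m) (grid_hit h D i)"
  using m
proof (induction i)
  case 0 then show ?case by (simp add: stopping_time_const)
next
  case (Suc i)
  then have IH: "stopping_time (\<F> m) (grid_hit h D i)" by simp
  show ?case
  proof
    fix t
    have eq: "grid_hit h D (Suc i) \<omega> \<le> t \<longleftrightarrow> t = \<infinity> \<or> (\<exists>k. ennreal (real k * h) \<le> t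
        \<and> grid_hit h D i \<omega> < ennreal (real k * h) \<and> X (real k * h) (\<omega> (Suc i)) \<in> D)" for \<omega>
      using grid_hit_cases[OF h, of D i \<omega>] grid_hit_le[of h D i \<omega>]
      by (auto simp del: grid_hit.simps simp: top_unique intro: order_trans)
    have "Measurable.pred (\<F> m t) (\<lambda>\<omega>. ennreal (real k * h) \<le> t
        \<and> grid_hit h D i \<omega> < ennreal (real k * h) \<and> X (real k * h) (\<omega> (Suc i)) \<in> D)" for k
    proof (cases "ennreal (real k * h) \<le> t")
      case True
      have "Measurable.pred (\<F> m (ennreal (real k * h))) (\<lambda>\<omega>. grid_hit h D i \<omega> < ennreal (real k * h))"
        by (rule filtration.stopping_time_less_const[OF filtration_prod IH])
      then have [measurable]: "Measurable.pred (\<F> m t) (\<lambda>\<omega>. grid_hit h D i \<omega> < ennreal (real k * h))"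
        using sets_prod_filtration_mono[OF order_refl True, of m] by (auto simp: pred_def space_prod_filtration)
      have [measurable]: "(\<lambda>\<omega>. X (real k * h) (\<omega> (Suc i))) \<in> borel_measurable (\<F> m t)"
        using Suc.prems h True by (intro copy_adapted) auto
      show ?thesis using D by measurable
    qed simp
    then have ex: "Measurable.pred (\<F> m t) (\<lambda>\<omega>. \<exists>k. ennreal (real k * h) \<le> t
        \<and> grid_hit h D i \<omega> < ennreal (real k * h) \<and> X (real k * h) (\<omega> (Suc i)) \<in> D)"
      by (rule pred_intros_countable)
    show "Measurable.pred (\<F> m t) (\<lambda>\<omega>. grid_hit h D (Suc i) \<omega> \<le> t)"
      unfolding eq by (cases "t = \<infinity>") (simp_all add: ex)
  qed
qed

definition grid_target :: "real \<Rightarrow> 'e set \<Rightarrow> ('e \<Rightarrow> 'e) \<Rightarrow> nat \<Rightarrow> (nat \<Rightarrow> 'w) \<Rightarrow> 'e" where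
  "grid_target h D sel i \<omega> = sel (X (enn2real (grid_hit h D i \<omega>)) (\<omega> i))"

text \<open>
  The impulse time takes countably many values, so the decision splits into countably many decisions at
  deterministic times; where the time is infinite the value of the target is that for time 0, which is
  harmless because everything is known at \<open>\<infinity>\<close>.
\<close>

lemma grid_target_measurable:
  assumes h: "0 \<le> h" and D: "D \<in> sets borel" and sel: "sel \<in> borel \<rightarrow>\<^sub>M borel" and i: "1 \<le> i"
  shows "grid_target h D sel i \<in> filtration.pre_sigma paths (\<F> i) (grid_hit h D i) \<rightarrow>\<^sub>M borel"
proof (rule measurableI)
  interpret I: filtration paths "\<F> i" by (rule filtration_prod)
  note st = grid_hit_stopping[OF h D order_refl i]
  fix B :: "'e set" assume B: "B \<in> sets borel"
  obtain j where j: "i = Suc j" using i by (cases i) auto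
  have "Measurable.pred (I.pre_sigma (grid_hit h D i)) (\<lambda>\<omega>. grid_target h D sel i \<omega> \<in> B)"
  proof (rule I.pred_pre_sigmaI[OF st])
    fix t
    have Xm: "Measurable.pred (\<F> i t) (\<lambda>\<omega>. sel (X s (\<omega> i)) \<in> B)" if "0 \<le> s" "ennreal s \<le> t" for s
    proof -
      have "(\<lambda>\<omega>. sel (X s (\<omega> i))) \<in> borel_measurable (\<F> i t)"
        using copy_adapted[OF i order_refl that] sel by (rule measurable_compose)
      then show ?thesis using B by measurable
    qed
    have eq_const: "Measurable.pred (\<F> i t) (\<lambda>\<omega>. grid_hit h D i \<omega> = s)" if "s \<le> t" for s
      using I.stopping_time_eq_const[OF st, of s] sets_prod_filtration_mono[OF order_refl that, of i]
      by (auto simp: pred_def space_prod_filtration)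
    have eq: "grid_target h D sel i \<omega> \<in> B \<and> grid_hit h D i \<omega> \<le> t \<longleftrightarrow>
        (t = \<infinity> \<and> grid_hit h D i \<omega> = \<infinity> \<and> sel (X 0 (\<omega> i)) \<in> B) \<or>
        (\<exists>k. ennreal (real k * h) \<le> t \<and> grid_hit h D i \<omega> = ennreal (real k * h) \<and> sel (X (real k * h) (\<omega> i)) \<in> B)" for \<omega>
    proof (cases "grid_hit h D i \<omega> = \<infinity>")
      case True
      then show ?thesis by (auto simp: grid_target_def top_unique)
    next
      case False
      then obtain k where k: "grid_hit h D i \<omega> = ennreal (real k * h)"
        using grid_hit_cases[OF h, of D j \<omega>] unfolding j by blast
      have k0: "0 \<le> real k' * h" for k' using h by simp
      show ?thesis unfolding grid_target_def k using k0
        by (auto simp: enn2real_ennreal)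
    qed
    have "Measurable.pred (\<F> i t) (\<lambda>\<omega>. ennreal (real k * h) \<le> t \<and> grid_hit h D i \<omega> = ennreal (real k * h) \<and> sel (X (real k * h) (\<omega> i)) \<in> B)" for k
    proof (cases "ennreal (real k * h) \<le> t")
      case True
      have 0: "0 \<le> real k * h" using h by simp
      from pred_intros_logic(3)[OF eq_const[OF True] Xm[OF 0 True]] show ?thesis using True by simp
    qed simp
    moreover have "Measurable.pred (\<F> i t) (\<lambda>\<omega>. t = \<infinity> \<and> grid_hit h D i \<omega> = \<infinity> \<and> sel (X 0 (\<omega> i)) \<in> B)"
    proof (cases "t = \<infinity>")
      case True
      have 1: "Measurable.pred (\<F> i t) (\<lambda>\<omega>. grid_hit h D i \<omega> = \<infinity>)" using True by (intro eq_const) simp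
      have 2: "Measurable.pred (\<F> i t) (\<lambda>\<omega>. sel (X 0 (\<omega> i)) \<in> B)" by (rule Xm) auto
      from pred_intros_logic(3)[OF 1 2] show ?thesis using True by simp
    qed simp
    ultimately show "Measurable.pred (\<F> i t) (\<lambda>\<omega>. grid_target h D sel i \<omega> \<in> B \<and> grid_hit h D i \<omega> \<le> t)"
      unfolding eq by (intro pred_intros_logic(5) pred_intros_countable)
  qed
  then show "grid_target h D sel i -` B \<inter> space (I.pre_sigma (grid_hit h D i)) \<in> sets (I.pre_sigma (grid_hit h D i))"
    by (simp add: pred_def vimage_def Int_def conj_commute)
qed simp

lemma grid_strategy:
  assumes h: "0 \<le> h" and D: "D \<in> sets borel" and sel: "sel \<in> borel \<rightarrow>\<^sub>M borel"
  shows "(grid_hit h D, grid_target h D sel) \<in> grid_strategies \<Omega> F h"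
proof -
  have mono: "grid_hit h D i \<omega> \<le> grid_hit h D (Suc i) \<omega>" for i \<omega>
    using grid_hit_cases[OF h, of D i \<omega>] by (auto simp del: grid_hit.simps)
  have "grid_hit h D i \<omega> = \<infinity> \<or> (\<exists>n. grid_hit h D i \<omega> = ennreal (real n * h))" if "1 \<le> i" for i \<omega>
    using that grid_hit_cases[OF h, of D "i - 1" \<omega>] by (auto simp del: grid_hit.simps)
  then show ?thesis
    unfolding grid_strategies_def strategies_def
    using mono grid_hit_stopping[OF h D] grid_target_measurable[OF h D sel]
    by (auto simp del: grid_hit.simps(2))
qed

end

section \<open>An upper bound for threshold strategies\<close>

context discounted_control
begin

lemma impulses_mono: "T \<le> T' \<Longrightarrow> impulses T \<le> impulses T'"
  unfolding impulses_def
  by (intro nn_integral_mono suminf_le summableI) (auto dest: order_trans[OF _ ennreal_leI])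

text \<open>
  A horizon inside a cell is replaced by the right end of the cell: the impulse costs only increase, and
  the other quantities change by at most a constant.
\<close>

lemma average_cost_upper:
  assumes h: "0 < h"
    and le: "\<And>n. cost (real n * h) \<le> ereal (a * mass (real n * h) + C)"
  shows "discounted_average_cost X \<beta> g c M (\<tau>, \<xi>) \<le> ereal a"
proof -
  obtain K where K: "0 \<le> K" "\<And>x. \<bar>g x\<bar> \<le> K" using g_bound by blast
  define C' where "C' = C + \<bar>a\<bar> * h + K * h"
  have le': "cost T \<le> ereal (a * mass T + C')" if T: "0 \<le> T" for T
  proof -
    define n where "n = nat \<lceil>T / h\<rceil>"
    have "T / h \<le> real n" "real n < T / h + 1"
      unfolding n_def using T h by (auto simp: of_nat_nat ceiling_correct) linarith+
    then have n: "T \<le> real n * h" "real n * h \<le> T + h" using h by (auto simp: field_simps)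
    note int = set_integrable_weighted[OF mean_g_measurable mean_g_bound[OF K(2)]]
    have "(LINT s:{0..real n * h}|lborel. \<beta> (max 0 s) * mean_g s)
        = (LINT s:{0..T}|lborel. \<beta> (max 0 s) * mean_g s) + (LINT s:{T..real n * h}|lborel. \<beta> (max 0 s) * mean_g s)"
      by (rule set_integral_split[OF int T n(1)])
    moreover have "\<bar>LINT s:{T..real n * h}|lborel. \<beta> (max 0 s) * mean_g s\<bar> \<le> K * (real n * h - T)"
    proof (rule set_integral_Icc_bound[OF _ _ n(1)])
      show "(\<lambda>s. \<beta> (max 0 s) * mean_g s) \<in> borel_measurable borel"
        using beta_measurable mean_g_measurable by measurable
      show "\<bar>\<beta> (max 0 s) * mean_g s\<bar> \<le> K" for s
        using mult_mono[OF beta_max mean_g_bound[OF K(2)], of s s] by (simp add: abs_mult)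
    qed
    moreover have "K * (real n * h - T) \<le> K * h" using n K by (intro mult_left_mono) auto
    ultimately have r: "(LINT s:{0..T}|lborel. \<beta> (max 0 s) * mean_g s)
        \<le> (LINT s:{0..real n * h}|lborel. \<beta> (max 0 s) * mean_g s) + K * h" by linarith
    have "mass (real n * h) = mass T + (LINT s:{T..real n * h}|lborel. \<beta> (max 0 s) * 1)"
      unfolding mass_eq by (rule set_integral_split[OF set_integrable_weighted[where K=1] T n(1)]) auto
    moreover have "\<bar>LINT s:{T..real n * h}|lborel. \<beta> (max 0 s) * 1\<bar> \<le> 1 * (real n * h - T)"
      using beta_measurable beta_max by (intro set_integral_Icc_bound n) auto
    ultimately have "\<bar>mass (real n * h) - mass T\<bar> \<le> real n * h - T" by simp
    with n have m: "\<bar>mass (real n * h) - mass T\<bar> \<le> h" by linarith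
    have "a * (mass (real n * h) - mass T) \<le> \<bar>a\<bar> * h"
      using mult_mono[OF order_refl m, of "\<bar>a\<bar>"] by (simp add: abs_mult[symmetric])
    then have am: "a * mass (real n * h) \<le> a * mass T + \<bar>a\<bar> * h" by (simp add: right_diff_distrib)
    have "cost T \<le> cost (real n * h) + ereal (K * h)"
    proof -
      have "cost T
          \<le> ereal ((LINT s:{0..real n * h}|lborel. \<beta> (max 0 s) * mean_g s) + K * h) + enn2ereal (impulses (real n * h))"
        unfolding expected_cost_eq using r impulses_mono[OF n(1)]
        by (intro add_mono) (auto simp: less_eq_ennreal.rep_eq)
      also have "\<dots> = cost (real n * h) + ereal (K * h)"
        unfolding expected_cost_eq by (simp add: ac_simps flip: plus_ereal.simps(1))
      finally show ?thesis .
    qed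
    also have "\<dots> \<le> ereal (a * mass (real n * h) + C) + ereal (K * h)"
      by (intro add_right_mono le)
    also have "\<dots> \<le> ereal (a * mass T + C')" using am by (simp add: C'_def)
    finally show ?thesis .
  qed
  have "((\<lambda>T. a + C' / mass T) \<longlongrightarrow> a + 0) at_top"
    by (intro tendsto_intros real_tendsto_divide_at_top[OF tendsto_const mass_at_top])
  then have "((\<lambda>T. ereal (a + C' / mass T)) \<longlongrightarrow> ereal a) at_top" by simp
  then have lim: "Limsup at_top (\<lambda>T. ereal (a + C' / mass T)) = ereal a"
    by (intro lim_imp_Limsup) auto
  have "Limsup at_top (\<lambda>T. cost T / ereal (mass T))
      \<le> Limsup at_top (\<lambda>T. ereal (a + C' / mass T))"
  proof (rule Limsup_mono)
    have "\<forall>\<^sub>F T in at_top. 0 < mass T" using mass_at_top by (auto simp: filterlim_at_top_dense)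
    then show "\<forall>\<^sub>F T in at_top. cost T / ereal (mass T) \<le> ereal (a + C' / mass T)"
      using eventually_ge_at_top[of 0]
    proof eventually_elim
      case (elim T)
      have "cost T / ereal (mass T) \<le> ereal (a * mass T + C') / ereal (mass T)"
        using elim by (intro ereal_divide_right_mono le') auto
      also have "\<dots> = ereal (a + C' / mass T)" using elim by (simp add: add_divide_distrib)
      finally show ?case .
    qed
  qed
  from this[unfolded lim] show ?thesis unfolding discounted_average_cost_def mass_def .
qed

text \<open>
  Along a threshold strategy there is at most one impulse per cell, at its right end, so the running cost
  of a cell is not altered, the Bellman equation holds with near-equality at each step, and the argument for the
  lower bound becomes exact up to \<open>\<eta>\<close> and the selection error \<open>\<eta>'\<close>.  The telescoping lemma is applied to the
  negated quantities.
\<close>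

lemma grid_upper_bound:
  assumes h: "0 < h" and v: "continuous_on UNIV v" and u: "continuous_on UNIV u"
    and bellman: "\<And>x. \<bar>u x - (running_cost h x + transition h v x - \<mu> * h)\<bar> \<le> \<eta>"
    and inside: "\<And>x. x \<in> D \<Longrightarrow> c x (sel x) + u (sel x) \<le> v x + \<eta>'"
    and outside: "\<And>x. x \<notin> D \<Longrightarrow> u x \<le> v x" and \<eta>': "0 \<le> \<eta>'"
    and hit: "\<And>i \<omega>. \<omega> \<in> paths \<Longrightarrow> \<tau> (Suc i) \<omega> = \<infinity> \<or> (\<exists>k. \<tau> (Suc i) \<omega> = ennreal (real k * h)
        \<and> \<tau> i \<omega> < ennreal (real k * h) \<and> X (real k * h) (\<omega> (Suc i)) \<in> D)"
    and first: "\<And>i \<omega> k. \<omega> \<in> paths \<Longrightarrow> \<tau> i \<omega> < ennreal (real k * h) \<Longrightarrow> X (real k * h) (\<omega> (Suc i)) \<in> D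
        \<Longrightarrow> \<tau> (Suc i) \<omega> \<le> ennreal (real k * h)"
    and target: "\<And>i \<omega>. \<omega> \<in> paths \<Longrightarrow> \<xi> (Suc i) \<omega> = sel (X (enn2real (\<tau> (Suc i) \<omega>)) (\<omega> (Suc i)))"
  shows "discounted_average_cost X \<beta> g c M (\<tau>, \<xi>) \<le> ereal (\<mu> + (\<eta> + \<eta>') / h)"
proof -
  have kh: "ennreal (real k * h) < ennreal (real k' * h) \<longleftrightarrow> k < k'" "ennreal (real k * h) \<le> ennreal (real k' * h) \<longleftrightarrow> k \<le> k'" for k k' :: nat
    using h by (auto simp: ennreal_less_iff ennreal_le_iff)
  have tau_lower: "ennreal (real i * h) \<le> \<tau> i \<omega>" if \<omega>: "\<omega> \<in> paths" for i \<omega>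
  proof (induction i)
    case 0 then show ?case by (simp add: tau_0)
  next
    case (Suc i)
    show ?case using hit[OF \<omega>, of i]
    proof
      assume "\<exists>k. \<tau> (Suc i) \<omega> = ennreal (real k * h) \<and> \<tau> i \<omega> < ennreal (real k * h) \<and> X (real k * h) (\<omega> (Suc i)) \<in> D"
      then obtain k where k: "\<tau> (Suc i) \<omega> = ennreal (real k * h)" "\<tau> i \<omega> < ennreal (real k * h)" by blast
      have "i < k" using le_less_trans[OF Suc k(2)] kh by simp
      then show ?thesis unfolding k(1) kh(2) by simp
    qed simp
  qed
  have strict: "\<tau> i \<omega> < \<tau> (Suc i) \<omega>" if "\<omega> \<in> paths" "\<tau> i \<omega> < \<infinity>" for i \<omega>
    using hit[OF that(1), of i] that(2) by auto
  have act: "active t \<omega>" if \<omega>: "\<omega> \<in> paths" for t \<omega>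
  proof -
    obtain i where "t / h < real i" using reals_Archimedean2 by blast
    then have "t < real (Suc i) * h" using h by (simp add: field_simps)
    then have "ennreal t < ennreal (real (Suc i) * h)" using h by (subst ennreal_lessI) auto
    also have "\<dots> \<le> \<tau> (Suc i) \<omega>" by (rule tau_lower[OF \<omega>])
    finally show ?thesis unfolding active_def by blast
  qed
  have act_ae: "AE \<omega> in M. active t \<omega>" for t using act by (intro AE_I2) (simp add: space_M)
  have target_ae: "AE \<omega> in M. \<forall>i. \<tau> (Suc i) \<omega> < \<infinity> \<longrightarrow> X (enn2real (\<tau> (Suc i) \<omega>)) (\<omega> (Suc (Suc i))) = \<xi> (Suc i) \<omega>"
    using law unfolding controlled_law_def by (subst AE_all_countable) auto
  have same_cell: "n_impulses (real j * h + s) \<omega> = n_impulses (real j * h) \<omega>" if \<omega>: "\<omega> \<in> paths" and s: "0 \<le> s" "s < h" for j s \<omega>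
  proof (rule antisym)
    let ?n = "n_impulses (real j * h + s) \<omega>"
    have le: "\<tau> ?n \<omega> \<le> ennreal (real j * h + s)" using tau_le_iff[OF act[OF \<omega>] \<omega>] by simp
    have "\<tau> ?n \<omega> \<le> ennreal (real j * h)"
    proof (cases ?n)
      case 0 then show ?thesis by (simp add: tau_0)
    next
      case (Suc i)
      have "\<tau> (Suc i) \<omega> \<noteq> \<infinity>" using le unfolding Suc by (auto simp: top_unique)
      then obtain k where k: "\<tau> (Suc i) \<omega> = ennreal (real k * h)" using hit[OF \<omega>, of i] by blast
      have "real k * h \<le> real j * h + s" using le h s unfolding Suc k by (subst (asm) ennreal_le_iff) auto
      also have "\<dots> < real (Suc j) * h" using s by (simp add: algebra_simps)
      finally have "k < Suc j" using h by (simp add: mult_less_cancel_right_pos)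
      then show ?thesis unfolding Suc k kh(2) by simp
    qed
    then show "?n \<le> n_impulses (real j * h) \<omega>" using tau_le_iff[OF act[OF \<omega>] \<omega>] by simp
    show "n_impulses (real j * h) \<omega> \<le> ?n" using s by (intro n_impulses_mono act \<omega>) auto
  qed
  obtain Kg where Kg: "0 \<le> Kg" "\<And>x. \<bar>g x\<bar> \<le> Kg" using g_bound by blast
  obtain Ku where Ku: "0 \<le> Ku" "\<And>x. \<bar>u x\<bar> \<le> Ku" using continuous_bounded[OF u] by blast
  obtain Kc where Kc: "0 < Kc" "\<And>x \<xi>. c x \<xi> \<le> Kc" using c_bounded by blast
  define a where "a j = (LINT \<omega>|M. u (state (real j * h) \<omega>))" for j
  define S where "S j = enn2real (impulses_between (real j * h) (real (Suc j) * h))" for j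
  have S0: "0 \<le> S j" for j by (simp add: S_def)
  have main: "impulses_between (real j * h) (real (Suc j) * h) = ennreal (S j) \<and>
      a (Suc j) + S j - \<eta>' \<le> (LINT \<omega>|M. v (uninterrupted (real j * h) h \<omega>))" for j
  proof -
    let ?t = "real j * h" and ?t' = "real (Suc j) * h"
    have tt': "?t \<le> ?t'" "0 \<le> ?t" "0 \<le> ?t'" "?t + h = ?t'" using h by (auto simp: algebra_simps)
    define R where "R \<omega> = (\<Sum>k. indicator (impulse_in ?t ?t' (Suc k)) \<omega> * ennreal (impulse_cost (Suc k) \<omega>))" for \<omega>
    have Rm [measurable]: "R \<in> borel_measurable M" unfolding R_def by measurable
    \<comment> \<open>\<open>R\<close> is the impulse cost of the cell, at most one summand\<close>
    have key: "AE \<omega> in M. R \<omega> \<le> ennreal Kc \<and> u (state ?t' \<omega>) + enn2real (R \<omega>) - \<eta>' \<le> v (uninterrupted ?t h \<omega>)"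
      using target_ae AE_space
    proof eventually_elim
      case (elim \<omega>)
      then have \<omega>: "\<omega> \<in> paths" by (simp add: space_M)
      define i where "i = n_impulses ?t \<omega>"
      define Z where "Z = X ?t' (\<omega> (Suc i))"
      have Zu: "uninterrupted ?t h \<omega> = Z" by (simp add: uninterrupted_def Z_def i_def tt'(4))
      have i1: "\<tau> i \<omega> \<le> ennreal ?t" "ennreal ?t < \<tau> (Suc i) \<omega>"
        using tau_le_iff[OF act[OF \<omega>] \<omega>, of i ?t] n_impulses_less[OF act[OF \<omega>], of ?t] by (auto simp: i_def)
      have lt: "\<tau> i \<omega> < ennreal ?t'" by (rule le_less_trans[OF i1(1)]) (simp add: kh del: of_nat_Suc)
      have R: "R \<omega> = ennreal (\<Sum>k\<in>{i..<n_impulses ?t' \<omega>}. impulse_cost (Suc k) \<omega>)"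
        unfolding R_def i_def by (rule sum_impulses_between[OF \<omega> act[OF \<omega>] tt'(1) impulse_cost_bounds(2)])
      show ?case
      proof (cases "Z \<in> D")
        case True
        have le: "\<tau> (Suc i) \<omega> \<le> ennreal ?t'" using first[OF \<omega> lt] True by (simp add: Z_def)
        then have "\<tau> (Suc i) \<omega> \<noteq> \<infinity>" by (auto simp: top_unique)
        then obtain k where k: "\<tau> (Suc i) \<omega> = ennreal (real k * h)" using hit[OF \<omega>, of i] by blast
        have "k = Suc j" using le i1(2) unfolding k kh by simp
        then have \<tau>: "\<tau> (Suc i) \<omega> = ennreal ?t'" using k by simp
        have n_impulses': "n_impulses ?t' \<omega> = Suc i"
        proof (rule antisym)
          have "\<not> \<tau> (Suc (Suc i)) \<omega> \<le> ennreal ?t'" using strict[OF \<omega>, of "Suc i"] unfolding \<tau> by simp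
          then show "n_impulses ?t' \<omega> \<le> Suc i" using tau_le_iff[OF act[OF \<omega>] \<omega>, of "Suc (Suc i)" ?t'] by simp
          show "Suc i \<le> n_impulses ?t' \<omega>" using tau_le_iff[OF act[OF \<omega>] \<omega>, of "Suc i" ?t'] \<tau> by simp
        qed
        have \<tau>r: "enn2real (\<tau> (Suc i) \<omega>) = ?t'" unfolding \<tau> using tt'(3) by (rule enn2real_ennreal)
        have "X ?t' (\<omega> (Suc (Suc i))) = \<xi> (Suc i) \<omega>" using elim(1)[rule_format, of i] \<tau>r by (simp add: \<tau>)
        also have "\<dots> = sel Z" using target[OF \<omega>, of i] unfolding \<tau>r by (simp add: Z_def)
        finally have st: "X ?t' (\<omega> (Suc (Suc i))) = sel Z" .
        have "impulse_cost (Suc i) \<omega> = c Z (sel Z)" unfolding impulse_cost_def \<tau>r st Z_def ..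
        then have "R \<omega> = ennreal (c Z (sel Z))" unfolding R n_impulses' by simp
        moreover have "state ?t' \<omega> = sel Z" unfolding state_def n_impulses' st ..
        ultimately show ?thesis unfolding Zu using inside[OF True] Kc c_nonneg by (simp add: ennreal_leI)
      next
        case False
        have "\<not> \<tau> (Suc i) \<omega> \<le> ennreal ?t'"
        proof
          assume le: "\<tau> (Suc i) \<omega> \<le> ennreal ?t'"
          then have "\<tau> (Suc i) \<omega> \<noteq> \<infinity>" by (auto simp: top_unique)
          then obtain k where k: "\<tau> (Suc i) \<omega> = ennreal (real k * h)" "X (real k * h) (\<omega> (Suc i)) \<in> D"
            using hit[OF \<omega>, of i] by blast
          have "k = Suc j" using le i1(2) unfolding k kh by simp
          then show False using k(2) False by (simp add: Z_def)
        qed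
        then have "n_impulses ?t' \<omega> \<le> i" using tau_le_iff[OF act[OF \<omega>] \<omega>, of "Suc i" ?t'] by simp
        moreover have "i \<le> n_impulses ?t' \<omega>" unfolding i_def using tt'(1) by (intro n_impulses_mono act \<omega>)
        ultimately have n_impulses': "n_impulses ?t' \<omega> = i" by simp
        have "state ?t' \<omega> = Z" unfolding state_def n_impulses' Z_def ..
        then show ?thesis unfolding Zu R n_impulses' using outside[OF False] \<eta>' by simp
      qed
    qed
    have SR: "impulses_between ?t ?t' = (\<integral>\<^sup>+ \<omega>. R \<omega> \<partial>M)" unfolding impulses_between_def R_def ..
    have "(\<integral>\<^sup>+ \<omega>. R \<omega> \<partial>M) \<le> (\<integral>\<^sup>+ \<omega>. ennreal Kc \<partial>M)" using key by (intro nn_integral_mono_AE) auto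
    also have "\<dots> < \<infinity>" by (simp add: M.emeasure_space_1)
    finally have fin: "(\<integral>\<^sup>+ \<omega>. R \<omega> \<partial>M) < \<infinity>" .
    have eq: "(\<integral>\<^sup>+ \<omega>. ennreal (enn2real (R \<omega>)) \<partial>M) = (\<integral>\<^sup>+ \<omega>. R \<omega> \<partial>M)"
    proof (rule nn_integral_cong_AE)
      show "AE \<omega> in M. ennreal (enn2real (R \<omega>)) = R \<omega>"
        using key
      proof eventually_elim
        case (elim \<omega>)
        then have "R \<omega> < top" using le_less_trans[OF _ ennreal_less_top] by blast
        then show ?case by simp
      qed
    qed
    have iR: "integrable M (\<lambda>\<omega>. enn2real (R \<omega>))"
      using fin eq by (intro integrableI_nonneg) auto
    have LR: "(LINT \<omega>|M. enn2real (R \<omega>)) = S j"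
      by (subst integral_eq_nn_integral) (auto simp: eq S_def SR simp del: of_nat_Suc)
    have iu: "integrable M (\<lambda>\<omega>. u (state ?t' \<omega>))" by (rule state_integrable[OF u tt'(3)])
    have iv: "integrable M (\<lambda>\<omega>. v (uninterrupted ?t h \<omega>))" by (rule uninterrupted_integrable[OF v tt'(2) less_imp_le[OF h]])
    have "(LINT \<omega>|M. u (state ?t' \<omega>) + enn2real (R \<omega>) - \<eta>') \<le> (LINT \<omega>|M. v (uninterrupted ?t h \<omega>))"
      using key iu iR iv by (intro integral_mono_AE) auto
    also have "(LINT \<omega>|M. u (state ?t' \<omega>) + enn2real (R \<omega>) - \<eta>') = a (Suc j) + S j - \<eta>'"
      using iu iR by (simp add: M.prob_space LR a_def)
    finally show ?thesis using fin unfolding S_def SR by simp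
  qed
  define \<theta> where "\<theta> = \<mu> * h + \<eta> + \<eta>'"
  define C where "C = 2 * Ku + Kg * h"
  have bpos: "0 \<le> \<beta> (real j * h)" for j using beta_range[of "real j * h"] h by simp
  have "cost (real n * h) \<le> ereal ((\<theta> / h) * mass (real n * h) + (\<bar>\<theta>\<bar> + C))" for n
  proof -
    let ?G = "LINT s:{0..real n * h}|lborel. \<beta> (max 0 s) * mean_g s"
    let ?b = "\<Sum>j<n. \<beta> (real j * h)" and ?s = "\<Sum>j<n. \<beta> (real j * h) * S j"
    have "(- \<theta>) * ?b \<le> (LINT s:{0..real n * h}|lborel. \<beta> (max 0 s) * (- mean_g s))
        + (\<Sum>j<n. \<beta> (real j * h) * (- S j)) + (2 * Ku + Kg * h)"
    proof (rule discounted_telescope[OF h, where a="\<lambda>j. - a j"])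
      show "(\<lambda>s. - mean_g s) \<in> borel_measurable borel" using mean_g_measurable by measurable
      show "\<bar>- mean_g s\<bar> \<le> Kg" for s using mean_g_bound[OF Kg(2)] by simp
      show "\<bar>- a j\<bar> \<le> Ku" for j using expected_state_bound[OF u Ku(2), of "real j * h"] h by (simp add: a_def)
      fix j assume "j < n"
      let ?t = "real j * h"
      have t: "0 \<le> ?t" and th: "?t + h = real (Suc j) * h" using h by (auto simp: algebra_simps)
      have "\<bar>(LINT \<omega>|M. running_cost h (state ?t \<omega>)) - (LINT s:{?t..?t + h}|lborel. mean_g s)\<bar> \<le> 0 * h"
      proof (rule running_step[OF t h act_ae])
        fix s assume s: "0 \<le> s" "s < h"
        have none: "{\<omega> \<in> space M. n_impulses ?t \<omega> \<noteq> n_impulses (?t + s) \<omega>} = {}" using same_cell[OF _ s] by (auto simp: space_M)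
        show "\<bar>(LINT \<omega>|M. g (uninterrupted ?t s \<omega>)) - mean_g (?t + s)\<bar> \<le> 0"
          using mean_g_gap[OF t s(1) act_ae Kg(2)] unfolding none by simp
      qed
      then have "(LINT \<omega>|M. running_cost h (state ?t \<omega>)) = (LINT s:{?t..real (Suc j) * h}|lborel. mean_g s)"
        unfolding th by simp
      then have "a (Suc j) + S j + (LINT s:{?t..real (Suc j) * h}|lborel. mean_g s) - \<theta> \<le> a j"
        using expected_bellman_step[OF u v t h act_ae bellman] main[of j] unfolding a_def[of j] \<theta>_def
        by (simp add: abs_le_iff)
      moreover have "(LINT s:{?t..real (Suc j) * h}|lborel. - mean_g s) = - (LINT s:{?t..real (Suc j) * h}|lborel. mean_g s)"
        by (simp add: set_lebesgue_integral_def)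
      ultimately show "- a j - - a (Suc j) \<le> (LINT s:{?t..real (Suc j) * h}|lborel. - mean_g s) + - S j - - \<theta>"
        by linarith
    qed
    moreover have "(LINT s:{0..real n * h}|lborel. \<beta> (max 0 s) * (- mean_g s)) = - ?G"
      by (simp add: set_lebesgue_integral_def)
    moreover have "(\<Sum>j<n. \<beta> (real j * h) * (- S j)) = - ?s" by (simp add: sum_negf)
    ultimately have Gs: "?G + ?s \<le> \<theta> * ?b + C" unfolding C_def by simp
    have "\<theta> * ?b - (\<theta> / h) * mass (real n * h) = (\<theta> / h) * (h * ?b - mass (real n * h))"
      using h by (simp add: right_diff_distrib)
    also have "\<dots> \<le> \<bar>\<theta> / h\<bar> * \<bar>h * ?b - mass (real n * h)\<bar>" unfolding abs_mult[symmetric] by (rule abs_ge_self)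
    also have "\<dots> \<le> \<bar>\<theta> / h\<bar> * h" by (intro mult_left_mono mass_grid[OF h]) auto
    also have "\<dots> = \<bar>\<theta>\<bar>" using h by (simp add: abs_divide)
    finally have Gs': "?G + ?s \<le> (\<theta> / h) * mass (real n * h) + (\<bar>\<theta>\<bar> + C)" using Gs by linarith
    have "impulses (real n * h) \<le> (\<Sum>j<n. ennreal (\<beta> (real j * h)) * impulses_between (real j * h) (real (Suc j) * h))"
    proof (rule impulses_le[OF h])
      show "0 < \<tau> (Suc k) \<omega>" if "\<omega> \<in> paths" for k \<omega>
        using tau_lower[OF that, of "Suc k"] h by (intro less_le_trans[OF _ tau_lower[OF that, of "Suc k"]]) simp
    qed
    also have "\<dots> = (\<Sum>j<n. ennreal (\<beta> (real j * h) * S j))"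
      using main bpos S0 by (simp add: ennreal_mult del: of_nat_Suc)
    also have "\<dots> = ennreal ?s" using bpos S0 by (intro sum_ennreal) auto
    finally have "enn2ereal (impulses (real n * h)) \<le> ereal ?s"
      using bpos S0 by (simp add: less_eq_ennreal.rep_eq enn2ereal_ennreal sum_nonneg)
    then have "cost (real n * h) \<le> ereal ?G + ereal ?s"
      unfolding expected_cost_eq by (intro add_left_mono)
    also have "\<dots> \<le> ereal ((\<theta> / h) * mass (real n * h) + (\<bar>\<theta>\<bar> + C))" using Gs' by simp
    finally show ?thesis .
  qed
  from average_cost_upper[OF h this]
  have "discounted_average_cost X \<beta> g c M (\<tau>, \<xi>) \<le> ereal (\<theta> / h)" .
  moreover have "\<theta> / h = \<mu> + (\<eta> + \<eta>') / h" using h by (simp add: \<theta>_def add_divide_distrib)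
  ultimately show ?thesis by simp
qed

end

section \<open>Convergence of the values\<close>

locale control_problem = impulse_problem \<Omega> F X P g c c\<^sub>0 + discount \<beta>
  for \<Omega> :: "'w set" and F :: "ennreal \<Rightarrow> 'w measure"
    and X :: "real \<Rightarrow> 'w \<Rightarrow> 'e::polish_space" and P :: "'e \<Rightarrow> 'w measure"
    and g :: "'e \<Rightarrow> real" and c :: "'e \<Rightarrow> 'e \<Rightarrow> real" and c\<^sub>0 :: real and \<beta> :: "real \<Rightarrow> real" +
  fixes PV :: "'e \<Rightarrow> ('w, 'e) strategy \<Rightarrow> (nat \<Rightarrow> 'w) measure"
  assumes PV: "\<And>x V. V \<in> strategies \<Omega> F \<Longrightarrow> controlled_law \<Omega> F X P x V (PV x V)"
begin

abbreviation J :: "'e \<Rightarrow> ('w, 'e) strategy \<Rightarrow> ereal" where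
  "J x V \<equiv> discounted_average_cost X \<beta> g c (PV x V) V"

lemma grid_subset: "grid_strategies \<Omega> F h \<subseteq> strategies \<Omega> F"
  by (auto simp: grid_strategies_def)

lemma discounted_controlI:
  "(\<tau>, \<xi>) \<in> strategies \<Omega> F \<Longrightarrow> discounted_control \<Omega> F X P g c c\<^sub>0 x \<tau> \<xi> (PV x (\<tau>, \<xi>)) \<beta>"
  by (intro discounted_control.intro controlled.intro controlled_axioms.intro
      impulse_problem_axioms discount_axioms PV) auto

lemma grid_strategy_achieves:
  assumes h: "0 < h" and \<eta>: "0 < \<eta>" and v: "continuous_on UNIV v" and u: "continuous_on UNIV u"
    and min: "\<And>x. v x = min (u x) (intervene u x)"
    and bellman: "\<And>x. \<bar>u x - (running_cost h x + transition h v x - \<mu> * h)\<bar> \<le> \<eta>"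
  shows "\<exists>V\<in>grid_strategies \<Omega> F h. J x V \<le> ereal (\<mu> + 2 * \<eta> / h)"
proof -
  define D where "D = {y. intervene u y < u y}"
  have "open D" unfolding D_def using u intervene_continuous[OF u] by (intro open_Collect_less)
  then have D: "D \<in> sets borel" by simp
  obtain sel where sel: "sel \<in> borel \<rightarrow>\<^sub>M borel" "\<And>y. c y (sel y) + u (sel y) \<le> intervene u y + \<eta>"
    using measurable_near_minimizer[OF u \<eta>] by blast
  let ?\<tau> = "grid_hit h D" and ?\<xi> = "grid_target h D sel"
  have V: "(?\<tau>, ?\<xi>) \<in> grid_strategies \<Omega> F h" using h by (intro grid_strategy D sel) simp
  interpret V: discounted_control \<Omega> F X P g c c\<^sub>0 x ?\<tau> ?\<xi> "PV x (?\<tau>, ?\<xi>)" \<beta>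
    using V grid_subset by (intro discounted_controlI) blast
  have "J x (?\<tau>, ?\<xi>) \<le> ereal (\<mu> + (\<eta> + \<eta>) / h)"
  proof (rule V.grid_upper_bound[OF h v u bellman, where sel=sel and D=D])
    show "c y (sel y) + u (sel y) \<le> v y + \<eta>" if "y \<in> D" for y
      using sel(2)[of y] that by (simp add: min D_def)
    show "u y \<le> v y" if "y \<notin> D" for y using that by (simp add: min D_def)
    show "?\<tau> (Suc i) \<omega> = \<infinity> \<or> (\<exists>k. ?\<tau> (Suc i) \<omega> = ennreal (real k * h)
        \<and> ?\<tau> i \<omega> < ennreal (real k * h) \<and> X (real k * h) (\<omega> (Suc i)) \<in> D)" for i \<omega>
      using h by (intro grid_hit_cases) simp
    show "?\<tau> (Suc i) \<omega> \<le> ennreal (real k * h)"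
      if "?\<tau> i \<omega> < ennreal (real k * h)" "X (real k * h) (\<omega> (Suc i)) \<in> D" for i \<omega> k
      using that by (rule grid_hit_le)
    show "?\<xi> (Suc i) \<omega> = sel (X (enn2real (?\<tau> (Suc i) \<omega>)) (\<omega> (Suc i)))" for i \<omega>
      by (simp only: grid_target_def)
  qed (use \<eta> in simp)
  then show ?thesis using V by auto
qed

lemma average_cost_lower_bound:
  assumes h: "0 < h" and v: "continuous_on UNIV v" and u: "continuous_on UNIV u"
    and min: "\<And>x. v x = min (u x) (intervene u x)" and tri: "\<And>x \<xi>. v x \<le> c x \<xi> + v \<xi>"
    and bellman: "\<And>x. \<bar>u x - (running_cost h x + transition h v x - \<mu> * h)\<bar> \<le> \<eta>"
    and Kg: "\<And>x. \<bar>g x\<bar> \<le> Kg"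
    and disp: "\<And>r y. 0 \<le> r \<Longrightarrow> r \<le> h \<Longrightarrow> transition r (\<lambda>z. dist z y) y \<le> \<epsilon>"
    and cmod: "0 \<le> L" "\<And>x \<xi> x' \<xi>'. \<bar>c x \<xi> - c x' \<xi>'\<bar> \<le> e + L * (dist x x' + dist \<xi> \<xi>')"
    and \<kappa>: "0 \<le> \<kappa>" "e + 2 * L * \<epsilon> \<le> \<kappa> * c\<^sub>0"
    and V: "V \<in> strategies \<Omega> F"
  defines "q \<equiv> \<beta> h / (1 + \<kappa> + 2 * Kg * h / c\<^sub>0)"
  shows "ereal (q * (\<mu> - \<eta> / h) - (1 - q) * Kg) \<le> J x V"
proof -
  obtain \<tau> \<xi> where V_eq: "V = (\<tau>, \<xi>)" by (cases V)
  interpret V: discounted_control \<Omega> F X P g c c\<^sub>0 x \<tau> \<xi> "PV x (\<tau>, \<xi>)" \<beta>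
    using V unfolding V_eq by (rule discounted_controlI)
  obtain Kv where Kv: "\<And>x. \<bar>v x\<bar> \<le> Kv" using continuous_bounded[OF v] by metis
  have vu: "v y \<le> u y" for y by (simp add: min)
  have delay: "(LINT \<omega>|PV x (\<tau>, \<xi>). indicator (V.impulse_in a (a + h) l) \<omega> * c (X (a + h) (\<omega> l)) (X (a + h) (\<omega> (Suc l))))
      \<le> (LINT \<omega>|PV x (\<tau>, \<xi>). indicator (V.impulse_in a (a + h) l) \<omega> * V.impulse_cost l \<omega>)
        + \<kappa> * c\<^sub>0 * measure (PV x (\<tau>, \<xi>)) (V.impulse_in a (a + h) l)" if "1 \<le> l" "0 \<le> a" for l a
  proof -
    have "(e + 2 * L * \<epsilon>) * measure (PV x (\<tau>, \<xi>)) (V.impulse_in a (a + h) l)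
        \<le> \<kappa> * c\<^sub>0 * measure (PV x (\<tau>, \<xi>)) (V.impulse_in a (a + h) l)"
      using \<kappa>(2) by (intro mult_right_mono) auto
    then show ?thesis
      using V.delayed_impulse_cost[where h=h, OF disp cmod that, of "a + h"] h by simp
  qed
  show ?thesis
    unfolding V_eq q_def
    by (rule V.average_cost_lower[OF h V.lower_bound_grid[OF h v Kv u vu tri bellman Kg \<kappa>(1) delay]])
qed

text \<open>
  For a given \<open>h\<close> the Bellman equation is solved with error \<open>\<eta> = h\<^sup>2\<close>, that is, \<open>h\<close> per unit of time.  The
  upper bound is then \<open>\<mu> + 2 h\<close>, and the lower bound loses \<open>h\<close> and the factor \<open>q(h)\<close>.  As \<open>h\<close> tends to 0,
  \<open>q(h)\<close> tends to \<open>1/(1 + \<kappa>)\<close>, where \<open>\<kappa>\<close> is chosen small beforehand.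
\<close>

lemma discretization_error:
  assumes \<epsilon>: "0 < \<epsilon>"
  shows "\<forall>\<^sub>F h in at_right 0. \<exists>m. \<forall>x. (INF V\<in>grid_strategies \<Omega> F h. J x V) \<le> ereal m
      \<and> ereal (m - \<epsilon>) \<le> (INF V\<in>strategies \<Omega> F. J x V)"
proof -
  obtain Kg where Kg: "0 \<le> Kg" "\<And>x. \<bar>g x\<bar> \<le> Kg" using g_bound by blast
  \<comment> \<open>the relative error admitted for the impulse costs\<close>
  define \<kappa> where "\<kappa> = \<epsilon> / (4 * (Kg + 1))"
  have \<kappa>: "0 < \<kappa>" using \<epsilon> Kg(1) by (simp add: \<kappa>_def)
  have "2 * Kg * \<kappa> \<le> 2 * (Kg + 1) * \<kappa>" using \<kappa> by (intro mult_right_mono) auto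
  also have "\<dots> = \<epsilon> / 2" using Kg(1) by (simp add: \<kappa>_def field_simps)
  finally have K\<kappa>: "2 * Kg * \<kappa> \<le> \<epsilon> / 2" .
  \<comment> \<open>half of \<open>\<kappa> c\<^sub>0\<close> for the modulus of \<open>c\<close>, the other half for the displacements\<close>
  define e where "e = \<kappa> * c\<^sub>0 / 2"
  have e: "0 < e" using \<kappa> c0(1) by (simp add: e_def)
  obtain L where L: "0 \<le> L" "\<And>x \<xi> x' \<xi>'. \<bar>c x \<xi> - c x' \<xi>'\<bar> \<le> e + L * (dist x x' + dist \<xi> \<xi>')"
    using c_modulus[OF e] by blast
  define \<delta> where "\<delta> = e / (2 * (L + 1))"
  have \<delta>: "0 < \<delta>" using e L(1) by (simp add: \<delta>_def)
  have "2 * L * \<delta> \<le> 2 * (L + 1) * \<delta>" using \<delta> by (intro mult_right_mono) auto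
  also have "\<dots> = e" using L(1) by (simp add: \<delta>_def field_simps)
  finally have eL: "e + 2 * L * \<delta> \<le> \<kappa> * c\<^sub>0" by (simp add: e_def)
  obtain h0 where h0: "h0 > 0" "\<And>r y. 0 \<le> r \<Longrightarrow> r \<le> h0 \<Longrightarrow> transition r (\<lambda>z. dist z y) y \<le> \<delta>"
    using uniform_stochastic_continuity[OF \<delta>] by blast
  define q where "q h = \<beta> h / (1 + \<kappa> + 2 * Kg * h / c\<^sub>0)" for h
  have "(\<beta> \<longlongrightarrow> \<beta> 0) (at 0 within {0..})" using beta_continuous by (simp add: continuous_on_def)
  then have b: "(\<beta> \<longlongrightarrow> 1) (at_right 0)" by (simp add: at_within_Ici_at_right beta_0)
  have id0: "((\<lambda>h::real. h) \<longlongrightarrow> 0) (at_right 0)" by (rule tendsto_ident_at)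
  have "(q \<longlongrightarrow> 1 / (1 + \<kappa> + 2 * Kg * 0 / c\<^sub>0)) (at_right 0)"
    unfolding q_def using b id0 \<kappa> c0(1) by (intro tendsto_intros) auto
  then have "((\<lambda>h. 3 * h + 2 * (1 - q h) * Kg) \<longlongrightarrow> 3 * 0 + 2 * (1 - 1 / (1 + \<kappa> + 2 * Kg * 0 / c\<^sub>0)) * Kg) (at_right 0)"
    using id0 by (intro tendsto_intros) auto
  moreover have "3 * 0 + 2 * (1 - 1 / (1 + \<kappa> + 2 * Kg * 0 / c\<^sub>0)) * Kg < \<epsilon>"
  proof -
    have "1 - 1 / (1 + \<kappa>) = \<kappa> / (1 + \<kappa>)" using \<kappa> by (simp add: field_simps)
    also have "\<dots> \<le> \<kappa>" using \<kappa> by (simp add: divide_le_eq)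
    finally have "2 * Kg * (1 - 1 / (1 + \<kappa>)) \<le> 2 * Kg * \<kappa>" using Kg(1) by (intro mult_left_mono) auto
    then show ?thesis using K\<kappa> \<epsilon> by (simp add: mult_ac)
  qed
  ultimately have "\<forall>\<^sub>F h in at_right 0. 3 * h + 2 * (1 - q h) * Kg < \<epsilon>" by (rule order_tendstoD(2))
  moreover have "\<forall>\<^sub>F h in at_right 0. h < h0" using order_tendstoD(2)[OF id0 h0(1)] .
  moreover have "\<forall>\<^sub>F h::real in at_right 0. 0 < h" by (rule eventually_at_right_less)
  ultimately show ?thesis
  proof eventually_elim
    case (elim h)
    then have h: "0 < h" "h < h0" by auto
    have \<eta>: "0 < h * h" using h by simp
    obtain v u \<mu> where b: "continuous_on UNIV v" "continuous_on UNIV u"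
      "\<And>x. v x = min (u x) (intervene u x)" "\<And>x \<xi>. v x \<le> c x \<xi> + v \<xi>"
      "\<And>x. \<bar>u x - (running_cost h x + transition h v x - \<mu> * h)\<bar> \<le> h * h" "\<bar>\<mu>\<bar> \<le> Kg"
      using approximate_bellman[OF h(1) \<eta> Kg(2)] by metis
    have bh: "0 < \<beta> h" "\<beta> h \<le> 1" using beta_range[of h] h by auto
    have q: "q h \<le> 1"
    proof -
      have "0 \<le> 2 * Kg * h / c\<^sub>0" using Kg(1) h c0(1) by simp
      then have "1 \<le> 1 + \<kappa> + 2 * Kg * h / c\<^sub>0" using \<kappa> by simp
      then show ?thesis unfolding q_def using bh by (simp add: divide_le_eq_1)
    qed
    have up: "\<exists>V\<in>grid_strategies \<Omega> F h. J x V \<le> ereal (\<mu> + 2 * h)" for x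
      using grid_strategy_achieves[OF h(1) \<eta> b(1,2,3,5), of x] h by simp
    have lo: "ereal (\<mu> + 2 * h - \<epsilon>) \<le> J x V" if "V \<in> strategies \<Omega> F" for x V
    proof -
      have "ereal (q h * (\<mu> - h * h / h) - (1 - q h) * Kg) \<le> J x V"
        unfolding q_def
      proof (rule average_cost_lower_bound[OF h(1) b(1-5) Kg(2) _ L _ eL that])
        show "transition r (\<lambda>z. dist z y) y \<le> \<delta>" if "0 \<le> r" "r \<le> h" for r y
          using h0(2) that h by simp
      qed (use \<kappa> in simp)
      moreover have "\<mu> + 2 * h - \<epsilon> \<le> q h * (\<mu> - h) - (1 - q h) * Kg"
      proof -
        have "(1 - q h) * (\<mu> - h) \<le> (1 - q h) * Kg" using q b(6) h by (intro mult_left_mono) auto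
        then show ?thesis using elim(1) by (simp add: algebra_simps)
      qed
      ultimately show ?thesis using h by (simp add: order_trans[rotated])
    qed
    show ?case
    proof (intro exI[of _ "\<mu> + 2 * h"] allI conjI)
      fix x
      show "(INF V\<in>grid_strategies \<Omega> F h. J x V) \<le> ereal (\<mu> + 2 * h)"
        using up[of x] by (auto intro: INF_lower2)
      show "ereal (\<mu> + 2 * h - \<epsilon>) \<le> (INF V\<in>strategies \<Omega> F. J x V)"
        using lo by (intro INF_greatest)
    qed
  qed
qed

text \<open>
  The error bound first shows that the value is finite, and then that the grid values are squeezed
  between the value and the value plus any positive number.
\<close>

lemma grid_values_converge:
  "((\<lambda>h. INF V\<in>grid_strategies \<Omega> F h. J x V) \<longlongrightarrow> (INF V\<in>strategies \<Omega> F. J x V)) (at_right 0)"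
proof -
  let ?I = "INF V\<in>strategies \<Omega> F. J x V" and ?Ih = "\<lambda>h. INF V\<in>grid_strategies \<Omega> F h. J x V"
  have le: "?I \<le> ?Ih h" for h using grid_subset by (intro INF_superset_mono) auto
  have ne: "at_right (0::real) \<noteq> bot" by simp
  have "\<exists>h. \<exists>m. \<forall>x. (INF V\<in>grid_strategies \<Omega> F h. J x V) \<le> ereal m \<and> ereal (m - 1) \<le> (INF V\<in>strategies \<Omega> F. J x V)"
    using eventually_happens'[OF ne discretization_error[of 1]] by simp
  then obtain h m where m: "?Ih h \<le> ereal m" "ereal (m - 1) \<le> ?I" by blast
  have "?I \<le> ereal m" using le m(1) by (rule order_trans)
  with m(2) obtain i where i: "?I = ereal i" by (cases ?I) auto
  show ?thesis
  proof (rule order_tendstoI)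
    fix a assume "a < ?I"
    then show "\<forall>\<^sub>F h in at_right 0. a < ?Ih h" using le by (intro always_eventually allI) (rule less_le_trans)
  next
    fix a assume "?I < a"
    then obtain r where r: "i < r" "ereal r < a" using ereal_dense2[of ?I a] unfolding i by auto
    then have "0 < r - i" by simp
    from discretization_error[OF this] show "\<forall>\<^sub>F h in at_right 0. ?Ih h < a"
    proof eventually_elim
      case (elim h)
      then obtain m where m: "?Ih h \<le> ereal m" "ereal (m - (r - i)) \<le> ?I" by blast
      then have "m \<le> r" unfolding i by simp
      then have "ereal m \<le> ereal r" by simp
      then show ?case using m(1) r(2) by (meson le_less_trans order_trans)
    qed
  qed
qed

end

theorem theorem4p4:
  fixes \<Omega> :: "'w set" and F :: "ennreal \<Rightarrow> 'w measure"
    and X :: "real \<Rightarrow> 'w \<Rightarrow> 'e::polish_space" and P :: "'e \<Rightarrow> 'w measure"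
    and \<beta> :: "real \<Rightarrow> real" and g :: "'e \<Rightarrow> real" and c :: "'e \<Rightarrow> 'e \<Rightarrow> real" and c\<^sub>0 :: real
    and PV :: "'e \<Rightarrow> ('w, 'e) strategy \<Rightarrow> (nat \<Rightarrow> 'w) measure"
    and x :: 'e
  assumes compact_E: "compact (UNIV :: 'e set)"
    and process: "standard_process \<Omega> F X P"
    and beta_range: "\<And>t. 0 \<le> t \<Longrightarrow> 0 < \<beta> t \<and> \<beta> t \<le> 1"
    and beta_decreasing: "\<And>s t. 0 \<le> s \<Longrightarrow> s \<le> t \<Longrightarrow> \<beta> t \<le> \<beta> s"
    and beta_continuous: "continuous_on {0..} \<beta>"
    and beta_0: "\<beta> 0 = 1"
    and beta_supermult: "\<And>s t. 0 \<le> s \<Longrightarrow> 0 \<le> t \<Longrightarrow> \<beta> t * \<beta> s \<le> \<beta> (t + s)"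
    and beta_integral: "(\<integral>\<^sup>+ s\<in>{0..}. ennreal (\<beta> s) \<partial>lborel) = \<infinity>"
    and g: "g \<in> bcontfun"
    and c: "(\<lambda>(x, \<xi>). c x \<xi>) \<in> bcontfun"
    and c0: "0 < c\<^sub>0" "\<And>x \<xi>. c\<^sub>0 \<le> c x \<xi>"
    and c_triangle: "\<And>x \<xi> \<eta>. c x \<xi> \<le> c x \<eta> + c \<eta> \<xi>"
    and feller: "\<And>f t. (f :: 'e \<Rightarrow> real) \<in> bcontfun \<Longrightarrow> 0 < t \<Longrightarrow>
      (\<lambda>x. LINT \<omega>|P x. f (X t \<omega>)) \<in> bcontfun"
    and ergodic: "\<And>t. 0 < t \<Longrightarrow> \<exists>\<Lambda>. 0 < \<Lambda> \<and> \<Lambda> < 1 \<and>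
      (\<forall>x y. \<forall>A\<in>sets borel. \<bar>trans_prob X P t x A - trans_prob X P t y A\<bar> \<le> \<Lambda>)"
    and PV: "\<And>x V. V \<in> strategies \<Omega> F \<Longrightarrow> controlled_law \<Omega> F X P x V (PV x V)"
  shows "((\<lambda>h. INF V\<in>grid_strategies \<Omega> F h. discounted_average_cost X \<beta> g c (PV x V) V)
           \<longlongrightarrow> (INF V\<in>strategies \<Omega> F. discounted_average_cost X \<beta> g c (PV x V) V)) (at_right 0)"
proof -
  interpret S: standard_process \<Omega> F X P by (rule process)
  have "control_problem \<Omega> F X P g c c\<^sub>0 \<beta> PV"
  proof (unfold_locales)
    show "continuous_on UNIV g" "continuous_on UNIV (\<lambda>(x, \<xi>). c x \<xi>)"
      using g c by (auto simp: bcontfun_def)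
  qed (fact compact_E feller c0 c_triangle beta_range beta_decreasing beta_continuous beta_0
      beta_supermult beta_integral PV)+
  then show ?thesis by (rule control_problem.grid_values_converge)
qed

end
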